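(* Let $s>\frac12$, let $u\in L^2_s(\mathbb{R})$ be real-valued, let $k\in(\mathbb{C}\setminus[0,\infty))\cup(\mathbb{R}^+\pm0i)$ and $\lambda>0$. Let $m_1(x,k)$, $m_e(x,\lambda+0i)$ be the Jost solutions and $$\Gamma(\lambda)=1+i\int_{\mathbb{R}}u(x)m_e(x,\lambda+0i)e^{-i\lambda x}\,dx,\qquad \beta(\lambda)=i\int_{\mathbb{R}}u(x)m_1(x,\lambda+0i)e^{-i\lambda x}\,dx.$$ Then $$\lim_{k\to\infty}m_1(x,k)=1,\qquad \lim_{\lambda\to\infty}\Big(m_e(x,\lambda+0i)-e^{i\lambda x}e^{i\int_{-\infty}^xu(t)\,dt}\Big)=0,$$ where both limits hold in $L^\infty(\mathbb{R})$ norm (in $x$); $$\Gamma(\lambda)-e^{i\int_{\mathbb{R}}u(t)\,dt}=O\Big(\frac1\lambda\Big)\quad\text{as }\lambda\to\infty;$$ and, for any fixed $a>0$, $$\beta\in L^2(a,\infty),\qquad\lim_{\lambda\to\infty}\beta(\lambda)=0.$$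
   Context: Notation. $w(x)=1+|x|$; $L^p_s(\mathbb{R})=\{f: w^sf\in L^p(\mathbb{R})\}$ with norm $\|w^sf\|_p$. $\mathbb{R}^+=(0,\infty)$, $\mathbb{R}^-=(-\infty,0)$. $\mathbb{R}^+\pm0i$ denotes two copies of $(0,\infty)$ with points $\lambda+0i$, $\lambda-0i$, regarded as the upper and lower edges of the cut along $(0,\infty)$; $k\to\infty$ means $|k|\to\infty$ in the cut plane including both edges. Kernels: $G_k(x)=\frac1{2\pi}\int_0^\infty\frac{e^{ix\xi}}{\xi-k}d\xi$ for $k\in\mathbb{C}\setminus[0,\infty)$; for $\lambda>0$, $G_{\lambda\pm0i}(x)=\pm ie^{i\lambda x}\chi_{\mathbb{R}^\pm}(x)-\widetilde G_\lambda(x)$, where $\widetilde G_\lambda(x)=\frac1{2\pi}\int_{-\infty}^0\frac{e^{ix\xi}}{\xi-\lambda}d\xi$. Jost solutions: with any fixed $s_1\in(\frac12,s)$, $m_1(\cdot,k)$ and $m_e(\cdot,\lambda+0i)$ are the unique functions in $L^\infty_{-(s-s_1)}(\mathbb{R})$ with $m_1(\cdot,k)=1+G_k*(u\,m_1(\cdot,k))$ and $m_e(\cdot,\lambda+0i)=e^{i\lambda x}+G_{\lambda+0i}*(u\,m_e(\cdot,\lambda+0i))$. It is known that these exist for all $k\in\mathbb{R}^+\pm0i$ and all $\lambda>0$, and for all $k\in\mathbb{C}\setminus[0,\infty)$ with $|k|$ sufficiently large, and that they lie in $L^\infty(\mathbb{R})$. *)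

theory Defs
  imports
    "HOL-Analysis.Analysis"
    "HOL-Probability.Essential_Supremum"
    "HOL-Library.Landau_Symbols"
begin

section \<open>Weighted Lebesgue spaces\<close>

definition weighted :: "real \<Rightarrow> (real \<Rightarrow> 'b::real_normed_vector) \<Rightarrow> real \<Rightarrow> 'b"
  where "weighted s f x = (1 + \<bar>x\<bar>) powr s *\<^sub>R f x"

definition in_L2 :: "'a measure \<Rightarrow> ('a \<Rightarrow> 'b::real_normed_vector) \<Rightarrow> bool"
  where "in_L2 M f \<longleftrightarrow> f \<in> borel_measurable M \<and> integrable M (\<lambda>x. (norm (f x))\<^sup>2)"

definition Linf_norm :: "'a measure \<Rightarrow> ('a \<Rightarrow> 'b::real_normed_vector) \<Rightarrow> ereal"
  where "Linf_norm M f = esssup M (\<lambda>x. ereal (norm (f x)))"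

definition in_Linf :: "'a measure \<Rightarrow> ('a \<Rightarrow> 'b::real_normed_vector) \<Rightarrow> bool"
  where "in_Linf M f \<longleftrightarrow> f \<in> borel_measurable M \<and> Linf_norm M f < \<infinity>"


section \<open>The plane cut along the positive half line\<close>

text \<open>\<open>Interior k\<close> is a point off the cut, while \<open>Upper l\<close> and \<open>Lower l\<close> are the points
  \<open>l + 0i\<close> and \<open>l - 0i\<close> on the two edges. Neither edge contains the branch point \<open>0\<close>.\<close>

datatype cut_point = Interior complex | Upper real | Lower real

definition cut_plane :: "cut_point set"
  where "cut_plane =
    Interior ` (- complex_of_real ` {0..}) \<union> Upper ` {0<..} \<union> Lower ` {0<..}"

fun cut_abs :: "cut_point \<Rightarrow> real" where
  "cut_abs (Interior k) = cmod k"
| "cut_abs (Upper l) = \<bar>l\<bar>"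
| "cut_abs (Lower l) = \<bar>l\<bar>"

text \<open>The filter of \<open>k \<rightarrow> \<infinity>\<close>: the absolute value of \<open>k\<close> tends to infinity and \<open>k\<close> ranges
  over the whole cut plane, including both edges.\<close>

definition cut_infinity :: "cut_point filter"
  where "cut_infinity = inf (filtercomap cut_abs at_top) (principal cut_plane)"


section \<open>The kernels\<close>

text \<open>The integrals over half lines converge only conditionally (for \<open>x \<noteq> 0\<close>), so they are
  written as limits of integrals over bounded intervals. At \<open>x = 0\<close> they diverge and
  the kernel has an arbitrary value there, which does not affect convolutions.\<close>

definition G_off :: "complex \<Rightarrow> real \<Rightarrow> complex"
  where "G_off k x = 1 / (2 * of_real pi) *
    Lim at_top (\<lambda>R::real. integral {0..R}
      (\<lambda>\<xi>. exp (\<i> * of_real (x * \<xi>)) / (of_real \<xi> - k)))"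

definition G_tilde :: "real \<Rightarrow> real \<Rightarrow> complex"
  where "G_tilde l x = 1 / (2 * of_real pi) *
    Lim at_top (\<lambda>R::real. integral {-R..0}
      (\<lambda>\<xi>. exp (\<i> * of_real (x * \<xi>)) / of_real (\<xi> - l)))"

fun G_kernel :: "cut_point \<Rightarrow> real \<Rightarrow> complex" where
  "G_kernel (Interior k) x = G_off k x"
| "G_kernel (Upper l) x =
    \<i> * exp (\<i> * of_real (l * x)) * indicator {0<..} x - G_tilde l x"
| "G_kernel (Lower l) x =
    - \<i> * exp (\<i> * of_real (l * x)) * indicator {..<0} x - G_tilde l x"

definition convolution :: "(real \<Rightarrow> complex) \<Rightarrow> (real \<Rightarrow> complex) \<Rightarrow> real \<Rightarrow> complex"
  where "convolution g f x = (LINT y|lebesgue. g (x - y) * f y)"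


section \<open>Jost solutions\<close>

text \<open>\<open>solves_jost r u k h m\<close>: \<open>m\<close> lies in the weighted space with weight exponent \<open>-r\<close> and
  satisfies \<open>m = h + G\<^sub>k * (u m)\<close>. Elements of these spaces are functions up to
  null sets, so both the equation and uniqueness are understood almost everywhere.\<close>

definition solves_jost ::
    "real \<Rightarrow> (real \<Rightarrow> real) \<Rightarrow> cut_point \<Rightarrow> (real \<Rightarrow> complex) \<Rightarrow> (real \<Rightarrow> complex) \<Rightarrow> bool"
  where "solves_jost r u k h m \<longleftrightarrow>
    in_Linf lebesgue (weighted (- r) m) \<and>
    (AE x in lebesgue.
      m x = h x + convolution (G_kernel k) (\<lambda>y. of_real (u y) * m y) x)"

definition is_jost ::
    "real \<Rightarrow> (real \<Rightarrow> real) \<Rightarrow> cut_point \<Rightarrow> (real \<Rightarrow> complex) \<Rightarrow> (real \<Rightarrow> complex) \<Rightarrow> bool"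
  where "is_jost r u k h m \<longleftrightarrow>
    solves_jost r u k h m \<and>
    (\<forall>n. solves_jost r u k h n \<longrightarrow> (AE x in lebesgue. n x = m x))"

definition is_jost_1 :: "real \<Rightarrow> (real \<Rightarrow> real) \<Rightarrow> cut_point \<Rightarrow> (real \<Rightarrow> complex) \<Rightarrow> bool"
  where "is_jost_1 r u k m \<longleftrightarrow> is_jost r u k (\<lambda>x. 1) m"

definition is_jost_e :: "real \<Rightarrow> (real \<Rightarrow> real) \<Rightarrow> real \<Rightarrow> (real \<Rightarrow> complex) \<Rightarrow> bool"
  where "is_jost_e r u l m \<longleftrightarrow>
    is_jost r u (Upper l) (\<lambda>x. exp (\<i> * of_real (l * x))) m"


section \<open>Scattering coefficients\<close>

text \<open>Here \<open>m1 k\<close> is the function \<open>m\<^sub>1(\<cdot>, k)\<close>, and \<open>me l\<close> is \<open>m\<^sub>e(\<cdot>, l + 0i)\<close>.\<close>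

definition Gamma_coeff :: "(real \<Rightarrow> real) \<Rightarrow> (real \<Rightarrow> real \<Rightarrow> complex) \<Rightarrow> real \<Rightarrow> complex"
  where "Gamma_coeff u me l =
    1 + \<i> * (LINT x|lebesgue. of_real (u x) * me l x * exp (- (\<i> * of_real (l * x))))"

definition beta_coeff :: "(real \<Rightarrow> real) \<Rightarrow> (cut_point \<Rightarrow> real \<Rightarrow> complex) \<Rightarrow> real \<Rightarrow> complex"
  where "beta_coeff u m1 l =
    \<i> * (LINT x|lebesgue. of_real (u x) * m1 (Upper l) x * exp (- (\<i> * of_real (l * x))))"

end

theory Submission
  imports
    Defs
    "HOL-Complex_Analysis.Great_Picard"
    "HOL-Probability.Sinc_Integral"
    "HOL-Probability.Characteristic_Functions"
    "HOL-Real_Asymp.Real_Asymp"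
begin

text \<open>Write \<open>U x = \<integral>\<^sub>-\<^sub>\<infinity>\<^sup>x u\<close>. Rotating the contour turns every kernel into a wave
  \<open>\<i> exp (\<i> k x)\<close> on a half line plus a rest \<open>E\<close> with \<open>\<parallel>E\<parallel>\<^sub>2 = O(1 / sqrt \<bar>k\<bar>)\<close>; away from
  the right half plane the wave is absent. The wave part is a Volterra operator, which the integrating factor
  \<open>exp (- \<i> U)\<close> inverts explicitly. The rest is a small perturbation in \<open>L\<^sup>\<infinity>\<close>, so that up to
  \<open>O(1 / sqrt \<bar>k\<bar>)\<close> the solutions are those of the Volterra equation: \<open>exp (\<i> l x) exp (\<i> U x)\<close> for
  \<open>m\<^sub>e\<close>, and, for \<open>m\<^sub>1\<close>, the constant \<open>1\<close> plus an oscillatory integral that vanishes uniformly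
  by the Riemann-Lebesgue lemma.

  Multiplying the equation by \<open>exp (- \<i> U)\<close> expresses both coefficients as Fourier integrals at \<open>l\<close> of
  integrable and square integrable functions plus a bilinear error in \<open>E\<close>. By Plancherel the error is
  bounded by the supremum of the Fourier multiplier of \<open>E\<close>, which is \<open>1 / l\<close>; this gives the rate for
  \<open>\<Gamma>\<close> and makes \<open>\<beta>\<close> square integrable at infinity. On compact intervals \<open>\<beta>\<close> is continuous:
  solutions at convergent spectral parameters have pointwise convergent subsequences, and by uniqueness the limit
  is the solution at the limit parameter.\<close>

section \<open>Square integrable functions\<close>

text \<open>Because s > 1/2, the potential lies in both L1 and L2, and the weight brings u m into
  these spaces for every m that may grow as the Jost solutions are allowed to. The rests of the
  kernels have a logarithmic singularity at 0 and decay only like 1/|x|: they are not in L1 but in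
  L2, so their convolutions with u m are estimated by Cauchy-Schwarz, uniformly in x. This gives
  |k|^(-1/2), enough for both limits but not for the rate 1/l. Realness of u enters twice: |exp
  (\<i> U)| = 1 bounds the Volterra inverse by 1 + ||u||_1, and conjugation together with x -> -x
  carries the lower half plane and the lower edge to the upper ones. On bounded ranges of l no
  smallness is available; there the uniqueness contained in the notion of Jost solution takes the
  place of estimates. The given solutions are classes modulo Lebesgue null sets in a weighted space,
  whereas the analysis runs on bounded Borel functions that satisfy the equation at every point, so
  the transfer between the two forms a separate layer.\<close>

definition L2_nrm :: "(real \<Rightarrow> 'b::real_normed_vector) \<Rightarrow> real"
  where "L2_nrm f = sqrt (LINT x|lborel. (norm (f x))\<^sup>2)"

lemma L2_nrm_nonneg [simp]: "0 \<le> L2_nrm f"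
  by (simp add: L2_nrm_def)

lemma L2_nrm_power2: "(L2_nrm f)\<^sup>2 = (LINT x|lborel. (norm (f x))\<^sup>2)"
  by (simp add: L2_nrm_def)

lemma in_L2_measurable: "in_L2 M f \<Longrightarrow> f \<in> borel_measurable M"
  by (simp add: in_L2_def)

lemma in_L2_bound:
  assumes f: "in_L2 M f" and g: "g \<in> borel_measurable M" and le: "\<And>x. norm (g x) \<le> C * norm (f x)"
  shows "in_L2 M g"
proof -
  have 1: "integrable M (\<lambda>x. C\<^sup>2 * (norm (f x))\<^sup>2)"
    using f by (simp add: in_L2_def)
  have 2: "norm ((norm (g x))\<^sup>2) \<le> norm (C\<^sup>2 * (norm (f x))\<^sup>2)" for x
    using power_mono[OF le[of x] norm_ge_zero, where n=2] by (simp add: power_mult_distrib)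
  have "integrable M (\<lambda>x. (norm (g x))\<^sup>2)"
    by (rule Bochner_Integration.integrable_bound[OF 1 _ AE_I2[OF 2]]) (use g in measurable)
  with g show ?thesis by (simp add: in_L2_def)
qed

lemma L2_nrm_mono:
  assumes f: "in_L2 lborel f" and g: "g \<in> borel_measurable borel" and C: "0 \<le> C"
    and le: "\<And>x. norm (g x) \<le> C * norm (f x)"
  shows "L2_nrm g \<le> C * L2_nrm f"
proof -
  have g2: "in_L2 lborel g"
    by (rule in_L2_bound[OF f _ le]) (use g in simp)
  have "(LINT x|lborel. (norm (g x))\<^sup>2) \<le> (LINT x|lborel. C\<^sup>2 * (norm (f x))\<^sup>2)"
  proof (rule integral_mono)
    show "(norm (g x))\<^sup>2 \<le> C\<^sup>2 * (norm (f x))\<^sup>2" for x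
      using power_mono[OF le[of x] norm_ge_zero, where n=2] by (simp add: power_mult_distrib)
  qed (use f g2 in \<open>auto simp: in_L2_def\<close>)
  then have "sqrt (LINT x|lborel. (norm (g x))\<^sup>2) \<le> sqrt (C\<^sup>2 * (LINT x|lborel. (norm (f x))\<^sup>2))"
    by simp
  then show ?thesis
    using C by (simp add: L2_nrm_def real_sqrt_mult)
qed

lemma in_L2_mult_integrable:
  assumes "in_L2 M f" "in_L2 M g"
  shows "integrable M (\<lambda>x. norm (f x) * norm (g x))"
proof -
  have 1: "integrable M (\<lambda>x. (norm (f x))\<^sup>2 + (norm (g x))\<^sup>2)"
    using assms by (simp add: in_L2_def)
  have 2: "norm (norm (f x) * norm (g x)) \<le> norm ((norm (f x))\<^sup>2 + (norm (g x))\<^sup>2)" for x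
    using sum_squares_bound[of "norm (f x)" "norm (g x)", unfolded mult.assoc]
      mult_nonneg_nonneg[OF norm_ge_zero[of "f x"] norm_ge_zero[of "g x"]]
    by (simp only: real_norm_def abs_of_nonneg[OF add_nonneg_nonneg[OF zero_le_power2 zero_le_power2]] abs_of_nonneg)
  show ?thesis
    by (rule Bochner_Integration.integrable_bound[OF 1 _ AE_I2[OF 2]])
      (use assms[THEN in_L2_measurable] in measurable)
qed

lemma L2_Cauchy_Schwarz:
  assumes f: "in_L2 lborel f" and g: "in_L2 lborel g"
  shows "(LINT x|lborel. norm (f x) * norm (g x)) \<le> L2_nrm f * L2_nrm g"
proof -
  have int: "integrable lborel (\<lambda>x. norm (f x) * norm (g x))"
    by (rule in_L2_mult_integrable[OF f g])
  have [measurable]: "f \<in> borel_measurable borel" "g \<in> borel_measurable borel"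
    using f g by (auto simp: in_L2_def)
  have 1: "(\<integral>\<^sup>+x. ennreal (norm (f x)) * ennreal (norm (g x)) \<partial>lborel)\<^sup>2
      \<le> (\<integral>\<^sup>+x. ennreal (norm (f x)) ^ 2 \<partial>lborel) * (\<integral>\<^sup>+x. ennreal (norm (g x)) ^ 2 \<partial>lborel)"
    by (rule Cauchy_Schwarz_nn_integral) auto
  have 2: "(\<integral>\<^sup>+x. ennreal (norm (f x)) * ennreal (norm (g x)) \<partial>lborel)
      = ennreal (LINT x|lborel. norm (f x) * norm (g x))"
    by (subst nn_integral_eq_integral[OF int, symmetric]) (auto simp: ennreal_mult)
  have 3: "(\<integral>\<^sup>+x. ennreal (norm (h x)) ^ 2 \<partial>lborel) = ennreal ((L2_nrm h)\<^sup>2)"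
    if "in_L2 lborel h" for h :: "real \<Rightarrow> 'c::real_normed_vector"
    unfolding L2_nrm_power2 using that
    by (subst nn_integral_eq_integral[symmetric]) (auto simp: in_L2_def ennreal_power)
  have "(ennreal (LINT x|lborel. norm (f x) * norm (g x)))\<^sup>2
      \<le> ennreal ((L2_nrm f)\<^sup>2) * ennreal ((L2_nrm g)\<^sup>2)"
    using 1 unfolding 2 3[OF f] 3[OF g] .
  then have "ennreal ((LINT x|lborel. norm (f x) * norm (g x))\<^sup>2)
      \<le> ennreal ((L2_nrm f * L2_nrm g)\<^sup>2)"
    by (simp add: ennreal_power ennreal_mult'' power_mult_distrib)
  then have "(LINT x|lborel. norm (f x) * norm (g x))\<^sup>2 \<le> (L2_nrm f * L2_nrm g)\<^sup>2"
    by (subst (asm) ennreal_le_iff) simp_all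
  then show ?thesis
    by (rule power2_le_imp_le) simp
qed

lemma in_L2_reflect:
  fixes f :: "real \<Rightarrow> 'b::real_normed_vector"
  assumes "in_L2 lborel f"
  shows "in_L2 lborel (\<lambda>y. f (x - y))"
  using assms lborel_integrable_real_affine[of "\<lambda>y. (norm (f y))\<^sup>2" "-1" x]
  by (auto simp: in_L2_def)

lemma L2_nrm_reflect: "L2_nrm (\<lambda>y. f (x - y)) = L2_nrm f"
  unfolding L2_nrm_def
  by (subst (2) lborel_integral_real_affine[of "-1" _ x]) auto

text \<open>Reflection and translation leave the L2 norm unchanged, so the bound is uniform in x.
  Every rest term is controlled in the supremum norm in this way.\<close>

lemma integral_convolution_bound:
  fixes E b :: "real \<Rightarrow> 'b::{real_normed_algebra,second_countable_topology,banach}"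
  assumes E: "in_L2 lborel E" and b: "in_L2 lborel b"
  shows "integrable lborel (\<lambda>y. E (x - y) * b y)"
    and "norm (LINT y|lborel. E (x - y) * b y) \<le> L2_nrm E * L2_nrm b"
proof -
  have [measurable]: "E \<in> borel_measurable borel" "b \<in> borel_measurable borel"
    using E b by (auto simp: in_L2_def)
  have int: "integrable lborel (\<lambda>y. norm (E (x - y)) * norm (b y))"
    by (rule in_L2_mult_integrable[OF in_L2_reflect[OF E] b])
  show 1: "integrable lborel (\<lambda>y. E (x - y) * b y)"
    by (rule Bochner_Integration.integrable_bound[OF int]) (auto simp: norm_mult_ineq)
  have "norm (LINT y|lborel. E (x - y) * b y) \<le> (LINT y|lborel. norm (E (x - y)) * norm (b y))"
    by (rule order_trans[OF integral_norm_bound integral_mono[OF integrable_norm[OF 1] int]])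
      (auto simp: norm_mult_ineq)
  also have "\<dots> \<le> L2_nrm E * L2_nrm b"
    using L2_Cauchy_Schwarz[OF in_L2_reflect[OF E] b] by (simp add: L2_nrm_reflect)
  finally show "norm (LINT y|lborel. E (x - y) * b y) \<le> L2_nrm E * L2_nrm b" .
qed

section \<open>Primitives\<close>

text \<open>Absolute continuity in integrated form. The densities are merely locally integrable, so
  derivatives exist only almost everywhere; the product rule, the chain rule and uniqueness are
  proved from increments instead.\<close>

definition primitive :: "(real \<Rightarrow> complex) \<Rightarrow> (real \<Rightarrow> complex) \<Rightarrow> bool"
  where "primitive F f \<longleftrightarrow> (\<forall>a b. a \<le> b \<longrightarrow>
    f absolutely_integrable_on {a..b} \<and> (f has_integral F b - F a) {a..b})"

text \<open>Summing over fine partitions, an error that is quadratic in an absolutely continuous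
  quantity disappears. This replaces differentiation almost everywhere.\<close>

lemma primitiveI_quadratic:
  fixes f F :: "real \<Rightarrow> complex" and g :: "real \<Rightarrow> real"
  assumes f: "\<And>a b. f absolutely_integrable_on {a..b}"
    and g: "\<And>a b. g integrable_on {a..b}" and g0: "\<And>x. 0 \<le> g x" and C: "0 \<le> C"
    and quad: "\<And>a b. a \<le> b \<Longrightarrow> norm (F b - F a - integral {a..b} f) \<le> C * (integral {a..b} g)\<^sup>2"
  shows "primitive F f"
proof -
  have fi: "f integrable_on {a..b}" for a b
    using f set_lebesgue_integral_eq_integral(1) by blast
  have eq: "F b - F a = integral {a..b} f" if ab: "a \<le> b" for a b
  proof -
    define G where "G x = integral {a..x} g" for x
    define D where "D x = F x - F a - integral {a..x} f" for x
    have Gdiff: "G y = G x + integral {x..y} g" if "a \<le> x" "x \<le> y" for x y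
      unfolding G_def using Henstock_Kurzweil_Integration.integral_combine[OF that g] by simp
    have Ddiff: "D y = D x + (F y - F x - integral {x..y} f)" if "a \<le> x" "x \<le> y" for x y
      unfolding D_def Henstock_Kurzweil_Integration.integral_combine[OF that fi, symmetric] by simp
    have uc: "uniformly_continuous_on {a..b} G"
      unfolding G_def by (intro compact_uniformly_continuous indefinite_integral_continuous_1 g) auto
    \<comment> \<open>Cut [a, b] into pieces on which G grows by at most e. A piece with increment w
      contributes C w^2 <= C e w, and the increments w add up to G b.\<close>
    have bound: "norm (D b) \<le> e * (C * G b)" if e: "0 < e" for e
    proof -
      obtain d where d: "d > 0" and dG: "\<And>x y. x \<in> {a..b} \<Longrightarrow> y \<in> {a..b} \<Longrightarrow> dist y x < d \<Longrightarrow> dist (G y) (G x) < e"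
        using uc e unfolding uniformly_continuous_on_def by metis
      obtain n :: nat where n: "(b - a) / d < real n"
        using reals_Archimedean2 by blast
      have npos: "0 < real n"
        using n ab d by (meson divide_nonneg_pos diff_ge_0_iff_ge order_le_less_trans)
      define h where "h = (b - a) / real n"
      have h: "0 \<le> h" "h < d"
        using n npos ab d by (auto simp: h_def field_simps)
      define t where "t i = a + real i * h" for i :: nat
      have ind: "norm (D (t i)) \<le> e * (C * G (t i))" if "i \<le> n" for i
        using that
      proof (induction i)
        case 0
        then show ?case by (simp add: t_def D_def G_def)
      next
        case (Suc i)
        have le: "real (Suc i) * h \<le> b - a"
          using Suc.prems npos h(1) mult_right_mono[of "real (Suc i)" "real n" h] by (simp add: h_def)
        have ti: "a \<le> t i" "t i \<le> t (Suc i)" "t (Suc i) \<le> b" "t (Suc i) - t i = h"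
          using h le by (auto simp: t_def algebra_simps)
        define w where "w = integral {t i..t (Suc i)} g"
        have w0: "0 \<le> w"
          unfolding w_def by (rule Henstock_Kurzweil_Integration.integral_nonneg[OF g]) (use g0 in auto)
        have "dist (G (t (Suc i))) (G (t i)) < e"
          by (rule dG) (use ti h in \<open>auto simp: dist_real_def\<close>)
        then have we: "w \<le> e"
          using Gdiff[OF ti(1,2)] w0 by (simp add: w_def dist_real_def)
        have "norm (D (t (Suc i))) \<le> norm (D (t i)) + C * w\<^sup>2"
          unfolding Ddiff[OF ti(1,2)] w_def
          by (rule order_trans[OF norm_triangle_ineq]) (use quad[OF ti(2)] in simp)
        also have "C * w\<^sup>2 \<le> C * (e * w)"
          using C w0 we by (intro mult_left_mono) (auto simp: power2_eq_square intro: mult_right_mono)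
        also have "norm (D (t i)) \<le> e * (C * G (t i))"
          using Suc by simp
        finally show ?case
          using Gdiff[OF ti(1,2)] by (simp add: w_def algebra_simps)
      qed
      have "t n = b"
        using npos by (simp add: t_def h_def)
      with ind[of n] show ?thesis by simp
    qed
    have "norm (D b) \<le> 0"
    proof (rule field_le_epsilon)
      fix e :: real assume e: "0 < e"
      define K where "K = \<bar>C * G b\<bar> + 1"
      have K: "0 < K" "C * G b \<le> K" by (auto simp: K_def)
      have "norm (D b) \<le> e / K * (C * G b)"
        by (rule bound) (use e K in simp)
      also have "\<dots> \<le> e / K * K"
        using e K by (intro mult_left_mono) auto
      finally show "norm (D b) \<le> 0 + e" using K by simp
    qed
    then show ?thesis by (simp add: D_def)
  qed
  show ?thesis
    unfolding primitive_def using f eq fi by (metis integrable_integral)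
qed

section \<open>Calculus of primitives: continuity, products and exponentials\<close>

lemma primitive_continuous:
  assumes "primitive F f" shows "continuous_on {a..b} F"
proof -
  have fi: "f integrable_on {a..b}"
    using assms by (cases "a \<le> b") (auto simp: primitive_def integrable_on_def)
  have "continuous_on {a..b} (\<lambda>x. F a + integral {a..x} f)"
    by (intro continuous_intros indefinite_integral_continuous_1 fi)
  moreover have "F a + integral {a..x} f = F x" if "x \<in> {a..b}" for x
  proof -
    have "a \<le> x" using that by simp
    then have "(f has_integral F x - F a) {a..x}"
      using assms unfolding primitive_def by blast
    then show ?thesis by (simp add: integral_unique)
  qed
  ultimately show ?thesis
    by (metis (no_types, lifting) continuous_on_cong)
qed

lemma primitive_integral:
  assumes "primitive F f" "a \<le> b" shows "integral {a..b} f = F b - F a"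
  using assms unfolding primitive_def by (blast dest: integral_unique)

lemma primitive_integrable:
  assumes "primitive F f"
  shows "f absolutely_integrable_on {a..b}" "f integrable_on {a..b}"
proof -
  show "f absolutely_integrable_on {a..b}"
    using assms by (cases "a \<le> b") (auto simp: primitive_def)
  then show "f integrable_on {a..b}"
    using set_lebesgue_integral_eq_integral(1) by blast
qed

lemma primitive_norm_diff_le:
  assumes F: "primitive F f" and g: "g integrable_on {a..b}" and le: "\<And>x. norm (f x) \<le> g x"
    and y: "a \<le> x" "x \<le> y" "y \<le> b"
  shows "norm (F y - F x) \<le> integral {a..b} g"
proof -
  have "norm (F y - F x) \<le> integral {x..y} g"
    unfolding primitive_integral[OF F y(2), symmetric]
    by (intro integral_norm_bound_integral primitive_integrable[OF F] le
        integrable_subinterval_real[OF g]) (use y in auto)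
  also have "\<dots> \<le> integral {a..b} g"
    by (intro integral_subset_le integrable_subinterval_real[OF g] g)
      (use y le norm_ge_zero order_trans in \<open>auto, blast\<close>)
  finally show ?thesis .
qed

lemma absolutely_integrable_continuous_mult:
  fixes f F :: "real \<Rightarrow> complex"
  assumes f: "f absolutely_integrable_on {a..b}" and F: "continuous_on {a..b} F"
  shows "(\<lambda>x. F x * f x) absolutely_integrable_on {a..b}"
proof (rule absolutely_integrable_bounded_measurable_product[where h="(*)"])
  show "F \<in> borel_measurable (lebesgue_on {a..b})"
    using F by (intro continuous_imp_measurable_on_sets_lebesgue) auto
  show "bilinear ((*) :: complex \<Rightarrow> complex \<Rightarrow> complex)"
    using bilinear_conv_bounded_bilinear bounded_bilinear_mult by blast
  show "bounded (F ` {a..b})"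
    using F by (intro compact_imp_bounded compact_continuous_image) auto
qed (use f in auto)

text \<open>The deviation from the product rule on [a, b] is the integral of f (G a - G), plus that
  of (F a - F) g, plus the product of the two increments. With P and Q the integrals of |f| and |g|,
  each of the three is at most P Q <= (P + Q)^2, whence the constant 3.\<close>

lemma primitive_mult:
  assumes F: "primitive F f" and G: "primitive G g"
  shows "primitive (\<lambda>x. F x * G x) (\<lambda>x. f x * G x + F x * g x)"
proof (rule primitiveI_quadratic[where g="\<lambda>x. norm (f x) + norm (g x)" and C=3])
  note ff = primitive_integrable[OF F] and gg = primitive_integrable[OF G]
  note Fc = primitive_continuous[OF F] and Gc = primitive_continuous[OF G]
  fix a b :: real
  have nf: "(\<lambda>x. norm (f x)) integrable_on {a..b}" and ng: "(\<lambda>x. norm (g x)) integrable_on {a..b}"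
    using ff(1)[of a b] gg(1)[of a b] unfolding absolutely_integrable_on_def by auto
  show "(\<lambda>x. norm (f x) + norm (g x)) integrable_on {a..b}"
    by (intro integrable_add nf ng)
  have 1: "(\<lambda>x. f x * G x) absolutely_integrable_on {a..b}"
    using absolutely_integrable_continuous_mult[OF ff(1) Gc] by (simp add: mult.commute)
  have 2: "(\<lambda>x. F x * g x) absolutely_integrable_on {a..b}"
    by (rule absolutely_integrable_continuous_mult[OF gg(1) Fc])
  show "(\<lambda>x. f x * G x + F x * g x) absolutely_integrable_on {a..b}"
    using 1 2 by (rule set_integral_add(1))
  have 1: "(\<lambda>x. f x * G x) integrable_on {a..b}" and 2: "(\<lambda>x. F x * g x) integrable_on {a..b}"
    using 1 2 set_lebesgue_integral_eq_integral(1) by blast+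
  assume ab: "a \<le> b"
  define P where "P = integral {a..b} (\<lambda>x. norm (f x))"
  define Q where "Q = integral {a..b} (\<lambda>x. norm (g x))"
  have P0: "0 \<le> P" and Q0: "0 \<le> Q"
    unfolding P_def Q_def by (auto intro!: Henstock_Kurzweil_Integration.integral_nonneg nf ng)
  have b1: "norm (integral {a..b} (\<lambda>x. f x * (G a - G x))) \<le> P * Q"
  proof -
    have "norm (integral {a..b} (\<lambda>x. f x * (G a - G x))) \<le> integral {a..b} (\<lambda>x. norm (f x) * Q)"
    proof (rule integral_norm_bound_integral)
      show "(\<lambda>x. f x * (G a - G x)) integrable_on {a..b}"
        using integrable_diff[OF integrable_on_mult_left[OF ff(2), of "G a"] 1]
        by (simp add: algebra_simps)
      fix x assume "x \<in> {a..b}"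
      then have "norm (G x - G a) \<le> Q"
        unfolding Q_def by (intro primitive_norm_diff_le[OF G ng]) auto
      then show "norm (f x * (G a - G x)) \<le> norm (f x) * Q"
        by (auto simp: norm_mult norm_minus_commute intro: mult_left_mono)
    qed (intro integrable_on_mult_left nf)
    then show ?thesis by (simp add: P_def)
  qed
  have b2: "norm (integral {a..b} (\<lambda>x. (F a - F x) * g x)) \<le> P * Q"
  proof -
    have "norm (integral {a..b} (\<lambda>x. (F a - F x) * g x)) \<le> integral {a..b} (\<lambda>x. P * norm (g x))"
    proof (rule integral_norm_bound_integral)
      show "(\<lambda>x. (F a - F x) * g x) integrable_on {a..b}"
        using integrable_diff[OF integrable_on_mult_right[OF gg(2), of "F a"] 2]
        by (simp add: algebra_simps)
      fix x assume "x \<in> {a..b}"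
      then have "norm (F x - F a) \<le> P"
        unfolding P_def by (intro primitive_norm_diff_le[OF F nf]) auto
      then show "norm ((F a - F x) * g x) \<le> P * norm (g x)"
        by (auto simp: norm_mult norm_minus_commute intro: mult_right_mono)
    qed (intro integrable_on_mult_right ng)
    then show ?thesis by (simp add: Q_def)
  qed
  have b3: "norm ((F b - F a) * (G b - G a)) \<le> P * Q"
    unfolding norm_mult P_def Q_def
    by (intro mult_mono primitive_norm_diff_le[OF F nf] primitive_norm_diff_le[OF G ng])
      (use ab in \<open>auto intro!: Henstock_Kurzweil_Integration.integral_nonneg nf\<close>)
  have i1: "integral {a..b} (\<lambda>x. f x * (G a - G x)) = (F b - F a) * G a - integral {a..b} (\<lambda>x. f x * G x)"
    using integral_diff[OF integrable_on_mult_left[OF ff(2), of "G a"] 1]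
    by (simp add: algebra_simps primitive_integral[OF F ab])
  have i2: "integral {a..b} (\<lambda>x. (F a - F x) * g x) = F a * (G b - G a) - integral {a..b} (\<lambda>x. F x * g x)"
    using integral_diff[OF integrable_on_mult_right[OF gg(2), of "F a"] 2]
    by (simp add: algebra_simps primitive_integral[OF G ab])
  have "F b * G b - F a * G a - integral {a..b} (\<lambda>x. f x * G x + F x * g x)
      = integral {a..b} (\<lambda>x. f x * (G a - G x)) + integral {a..b} (\<lambda>x. (F a - F x) * g x)
        + (F b - F a) * (G b - G a)"
    unfolding i1 i2 integral_add[OF 1 2] by (simp add: algebra_simps)
  also have "norm \<dots> \<le> P * Q + P * Q + P * Q"
    by (intro norm_triangle_mono b1 b2 b3)
  also have "\<dots> \<le> 3 * (P + Q)\<^sup>2"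
    using P0 Q0 by (simp add: power2_eq_square algebra_simps)
  also have "P + Q = integral {a..b} (\<lambda>x. norm (f x) + norm (g x))"
    unfolding P_def Q_def by (rule integral_add[OF nf ng, symmetric])
  finally show "norm (F b * G b - F a * G a - integral {a..b} (\<lambda>x. f x * G x + F x * g x))
     \<le> 3 * (integral {a..b} (\<lambda>x. norm (f x) + norm (g x)))\<^sup>2" .
qed auto

lemma exp_i_diff_le: "cmod (iexp x - iexp y) \<le> \<bar>x - y\<bar>"
proof -
  have "iexp x - iexp y = iexp y * (iexp (x - y) - 1)"
    by (simp add: algebra_simps flip: exp_add)
  then show ?thesis
    using iexp_approx1[of "x - y" 0] by (simp add: norm_mult)
qed

text \<open>Taylor's formula of second order at V a leaves an error of at most the squared increment
  of V, and freezing the exponential at V a inside the integral costs another such square. Together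
  they give the constant 2.\<close>

lemma primitive_exp:
  fixes v V :: "real \<Rightarrow> real"
  assumes V: "primitive (\<lambda>x. of_real (V x)) (\<lambda>x. of_real (v x))"
  shows "primitive (\<lambda>x. iexp (V x)) (\<lambda>x. \<i> * of_real (v x) * iexp (V x))"
proof (rule primitiveI_quadratic[where g="\<lambda>x. \<bar>v x\<bar>" and C=2])
  note vv = primitive_integrable[OF V] and Vc = primitive_continuous[OF V]
  fix a b :: real
  have nv: "(\<lambda>x. \<bar>v x\<bar>) integrable_on {a..b}"
    using vv(1)[of a b] unfolding absolutely_integrable_on_def by auto
  show "(\<lambda>x. \<bar>v x\<bar>) integrable_on {a..b}" by (rule nv)
  have 1: "(\<lambda>x. (\<i> * iexp (V x)) * of_real (v x)) absolutely_integrable_on {a..b}"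
    by (intro absolutely_integrable_continuous_mult[OF vv(1)] continuous_intros Vc)
  then show "(\<lambda>x. \<i> * of_real (v x) * iexp (V x)) absolutely_integrable_on {a..b}"
    by (simp add: mult_ac)
  then have 1: "(\<lambda>x. \<i> * of_real (v x) * iexp (V x)) integrable_on {a..b}"
    using set_lebesgue_integral_eq_integral(1) by blast
  assume ab: "a \<le> b"
  define P where "P = integral {a..b} (\<lambda>x. \<bar>v x\<bar>)"
  have quad: "norm (iexp x - iexp y - \<i> * of_real (x - y) * iexp y) \<le> \<bar>x - y\<bar>\<^sup>2" for x y :: real
  proof -
    have "iexp x - iexp y - \<i> * of_real (x - y) * iexp y
       = iexp y * (iexp (x - y) - (1 + \<i> * of_real (x - y)))"
      by (simp add: algebra_simps flip: exp_add)
    moreover have "norm (iexp (x - y) - (1 + \<i> * of_real (x - y))) \<le> \<bar>x - y\<bar>\<^sup>2 / 2"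
      using iexp_approx1[of "x - y" 1] by (simp add: power2_eq_square)
    ultimately show ?thesis
      by (simp add: norm_mult del: of_real_diff) (smt (verit) zero_le_power2)
  qed
  have VP: "\<bar>V x - V a\<bar> \<le> P" if "x \<in> {a..b}" for x
  proof -
    have "norm (complex_of_real (V x) - of_real (V a)) \<le> P"
      unfolding P_def by (intro primitive_norm_diff_le[OF V nv]) (use that in auto)
    then show ?thesis
      by (metis norm_of_real of_real_diff)
  qed
  have b1: "norm (integral {a..b} (\<lambda>x. \<i> * of_real (v x) * (iexp (V a) - iexp (V x)))) \<le> P * P"
  proof -
    have "norm (integral {a..b} (\<lambda>x. \<i> * of_real (v x) * (iexp (V a) - iexp (V x))))
       \<le> integral {a..b} (\<lambda>x. \<bar>v x\<bar> * P)"
    proof (rule integral_norm_bound_integral)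
      show "(\<lambda>x. \<i> * of_real (v x) * (iexp (V a) - iexp (V x))) integrable_on {a..b}"
        using integrable_diff[OF integrable_on_mult_right[OF vv(2), of "\<i> * iexp (V a)"] 1]
        by (simp add: algebra_simps)
      fix x assume "x \<in> {a..b}"
      then have "\<bar>V a - V x\<bar> \<le> P" using VP by (metis abs_minus_commute)
      then have "norm (iexp (V a) - iexp (V x)) \<le> P"
        using exp_i_diff_le[of "V a" "V x"] by linarith
      then show "norm (\<i> * of_real (v x) * (iexp (V a) - iexp (V x))) \<le> \<bar>v x\<bar> * P"
        by (auto simp: norm_mult intro: mult_left_mono)
    qed (intro integrable_on_mult_left nv)
    then show ?thesis by (simp add: P_def)
  qed
  have i1: "integral {a..b} (\<lambda>x. \<i> * of_real (v x) * (iexp (V a) - iexp (V x)))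
    = \<i> * of_real (V b - V a) * iexp (V a) - integral {a..b} (\<lambda>x. \<i> * of_real (v x) * iexp (V x))"
    using integral_diff[OF integrable_on_mult_right[OF vv(2), of "\<i> * iexp (V a)"] 1]
    by (simp add: algebra_simps primitive_integral[OF V ab])
  have "iexp (V b) - iexp (V a) - integral {a..b} (\<lambda>x. \<i> * of_real (v x) * iexp (V x))
    = (iexp (V b) - iexp (V a) - \<i> * of_real (V b - V a) * iexp (V a))
     + integral {a..b} (\<lambda>x. \<i> * of_real (v x) * (iexp (V a) - iexp (V x)))"
    unfolding i1 by simp
  also have "norm \<dots> \<le> \<bar>V b - V a\<bar>\<^sup>2 + P * P"
    by (intro norm_triangle_mono b1 quad)
  also have "\<bar>V b - V a\<bar>\<^sup>2 \<le> P\<^sup>2"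
    using VP[of b] ab by (intro power_mono) auto
  finally show "norm (iexp (V b) - iexp (V a) - integral {a..b} (\<lambda>x. \<i> * of_real (v x) * iexp (V x))) \<le> 2 * (integral {a..b} (\<lambda>x. \<bar>v x\<bar>))\<^sup>2"
    by (simp add: P_def power2_eq_square)
qed auto

section \<open>Integrals with exponential phases\<close>

text \<open>Convolution of \<open>w\<close> with exp (\<i> k x) on the positive half line: the
  Volterra operator inside the kernels, without its factor \<i>. Since x - y >= 0 in the exponent,
  it is bounded by the L1 norm of \<open>w\<close> whenever Im k >= 0.\<close>

definition phase_int :: "complex \<Rightarrow> (real \<Rightarrow> complex) \<Rightarrow> real \<Rightarrow> complex"
  where "phase_int k w x = (LINT y:{..x}|lborel. exp (\<i> * k * of_real (x - y)) * w y)"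

lemma norm_exp_phase_le: "0 \<le> Im k \<Longrightarrow> y \<le> x \<Longrightarrow> norm (exp (\<i> * k * of_real (x - y))) \<le> 1"
  by (simp add: norm_exp)

lemma phase_int_integrable:
  assumes w: "integrable lborel w" and k: "0 \<le> Im k"
  shows "set_integrable lborel {..x} (\<lambda>y. exp (\<i> * k * of_real (x - y)) * w y)"
proof -
  have [measurable]: "w \<in> borel_measurable borel"
    using w by auto
  have le: "norm (indicator {..x} y *\<^sub>R (exp (\<i> * k * of_real (x - y)) * w y)) \<le> norm (w y)" for y
    using norm_exp_phase_le[OF k, of y x] by (auto simp: indicator_def norm_mult mult_left_le_one_le)
  show ?thesis
    unfolding set_integrable_def
    by (rule Bochner_Integration.integrable_bound[OF w _ AE_I2[OF le]]) measurable
qed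

lemma norm_phase_int_le:
  assumes w: "integrable lborel w" and k: "0 \<le> Im k"
  shows "norm (phase_int k w x) \<le> (LINT y|lborel. norm (w y))"
proof -
  have le: "norm (indicator {..x} y *\<^sub>R (exp (\<i> * k * of_real (x - y)) * w y)) \<le> norm (w y)" for y
    using norm_exp_phase_le[OF k, of y x] by (auto simp: indicator_def norm_mult mult_left_le_one_le)
  show ?thesis
    unfolding phase_int_def set_lebesgue_integral_def
    by (rule order_trans[OF integral_norm_bound integral_mono[OF integrable_norm integrable_norm[OF w]]])
      (use le phase_int_integrable[OF w k, of x] in \<open>auto simp: set_integrable_def\<close>)
qed

lemma phase_int_add:
  assumes "integrable lborel v" "integrable lborel w" "0 \<le> Im k"
  shows "phase_int k (\<lambda>y. v y + w y) x = phase_int k v x + phase_int k w x"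
  using set_integral_add(2)[OF phase_int_integrable[OF assms(1,3), of x] phase_int_integrable[OF assms(2,3), of x]]
  unfolding phase_int_def by (simp add: distrib_left)

lemma phase_int_diff:
  assumes "integrable lborel v" "integrable lborel w" "0 \<le> Im k"
  shows "phase_int k (\<lambda>y. v y - w y) x = phase_int k v x - phase_int k w x"
  using set_integral_diff(2)[OF phase_int_integrable[OF assms(1,3), of x] phase_int_integrable[OF assms(2,3), of x]]
  unfolding phase_int_def by (simp add: right_diff_distrib)

lemma phase_int_cmult: "phase_int k (\<lambda>y. c * w y) x = c * phase_int k w x"
proof -
  have "phase_int k (\<lambda>y. c * w y) x = (LINT y:{..x}|lborel. c * (exp (\<i> * k * of_real (x - y)) * w y))"
    unfolding phase_int_def by (simp add: mult_ac)
  then show ?thesis by (simp add: phase_int_def)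
qed

section \<open>A Riemann-Lebesgue lemma, uniform in the endpoint and over the closed upper half
  plane\<close>

definition oscillation_decay :: "(real \<Rightarrow> complex) \<Rightarrow> bool"
  where "oscillation_decay w \<longleftrightarrow> integrable lborel w \<and>
    (\<forall>e>0. \<exists>B. \<forall>k x. 0 \<le> Im k \<longrightarrow> B \<le> cmod k \<longrightarrow> norm (phase_int k w x) \<le> e)"

lemma oscillation_decay_add:
  assumes v: "oscillation_decay v" and w: "oscillation_decay w"
  shows "oscillation_decay (\<lambda>x. v x + w x)"
  unfolding oscillation_decay_def
proof (intro conjI allI impI)
  have vi: "integrable lborel v" and wi: "integrable lborel w"
    using v w by (auto simp: oscillation_decay_def)
  then show "integrable lborel (\<lambda>x. v x + w x)" by simp
  fix e :: real assume "0 < e"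
  then have e: "0 < e / 2" by simp
  obtain B where B: "\<And>k x. 0 \<le> Im k \<Longrightarrow> B \<le> cmod k \<Longrightarrow> norm (phase_int k v x) \<le> e / 2"
    using v e unfolding oscillation_decay_def by blast
  obtain D where D: "\<And>k x. 0 \<le> Im k \<Longrightarrow> D \<le> cmod k \<Longrightarrow> norm (phase_int k w x) \<le> e / 2"
    using w e unfolding oscillation_decay_def by blast
  show "\<exists>B. \<forall>k x. 0 \<le> Im k \<longrightarrow> B \<le> cmod k \<longrightarrow> norm (phase_int k (\<lambda>x. v x + w x) x) \<le> e"
  proof (intro exI allI impI)
    fix k x assume k: "0 \<le> Im k" "max B D \<le> cmod k"
    then show "norm (phase_int k (\<lambda>x. v x + w x) x) \<le> e"
      using norm_triangle_mono[OF B[of k x] D[of k x]] by (simp add: phase_int_add[OF vi wi])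
  qed
qed

lemma oscillation_decay_cmult:
  assumes w: "oscillation_decay w" shows "oscillation_decay (\<lambda>x. c * w x)"
  unfolding oscillation_decay_def
proof (intro conjI allI impI)
  show "integrable lborel (\<lambda>x. c * w x)"
    using w by (auto simp: oscillation_decay_def)
  fix e :: real assume e: "0 < e"
  have "0 < e / (cmod c + 1)"
    using e by (simp add: add_nonneg_pos)
  then obtain B where B: "\<And>k x. 0 \<le> Im k \<Longrightarrow> B \<le> cmod k \<Longrightarrow> norm (phase_int k w x) \<le> e / (cmod c + 1)"
    using w unfolding oscillation_decay_def by blast
  show "\<exists>B. \<forall>k x. 0 \<le> Im k \<longrightarrow> B \<le> cmod k \<longrightarrow> norm (phase_int k (\<lambda>x. c * w x) x) \<le> e"
  proof (intro exI allI impI)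
    fix k x assume k: "0 \<le> Im k" "B \<le> cmod k"
    have "norm (phase_int k (\<lambda>x. c * w x) x) \<le> (cmod c + 1) * (e / (cmod c + 1))"
      unfolding phase_int_cmult norm_mult using e by (intro mult_mono B k) auto
    also have "\<dots> = e"
      using norm_ge_zero[of c] by (simp add: add_nonneg_eq_0_iff)
    finally show "norm (phase_int k (\<lambda>x. c * w x) x) \<le> e" .
  qed
qed

lemma oscillation_decay_limit:
  assumes w: "\<And>n. oscillation_decay (w n)" and lim: "\<And>x. (\<lambda>n. w n x) \<longlonglongrightarrow> v x"
    and g: "integrable lborel g" and le: "\<And>n x. norm (w n x) \<le> g x"
  shows "oscillation_decay v"
  unfolding oscillation_decay_def
proof (intro conjI allI impI)
  have wi: "integrable lborel (w n)" for n
    using w by (auto simp: oscillation_decay_def)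
  then have [measurable]: "w n \<in> borel_measurable borel" for n
    by auto
  have [measurable]: "v \<in> borel_measurable borel"
    by (rule borel_measurable_LIMSEQ_metric[OF _ lim]) measurable
  show vi: "integrable lborel v"
    by (rule integrable_dominated_convergence[OF _ _ g, of v w]) (use lim le in auto)
  have "(\<lambda>n. LINT x|lborel. norm (w n x - v x)) \<longlonglongrightarrow> (LINT x|(lborel::real measure). 0)"
  proof (rule integral_dominated_convergence)
    show "integrable lborel (\<lambda>x. g x + norm (v x))"
      using g vi by simp
    show "AE x in lborel. (\<lambda>n. norm (w n x - v x)) \<longlonglongrightarrow> 0"
      using lim by (intro AE_I2 tendsto_norm_zero) (simp add: LIM_zero)
    show "AE x in lborel. norm (norm (w n x - v x)) \<le> g x + norm (v x)" for n
    proof (rule AE_I2)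
      fix x :: real
      show "norm (norm (w n x - v x)) \<le> g x + norm (v x)"
        using norm_triangle_ineq4[of "w n x" "v x"] le[of n x] by simp
    qed
  qed auto
  then have L: "(\<lambda>n. LINT x|lborel. norm (w n x - v x)) \<longlonglongrightarrow> 0" by simp
  fix e :: real assume "0 < e"
  then have e: "0 < e / 2" by simp
  obtain n where n: "(LINT x|lborel. norm (w n x - v x)) < e / 2"
    using order_tendstoD(2)[OF L e] by (auto dest: eventually_happens)
  obtain B where B: "\<And>k x. 0 \<le> Im k \<Longrightarrow> B \<le> cmod k \<Longrightarrow> norm (phase_int k (w n) x) \<le> e / 2"
    using w[of n] e unfolding oscillation_decay_def by blast
  show "\<exists>B. \<forall>k x. 0 \<le> Im k \<longrightarrow> B \<le> cmod k \<longrightarrow> norm (phase_int k v x) \<le> e"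
  proof (intro exI allI impI)
    fix k x assume k: "0 \<le> Im k" "B \<le> cmod k"
    have "norm (phase_int k (w n) x - phase_int k v x) \<le> e / 2"
      using norm_phase_int_le[of "\<lambda>x. w n x - v x" k x] wi vi k n by (simp add: phase_int_diff)
    then show "norm (phase_int k v x) \<le> e"
      using B[OF k, of x] norm_triangle_sub[of "phase_int k v x" "phase_int k (w n) x"]
      by (simp add: norm_minus_commute)
  qed
qed

text \<open>The antiderivative of the exponential carries a factor 1 / k, and at both endpoints,
  neither of which exceeds x, the exponential has modulus at most 1. The bound 2 / |k| depends
  neither on the interval nor on x.\<close>

lemma oscillation_decay_interval: "oscillation_decay (indicator {a..b})"
  unfolding oscillation_decay_def
proof (intro conjI allI impI)
  show int: "integrable lborel (indicator {a..b} :: real \<Rightarrow> complex)"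
  proof -
    have "integrable lborel (\<lambda>x. complex_of_real (indicator {a..b} x))"
      by (intro integrable_of_real) (simp add: integrable_indicator_iff emeasure_lborel_Icc_eq)
    then show ?thesis by (simp add: of_real_indicator)
  qed
  fix e :: real assume e: "0 < e"
  show "\<exists>B. \<forall>k x. 0 \<le> Im k \<longrightarrow> B \<le> cmod k \<longrightarrow> norm (phase_int k (indicator {a..b}) x) \<le> e"
  proof (intro exI allI impI)
    fix k x assume k: "0 \<le> Im k" "max 1 (2 / e) \<le> cmod k"
    then have k0: "k \<noteq> 0" by auto
    have eq: "phase_int k (indicator {a..b}) x = (LINT y|lborel. indicator {a..min b x} y *\<^sub>R exp (\<i> * k * of_real (x - y)))"
      unfolding phase_int_def set_lebesgue_integral_def
      by (intro Bochner_Integration.integral_cong) (auto simp: indicator_def)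
    show "norm (phase_int k (indicator {a..b}) x) \<le> e"
    proof (cases "a \<le> min b x")
      case False
      then show ?thesis using e by (simp add: eq)
    next
      case True
      define F where "F y = \<i> / k * exp (\<i> * k * of_real (x - y))" for y
      have "(LINT y|lborel. indicator {a..min b x} y *\<^sub>R exp (\<i> * k * of_real (x - y))) = F (min b x) - F a"
      proof (rule integral_FTC_atLeastAtMost[OF True])
        fix y
        have "((\<lambda>z. \<i> / k * exp (\<i> * k * (of_real x - z))) has_field_derivative exp (\<i> * k * of_real (x - y))) (at (of_real y))"
          by (rule derivative_eq_intros refl | use k0 in simp)+
        from has_vector_derivative_real_field[OF this]
        show "(F has_vector_derivative exp (\<i> * k * of_real (x - y))) (at y within {a..min b x})"
          by (simp add: F_def[abs_def])
      qed (intro continuous_intros)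
      moreover have "norm (F y) \<le> 1 / cmod k" if "y \<le> x" for y
        using norm_exp_phase_le[OF k(1) that] by (simp add: F_def norm_mult norm_divide divide_right_mono)
      then have "norm (F (min b x)) \<le> 1 / cmod k" "norm (F a) \<le> 1 / cmod k"
        using True by auto
      ultimately have "norm (phase_int k (indicator {a..b}) x) \<le> 1 / cmod k + 1 / cmod k"
        unfolding eq using norm_triangle_le_diff add_mono by metis
      also have "\<dots> \<le> e"
        using k(2) e k0 by (auto simp: field_simps)
      finally show ?thesis .
    qed
  qed
qed

lemma oscillation_decay_empty: "oscillation_decay (indicator {})"
proof -
  have "indicator {} = (\<lambda>x::real. 0 * (indicator {0..0} x :: complex))"
    by (simp add: fun_eq_iff)
  then show ?thesis
    by (metis oscillation_decay_cmult oscillation_decay_interval)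
qed

text \<open>Half lines form a generator stable under intersection, so Dynkin's theorem applies.
  Intersecting with {-c..c} keeps complements integrable and supplies the majorant for countable
  unions.\<close>

lemma oscillation_decay_Int_interval:
  assumes "A \<in> sets borel"
  shows "oscillation_decay (indicator (A \<inter> {-c..c::real}))"
proof -
  have int: "Int_stable (range (\<lambda>a::real. {..a}))"
    by (auto simp: Int_stable_def)
  have A: "A \<in> sigma_sets UNIV (range (\<lambda>a::real. {..a}))"
    using assms unfolding borel_eq_atMost by simp
  show ?thesis
  proof (rule sigma_sets_induct_disjoint[OF int _ A])
    fix A assume "A \<in> range (\<lambda>a::real. {..a})"
    then obtain a where "A = {..a}" by auto
    then have "A \<inter> {-c..c} = {-c..min a c}" by auto
    then show "oscillation_decay (indicator (A \<inter> {-c..c}))"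
      by (metis oscillation_decay_interval)
  next
    show "oscillation_decay (indicator ({} \<inter> {-c..c}))"
      using oscillation_decay_empty by (simp only: Int_empty_left UN_empty lessThan_0)
  next
    fix A assume "oscillation_decay (indicator (A \<inter> {-c..c}))"
    then have "oscillation_decay (\<lambda>x. indicator {-c..c} x + (-1) * indicator (A \<inter> {-c..c}) x)"
      by (intro oscillation_decay_add oscillation_decay_interval oscillation_decay_cmult)
    also have "(\<lambda>x. indicator {-c..c} x + (-1) * indicator (A \<inter> {-c..c}) x) = (indicator ((UNIV - A) \<inter> {-c..c}) :: real \<Rightarrow> complex)"
      by (auto simp: indicator_def fun_eq_iff)
    finally show "oscillation_decay (indicator ((UNIV - A) \<inter> {-c..c}))" .
  next
    fix A :: "nat \<Rightarrow> real set"
    assume A: "disjoint_family A" "range A \<subseteq> sigma_sets UNIV (range (\<lambda>a::real. {..a}))"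
      and RL: "\<And>i. oscillation_decay (indicator (A i \<inter> {-c..c}))"
    have un: "oscillation_decay (indicator ((\<Union>i<n. A i) \<inter> {-c..c}))" for n
    proof (induction n)
      case 0
      show ?case using oscillation_decay_empty by (simp only: Int_empty_left UN_empty lessThan_0)
    next
      case (Suc n)
      have "oscillation_decay (\<lambda>x. indicator ((\<Union>i<n. A i) \<inter> {-c..c}) x + indicator (A n \<inter> {-c..c}) x)"
        by (intro oscillation_decay_add Suc.IH RL)
      moreover have "A i \<inter> A n = {}" if "i < n" for i
        using A(1) that unfolding disjoint_family_on_def by (metis UNIV_I order_less_irrefl)
      then have "((\<Union>i<n. A i) \<inter> {-c..c}) \<inter> (A n \<inter> {-c..c}) = {}"
        by blast
      moreover have "(\<Union>i<Suc n. A i) \<inter> {-c..c} = ((\<Union>i<n. A i) \<inter> {-c..c}) \<union> (A n \<inter> {-c..c})"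
        by (simp add: lessThan_Suc Int_Un_distrib2 Un_commute)
      ultimately show ?case by (simp only: indicator_add)
    qed
    show "oscillation_decay (indicator (\<Union>(range A) \<inter> {-c..c}))"
    proof (rule oscillation_decay_limit[OF un])
      show "integrable lborel (indicator {-c..c} :: real \<Rightarrow> real)"
        by (simp add: integrable_indicator_iff emeasure_lborel_Icc_eq)
      fix x
      show "norm (indicator ((\<Union>i<n. A i) \<inter> {-c..c}) x :: complex) \<le> indicator {-c..c} x" for n
        by (auto simp: indicator_def)
      show "(\<lambda>n. indicator ((\<Union>i<n. A i) \<inter> {-c..c}) x) \<longlonglongrightarrow> (indicator (\<Union>(range A) \<inter> {-c..c}) x :: complex)"
      proof (cases "x \<in> \<Union>(range A)")
        case True
        then obtain i where i: "x \<in> A i" by auto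
        have "\<forall>\<^sub>F n in sequentially. indicator (\<Union>(range A) \<inter> {-c..c}) x = (indicator ((\<Union>i<n. A i) \<inter> {-c..c}) x :: complex)"
          using eventually_gt_at_top[of i]
        proof eventually_elim
          case (elim n)
          then have "x \<in> \<Union>(range A)" "x \<in> (\<Union>i<n. A i)" using i by blast+
          then show ?case by (simp add: indicator_def)
        qed
        then show ?thesis
          by (rule Lim_transform_eventually[OF tendsto_const])
      next
        case False
        then show ?thesis by (auto simp: indicator_def)
      qed
    qed
  qed simp
qed

text \<open>The property is closed under sums, multiples and dominated limits and therefore passes
  from indicators to all integrable functions. Uniformity in x yields supremum norms later;
  uniformity in k allows every direction of the upper half plane, not just the real axis.\<close>

theorem Riemann_Lebesgue_phase:
  assumes "integrable lborel w" shows "oscillation_decay w"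
  using assms
proof (induction rule: integrable_induct)
  case (base A c)
  have A: "A \<in> sets borel" "integrable lborel (indicator A :: real \<Rightarrow> real)"
    using base by (auto simp: integrable_indicator_iff)
  have "oscillation_decay (indicator A)"
  proof (rule oscillation_decay_limit[OF oscillation_decay_Int_interval[OF A(1)] _ A(2)])
    fix x :: real
    show "norm (indicator (A \<inter> {-real n..real n}) x :: complex) \<le> indicator A x" for n
      by (auto simp: indicator_def)
    have "\<forall>\<^sub>F n in sequentially. indicator A x = (indicator (A \<inter> {-real n..real n}) x :: complex)"
      using eventually_ge_at_top[of "nat \<lceil>\<bar>x\<bar>\<rceil>"]
      proof eventually_elim
      case (elim n)
      then have "\<bar>x\<bar> \<le> real n" by (simp add: nat_ceiling_le_eq)
      then show ?case by (auto simp: indicator_def abs_le_iff)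
    qed
    then show "(\<lambda>n. indicator (A \<inter> {-real n..real n}) x) \<longlonglongrightarrow> (indicator A x :: complex)"
      by (rule Lim_transform_eventually[OF tendsto_const])
  qed
  then have "oscillation_decay (\<lambda>x. c * indicator A x)"
    by (rule oscillation_decay_cmult)
  then show ?case
    by (simp add: scaleR_conv_of_real of_real_indicator mult.commute)
next
  case (add f g)
  then show ?case by (blast intro: oscillation_decay_add)
next
  case (lim f s)
  show ?case
    by (rule oscillation_decay_limit[where w=s and g="\<lambda>x. 2 * norm (f x)"]) (use lim in auto)
qed

section \<open>The Volterra equation\<close>

lemma integral_atMost_tendsto:
  fixes w :: "real \<Rightarrow> 'b::{banach,second_countable_topology}"
  assumes w: "integrable lborel w"
  shows "((\<lambda>x. LINT y:{..x}|lborel. w y) \<longlongrightarrow> 0) at_bot"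
    and "((\<lambda>x. LINT y:{..x}|lborel. w y) \<longlongrightarrow> (LINT y|lborel. w y)) at_top"
proof -
  have [measurable]: "w \<in> borel_measurable borel" using w by auto
  show "((\<lambda>x. LINT y:{..x}|lborel. w y) \<longlongrightarrow> (LINT y|lborel. w y)) at_top"
    using tendsto_integral_at_top[of lborel w] w by (simp add: set_lebesgue_integral_def)
  have "((\<lambda>x. LINT y:{..-x}|lborel. w y) \<longlongrightarrow> (LINT y|(lborel::real measure). 0::'b)) at_top"
    unfolding set_lebesgue_integral_def
  proof (rule integral_dominated_convergence_at_top)
    show "integrable lborel (\<lambda>x. norm (w x))" using w by simp
    show "AE x in lborel. ((\<lambda>i. indicator {..- i} x *\<^sub>R w x) \<longlongrightarrow> 0) at_top"
    proof (rule AE_I2)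
      fix x :: real
      have "\<forall>\<^sub>F i in at_top. 0 = indicator {..- i} x *\<^sub>R w x"
        using eventually_gt_at_top[of "-x"] by eventually_elim (auto simp: indicator_def)
      then show "((\<lambda>i. indicator {..- i} x *\<^sub>R w x) \<longlongrightarrow> 0) at_top"
        by (rule Lim_transform_eventually[OF tendsto_const])
    qed
    show "\<forall>\<^sub>F i in at_top. AE x in lborel. norm (indicator {..- i} x *\<^sub>R w x) \<le> norm (w x)"
      by (intro always_eventually allI AE_I2) (auto simp: indicator_def)
  qed auto
  then show "((\<lambda>x. LINT y:{..x}|lborel. w y) \<longlongrightarrow> 0) at_bot"
    by (simp add: at_bot_mirror filterlim_filtermap)
qed

lemma primitive_atMost:
  fixes w :: "real \<Rightarrow> complex"
  assumes w: "\<And>x. set_integrable lborel {..x} w"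
  shows "primitive (\<lambda>x. LINT y:{..x}|lborel. w y) w"
  unfolding primitive_def
proof (intro allI impI conjI)
  fix a b :: real assume ab: "a \<le> b"
  have ab_int: "set_integrable lborel {a..b} w" "set_integrable lborel {a<..b} w"
    by (rule set_integrable_subset[OF w[of b]]; auto)+
  then show "w absolutely_integrable_on {a..b}"
    unfolding set_integrable_def by (subst integrable_completion) auto
  have "(LINT y:{..b}|lborel. w y) = (LINT y:{..a}|lborel. w y) + (LINT y:{a<..b}|lborel. w y)"
    using ab by (subst set_integral_Un[symmetric]) (auto simp: w ab_int ivl_disj_un)
  also have "(LINT y:{a<..b}|lborel. w y) = (LINT y:{a..b}|lborel. w y)"
    using ab_int AE_lborel_singleton[of a]
    by (intro set_integral_cong_set) (auto simp: set_integrable_def set_borel_measurable_def elim!: eventually_mono)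
  finally show "(w has_integral (LINT y:{..b}|lborel. w y) - (LINT y:{..a}|lborel. w y)) {a..b}"
    using integrable_integral[OF set_borel_integral_eq_integral(1)[OF ab_int(1)]]
    by (simp add: set_borel_integral_eq_integral(2)[OF ab_int(1)])
qed

text \<open>The hypothesis concerns a left half line because the weights exp (- \<i> k y) of the
  Volterra argument have modulus exp (Im k * y), which may grow to the right.\<close>

lemma set_integral_atMost_tendsto_at_bot:
  fixes w :: "real \<Rightarrow> 'b::{banach,second_countable_topology}"
  assumes w: "set_integrable lborel {..0} w"
  shows "((\<lambda>x. LINT y:{..x}|lborel. w y) \<longlongrightarrow> 0) at_bot"
proof (rule Lim_transform_eventually)
  show "((\<lambda>x. LINT y:{..x}|lborel. indicator {..0} y *\<^sub>R w y) \<longlongrightarrow> 0) at_bot"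
    using integral_atMost_tendsto(1) w unfolding set_integrable_def by blast
  show "\<forall>\<^sub>F x in at_bot. (LINT y:{..x}|lborel. indicator {..0} y *\<^sub>R w y) = (LINT y:{..x}|lborel. w y)"
    using eventually_le_at_bot[of "0::real"]
    by eventually_elim
      (auto simp: set_lebesgue_integral_def indicator_def intro!: Bochner_Integration.integral_cong)
qed

text \<open>Two primitives of one density differ by a constant, which the limit at minus infinity
  identifies as 0. This takes the role of uniqueness for a first order differential
  equation.\<close>

lemma primitive_eqI:
  assumes F: "primitive F f" and G: "primitive G f"
    and lim: "((\<lambda>x. F x - G x) \<longlongrightarrow> 0) at_bot"
  shows "F x = G x"
proof -
  have "F a - G a = F x - G x" if "a \<le> x" for a
    using primitive_integral[OF F that] primitive_integral[OF G that] by (simp add: algebra_simps)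
  then have "\<forall>\<^sub>F a in at_bot. F a - G a = F x - G x"
    using eventually_le_at_bot[of x] by (rule eventually_mono[rotated])
  then have "((\<lambda>a::real. F x - G x) \<longlongrightarrow> 0) at_bot"
    by (rule Lim_transform_eventually[OF lim])
  then show ?thesis
    by (simp add: tendsto_const_iff)
qed

lemma primitive_cmult:
  assumes "primitive F f" shows "primitive (\<lambda>x. c * F x) (\<lambda>x. c * f x)"
  unfolding primitive_def
proof (intro allI impI conjI)
  fix a b :: real assume ab: "a \<le> b"
  show "(\<lambda>x. c * f x) absolutely_integrable_on {a..b}"
    using assms ab unfolding primitive_def by (auto intro: set_integrable_mult_right)
  have "(f has_integral F b - F a) {a..b}"
    using assms ab unfolding primitive_def by blast
  from has_integral_mult_right[OF this, of c]
  show "((\<lambda>x. c * f x) has_integral c * F b - c * F a) {a..b}"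
    by (simp add: right_diff_distrib)
qed

section \<open>The potential, its primitive and the integrating factor\<close>

locale potential =
  fixes u :: "real \<Rightarrow> real"
  assumes u_int: "integrable lborel u" and u_L2: "in_L2 lborel u"
begin

lemma u_meas [measurable]: "u \<in> borel_measurable borel"
  using u_int by auto

definition "U x = (LINT y:{..x}|lborel. u y)"
definition "U_inf = (LINT y|lborel. u y)"
definition "u_L1nrm = (LINT y|lborel. \<bar>u y\<bar>)"

text \<open>Up to the factor - \<i> this is the density of the integrating factor exp (- \<i> U). It
  has the modulus of \<open>u\<close>, so bounds for \<open>u\<close> carry over.\<close>

definition v :: "real \<Rightarrow> complex"
  where "v x = exp (- \<i> * of_real (U x)) * of_real (u x)"

lemma u_L1nrm_nonneg [simp]: "0 \<le> u_L1nrm"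
  unfolding u_L1nrm_def by simp

lemma U_measurable [measurable]: "U \<in> borel_measurable borel"
proof -
  have "(\<lambda>x. LINT y|lborel. (if y \<le> x then u y else 0)) \<in> borel_measurable borel"
    by measurable
  also have "(\<lambda>x. LINT y|lborel. (if y \<le> x then u y else 0)) = U"
    by (auto simp: fun_eq_iff U_def set_lebesgue_integral_def indicator_def
        intro!: Bochner_Integration.integral_cong)
  finally show ?thesis .
qed

lemma v_measurable [measurable]: "v \<in> borel_measurable borel"
  unfolding v_def[abs_def] by measurable

lemma norm_v: "norm (v x) = \<bar>u x\<bar>"
  by (simp add: v_def norm_mult norm_exp)

lemma norm_exp_U: "norm (exp (\<i> * complex_of_real (U x))) = 1"
  by (simp add: norm_exp)

text \<open>One statement for three multipliers of modulus |u|: \<open>u\<close> itself,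
  \<open>v\<close>, and \<open>v\<close> times an oscillating phase.\<close>

lemma integrable_u_mult:
  fixes m :: "real \<Rightarrow> complex"
  assumes [measurable]: "m \<in> borel_measurable borel" and le: "\<And>x. norm (m x) \<le> C"
    and w: "w \<in> borel_measurable borel" "\<And>x. norm (w x) = \<bar>u x\<bar>"
  shows "integrable lborel (\<lambda>x. w x * m x)" and "(LINT x|lborel. norm (w x * m x)) \<le> C * u_L1nrm"
    and "in_L2 lborel (\<lambda>x. w x * m x)" and "L2_nrm (\<lambda>x. w x * m x) \<le> C * L2_nrm u"
proof -
  note [measurable] = w(1)
  have C: "0 \<le> C" using le[of 0] norm_ge_zero order_trans by blast
  have b: "norm (w x * m x) \<le> C * \<bar>u x\<bar>" for x
    unfolding norm_mult w(2) using mult_right_mono[OF le[of x], of "\<bar>u x\<bar>"] by (simp add: mult.commute)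
  have b1: "norm (w x * m x) \<le> norm (C * \<bar>u x\<bar>)" for x
    using b[of x] by (rule order_trans) simp
  have ci: "integrable lborel (\<lambda>x. C * \<bar>u x\<bar>)"
    using u_int by simp
  show 1: "integrable lborel (\<lambda>x. w x * m x)"
    by (rule Bochner_Integration.integrable_bound[OF ci _ AE_I2[OF b1]]) measurable
  have "(LINT x|lborel. norm (w x * m x)) \<le> (LINT x|lborel. C * \<bar>u x\<bar>)"
    by (rule integral_mono[OF integrable_norm[OF 1] ci b])
  then show "(LINT x|lborel. norm (w x * m x)) \<le> C * u_L1nrm"
    by (simp add: u_L1nrm_def)
  show "in_L2 lborel (\<lambda>x. w x * m x)"
    by (rule in_L2_bound[OF u_L2, where C=C]) (use b in auto)
  show "L2_nrm (\<lambda>x. w x * m x) \<le> C * L2_nrm u"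
    by (rule L2_nrm_mono[OF u_L2]) (use b C in auto)
qed

lemmas integrable_um = integrable_u_mult[where w="\<lambda>x. complex_of_real (u x)", simplified]
lemmas integrable_vm = integrable_u_mult[where w=v, simplified norm_v, simplified]

lemma v_integrable: "integrable lborel v"
  using integrable_vm(1)[of "\<lambda>_. 1" 1] by simp

lemma primitive_U: "primitive (\<lambda>x. of_real (U x)) (\<lambda>x. of_real (u x))"
proof -
  have "set_integrable lborel {..x} (\<lambda>x. complex_of_real (u x))" for x
    using u_int unfolding set_integrable_def by (intro integrable_mult_indicator) auto
  then have "primitive (\<lambda>x. LINT y:{..x}|lborel. complex_of_real (u y)) (\<lambda>x. of_real (u x))"
    by (rule primitive_atMost)
  then show ?thesis
    by (simp add: U_def set_integral_complex_of_real)
qed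

lemma primitive_exp_U: "primitive (\<lambda>x. exp (- \<i> * of_real (U x))) (\<lambda>x. - \<i> * v x)"
proof -
  have "primitive (\<lambda>x. of_real (- U x)) (\<lambda>x. of_real (- u x))"
    using primitive_cmult[OF primitive_U, of "-1"] by simp
  from primitive_exp[OF this] show ?thesis
    by (simp add: v_def mult_ac)
qed

lemma U_tendsto: "(U \<longlongrightarrow> 0) at_bot" "(U \<longlongrightarrow> U_inf) at_top"
  unfolding U_def[abs_def] U_inf_def using integral_atMost_tendsto[OF u_int] by auto

text \<open>Multiplied by - \<i>, both sides become primitives of - \<i> \<open>v\<close> that
  vanish at minus infinity. This closed form is the source of the phase exp (\<i> U) in the
  limits.\<close>

lemma integral_v_atMost: "(LINT y:{..x}|lborel. v y) = \<i> * (exp (- \<i> * of_real (U x)) - 1)"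
proof -
  have si: "set_integrable lborel {..x} v" for x
    using v_integrable unfolding set_integrable_def by (intro integrable_mult_indicator) auto
  have "- \<i> * (LINT y:{..x}|lborel. v y) = exp (- \<i> * of_real (U x)) - 1"
  proof (rule primitive_eqI[where F="\<lambda>x. - \<i> * (LINT y:{..x}|lborel. v y)" and G="\<lambda>x. exp (- \<i> * of_real (U x)) - 1"])
    show "primitive (\<lambda>x. - \<i> * (LINT y:{..x}|lborel. v y)) (\<lambda>x. - \<i> * v x)"
      by (intro primitive_cmult primitive_atMost si)
    show "primitive (\<lambda>x. exp (- \<i> * of_real (U x)) - 1) (\<lambda>x. - \<i> * v x)"
      using primitive_exp_U unfolding primitive_def by simp
    have "((\<lambda>x. - \<i> * (LINT y:{..x}|lborel. v y) - (exp (- \<i> * of_real (U x)) - 1)) \<longlongrightarrow>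
       - \<i> * 0 - (exp (- \<i> * of_real 0) - 1)) at_bot"
      by (intro tendsto_intros set_integral_atMost_tendsto_at_bot si U_tendsto)
    then show "((\<lambda>x. - \<i> * (LINT y:{..x}|lborel. v y) - (exp (- \<i> * of_real (U x)) - 1)) \<longlongrightarrow> 0) at_bot"
      by simp
  qed
  then have "\<i> * (- \<i> * (LINT y:{..x}|lborel. v y)) = \<i> * (exp (- \<i> * of_real (U x)) - 1)"
    by simp
  then show ?thesis by simp
qed

lemma phase_int_eq:
  "phase_int k w x = exp (\<i> * k * of_real x) * (LINT y:{..x}|lborel. exp (- \<i> * k * of_real y) * w y)"
proof -
  have "exp (\<i> * k * of_real (x - y)) * w y = exp (\<i> * k * of_real x) * (exp (- \<i> * k * of_real y) * w y)" for y
    by (simp add: right_diff_distrib exp_diff exp_minus field_simps)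
  then show ?thesis
    unfolding phase_int_def by (simp only: set_integral_mult_right)
qed

text \<open>Let M x be the integral of exp (- \<i> k y) u m up to x. The equation becomes M' = exp
  (- \<i> k x) u p + \<i> u M, and the integrating factor turns it into (exp (- \<i> U) M)' = exp (-
  \<i> k x) v p, where both primitives start from 0 at minus infinity. The inversion is exact for
  potentials of any size.\<close>

lemma volterra:
  assumes k: "0 \<le> Im k" and [measurable]: "m \<in> borel_measurable borel" "p \<in> borel_measurable borel"
    and mb: "\<And>x. norm (m x) \<le> C" and pb: "\<And>x. norm (p x) \<le> D"
    and eq: "\<And>x. m x = p x + \<i> * phase_int k (\<lambda>y. of_real (u y) * m y) x"
  shows "phase_int k (\<lambda>y. of_real (u y) * m y) x = iexp (U x) * phase_int k (\<lambda>y. v y * p y) x"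
proof -
  have shift: "exp (- \<i> * k * of_real y) = exp (- \<i> * k * of_real x) * exp (\<i> * k * of_real (x - y))" for x y
    by (simp add: right_diff_distrib exp_diff exp_minus field_simps)
  have si: "set_integrable lborel {..x} (\<lambda>y. exp (- \<i> * k * of_real y) * w y)"
    if "integrable lborel w" for w x
  proof -
    have "set_integrable lborel {..x} (\<lambda>y. exp (- \<i> * k * of_real x) * (exp (\<i> * k * of_real (x - y)) * w y))"
      by (intro set_integrable_mult_right impI phase_int_integrable[OF that k])
    moreover have "exp (- \<i> * k * of_real y) * w y
        = exp (- \<i> * k * of_real x) * (exp (\<i> * k * of_real (x - y)) * w y)" for y
      by (subst shift[of y x]) (simp only: mult.assoc)
    ultimately show ?thesis
      by (simp only:)
  qed
  have um: "integrable lborel (\<lambda>y. of_real (u y) * m y)" and vp: "integrable lborel (\<lambda>y. v y * p y)"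
    by (rule integrable_um(1)[OF _ mb] integrable_vm(1)[OF _ pb], measurable)+
  define M where "M x = (LINT y:{..x}|lborel. exp (- \<i> * k * of_real y) * (of_real (u y) * m y))" for x
  define P where "P x = (LINT y:{..x}|lborel. exp (- \<i> * k * of_real y) * (v y * p y))" for x
  have "primitive (\<lambda>x. exp (- \<i> * of_real (U x)) * M x)
      (\<lambda>x. - \<i> * v x * M x + exp (- \<i> * of_real (U x)) * (exp (- \<i> * k * of_real x) * (of_real (u x) * m x)))"
    unfolding M_def by (intro primitive_mult primitive_exp_U primitive_atMost si um)
  moreover have "- \<i> * v x * M x + exp (- \<i> * of_real (U x)) * (exp (- \<i> * k * of_real x) * (of_real (u x) * m x))
     = exp (- \<i> * k * of_real x) * (v x * p x)" for x
  proof -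
    have "exp (- \<i> * k * of_real x) * phase_int k (\<lambda>y. of_real (u y) * m y) x = M x"
      unfolding phase_int_eq M_def by (simp flip: mult.assoc exp_add)
    then have "exp (- \<i> * k * of_real x) * m x = exp (- \<i> * k * of_real x) * p x + \<i> * M x"
      using eq[of x] by (simp add: algebra_simps)
    then have "exp (- \<i> * of_real (U x)) * of_real (u x) * (exp (- \<i> * k * of_real x) * m x)
       = v x * (exp (- \<i> * k * of_real x) * p x + \<i> * M x)"
      by (simp add: v_def)
    then show ?thesis
      by (simp add: algebra_simps)
  qed
  ultimately have "primitive (\<lambda>x. exp (- \<i> * of_real (U x)) * M x) (\<lambda>x. exp (- \<i> * k * of_real x) * (v x * p x))"
    by simp
  moreover have "primitive P (\<lambda>x. exp (- \<i> * k * of_real x) * (v x * p x))"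
    unfolding P_def[abs_def] by (intro primitive_atMost si vp)
  moreover have "((\<lambda>x. exp (- \<i> * of_real (U x)) * M x - P x) \<longlongrightarrow> exp (- \<i> * of_real 0) * 0 - 0) at_bot"
    unfolding M_def P_def by (intro tendsto_intros U_tendsto set_integral_atMost_tendsto_at_bot si um vp)
  then have "((\<lambda>x. exp (- \<i> * of_real (U x)) * M x - P x) \<longlongrightarrow> 0) at_bot"
    by simp
  ultimately have "exp (- \<i> * of_real (U x)) * M x = P x"
    by (rule primitive_eqI)
  then have "iexp (U x) * P x = M x"
    by (simp add: exp_minus field_simps)
  then show ?thesis
    unfolding phase_int_eq M_def[symmetric] P_def[symmetric] by (metis mult.left_commute)
qed

section \<open>Jost equations as perturbed Volterra equations\<close>

definition rest :: "(real \<Rightarrow> complex) \<Rightarrow> (real \<Rightarrow> complex) \<Rightarrow> real \<Rightarrow> complex"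
  where "rest E m x = (LINT y|lborel. E (x - y) * (of_real (u y) * m y))"

lemma rest_measurable [measurable]:
  assumes [measurable]: "E \<in> borel_measurable borel" "m \<in> borel_measurable borel"
  shows "rest E m \<in> borel_measurable borel"
  unfolding rest_def[abs_def] by measurable

lemma rest_bound:
  assumes E: "in_L2 lborel E" and m: "m \<in> borel_measurable borel" "\<And>x. norm (m x) \<le> C"
  shows "norm (rest E m x) \<le> L2_nrm E * (L2_nrm u * C)"
proof -
  have "norm (rest E m x) \<le> L2_nrm E * L2_nrm (\<lambda>y. of_real (u y) * m y)"
    unfolding rest_def by (intro integral_convolution_bound(2) E integrable_um(3)[OF m])
  also have "\<dots> \<le> L2_nrm E * (L2_nrm u * C)"
    using integrable_um(4)[OF m] by (intro mult_left_mono) (auto simp: mult.commute)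
  finally show ?thesis .
qed

text \<open>The full convolution is split into the wave, kept as a Volterra term, and a square
  integrable \<open>E\<close>. The equation is demanded at every point of a Borel function, so no
  null sets are carried along; boundedness makes the supremum finite, as absorption arguments
  require.\<close>

definition jost_eq :: "complex \<Rightarrow> (real \<Rightarrow> complex) \<Rightarrow> (real \<Rightarrow> complex) \<Rightarrow> (real \<Rightarrow> complex) \<Rightarrow> bool"
  where "jost_eq k E h m \<longleftrightarrow> m \<in> borel_measurable borel \<and> bounded (range m) \<and>
    (\<forall>x. m x = h x + rest E m x + \<i> * phase_int k (\<lambda>y. of_real (u y) * m y) x)"

context
  fixes k E h m
  assumes k: "0 \<le> Im k" and E: "in_L2 lborel E"
    and h: "h \<in> borel_measurable borel" "\<And>x. norm (h x) \<le> 1"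
    and m: "jost_eq k E h m"
begin

lemma jost_eq_meas: "m \<in> borel_measurable borel" "h \<in> borel_measurable borel" "E \<in> borel_measurable borel"
  using m h E by (auto simp: jost_eq_def in_L2_def)

lemma jost_eq_volterra:
  "phase_int k (\<lambda>y. of_real (u y) * m y) x
    = iexp (U x) * phase_int k (\<lambda>y. v y * (h y + rest E m y)) x"
proof -
  note [measurable] = jost_eq_meas
  have "bounded (range m)"
    using m unfolding jost_eq_def by blast
  then obtain C where C: "\<And>x. norm (m x) \<le> C"
    unfolding bounded_iff by blast
  show ?thesis
  proof (rule volterra[OF k])
    show "norm (h x + rest E m x) \<le> 1 + L2_nrm E * (L2_nrm u * C)" for x
      by (intro norm_triangle_mono h rest_bound[OF E] C jost_eq_meas)
    show "m x = h x + rest E m x + \<i> * phase_int k (\<lambda>y. complex_of_real (u y) * m y) x" for x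
      using m unfolding jost_eq_def by blast
  qed (use C in auto)
qed

text \<open>With p = h + \<open>rest E m\<close> as inhomogeneity, Volterra inversion gives m = p +
  \<i> exp (\<i> U) times the phase integral of v p. Since |exp (\<i> U)| = 1, the inversion costs
  the factor 1 + ||u||_1.\<close>

lemma jost_eq_step:
  assumes C: "\<And>x. norm (m x) \<le> C"
  shows "norm (m x) \<le> (1 + u_L1nrm) * (1 + L2_nrm E * (L2_nrm u * C))"
proof -
  note [measurable] = jost_eq_meas
  let ?p = "\<lambda>y. h y + rest E m y"
  have p: "norm (?p x) \<le> 1 + L2_nrm E * (L2_nrm u * C)" for x
    by (intro norm_triangle_mono h rest_bound[OF E] C jost_eq_meas)
  have "norm (phase_int k (\<lambda>y. v y * ?p y) x) \<le> (1 + L2_nrm E * (L2_nrm u * C)) * u_L1nrm"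
    using order_trans[OF norm_phase_int_le[OF integrable_vm(1)[OF _ p] k] integrable_vm(2)[OF _ p]]
    by measurable
  moreover have "m x = ?p x + \<i> * (iexp (U x) * phase_int k (\<lambda>y. v y * ?p y) x)"
    using m unfolding jost_eq_def jost_eq_volterra[symmetric] by blast
  ultimately have "norm (m x) \<le> (1 + L2_nrm E * (L2_nrm u * C)) + (1 + L2_nrm E * (L2_nrm u * C)) * u_L1nrm"
    using p[of x] by (auto intro!: norm_triangle_mono simp: norm_mult norm_exp_U)
  then show ?thesis
    by (simp add: algebra_simps)
qed

context
  assumes small: "L2_nrm E * L2_nrm u * (1 + u_L1nrm) \<le> 1 / 2"
begin

text \<open>The supremum S of |m| is finite and satisfies S <= (1 + ||u||_1) + S / 2, so the half is
  absorbed.\<close>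

lemma jost_eq_bound: "norm (m x) \<le> 2 * (1 + u_L1nrm)"
proof -
  define S where "S = (SUP x. norm (m x))"
  have bdd: "bdd_above (range (\<lambda>x. norm (m x)))"
  proof -
    have "bounded (range m)"
      using m unfolding jost_eq_def by blast
    then obtain C where "\<And>x. norm (m x) \<le> C"
      unfolding bounded_iff by blast
    then show ?thesis by (intro bdd_aboveI2)
  qed
  have S: "norm (m x) \<le> S" for x
    unfolding S_def by (rule cSUP_upper[OF _ bdd]) auto
  have S0: "0 \<le> S"
    using S[of 0] norm_ge_zero order_trans by blast
  have "S \<le> (1 + u_L1nrm) * (1 + L2_nrm E * (L2_nrm u * S))"
    unfolding S_def[of] by (rule cSUP_least) (use jost_eq_step[OF S] S_def in auto)
  also have "\<dots> = (1 + u_L1nrm) + (L2_nrm E * L2_nrm u * (1 + u_L1nrm)) * S"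
    by (simp add: algebra_simps)
  also have "\<dots> \<le> (1 + u_L1nrm) + 1 / 2 * S"
    using S0 small by (intro add_left_mono mult_right_mono)
  finally show ?thesis
    using S[of x] by simp
qed

text \<open>The subtracted expression is the exact solution of the Volterra equation with E = 0.
  What remains is the rest term of \<open>m\<close> and its image under the Volterra inverse, both
  controlled by the a priori bound on \<open>m\<close>.\<close>

lemma jost_eq_approx:
  "norm (m x - (h x + \<i> * iexp (U x) * phase_int k (\<lambda>y. v y * h y) x))
    \<le> 2 * (1 + u_L1nrm)\<^sup>2 * (L2_nrm u * L2_nrm E)"
proof -
  note [measurable] = jost_eq_meas
  define R where "R = L2_nrm E * (L2_nrm u * (2 * (1 + u_L1nrm)))"
  have r: "norm (rest E m x) \<le> R" for x
    unfolding R_def by (intro rest_bound[OF E] jost_eq_bound jost_eq_meas)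
  have i: "integrable lborel (\<lambda>y. v y * h y)" "integrable lborel (\<lambda>y. v y * rest E m y)"
    using h r by (auto intro!: integrable_vm(1))
  have "norm (phase_int k (\<lambda>y. v y * rest E m y) x) \<le> R * u_L1nrm"
    by (rule order_trans[OF norm_phase_int_le[OF i(2) k] integrable_vm(2)[OF _ r]]) measurable
  moreover have "m x - (h x + \<i> * iexp (U x) * phase_int k (\<lambda>y. v y * h y) x)
     = rest E m x + \<i> * (iexp (U x) * phase_int k (\<lambda>y. v y * rest E m y) x)"
  proof -
    have "m x = h x + rest E m x + \<i> * (iexp (U x) * phase_int k (\<lambda>y. v y * (h y + rest E m y)) x)"
      using m unfolding jost_eq_def jost_eq_volterra[symmetric] by blast
    then show ?thesis
      by (simp add: distrib_left phase_int_add[OF i k])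
  qed
  ultimately have "norm (m x - (h x + \<i> * iexp (U x) * phase_int k (\<lambda>y. v y * h y) x)) \<le> R + R * u_L1nrm"
    using r[of x] by (auto intro!: norm_triangle_mono simp: norm_mult norm_exp_U)
  then show ?thesis
    by (simp add: R_def power2_eq_square algebra_simps)
qed

end

end

end

section \<open>The kernels as Laplace integrals\<close>

text \<open>Common majorant of the rests: after rotation they are Laplace integrals with decay rate
  \<mu> and denominators comparable to sqrt (t^2 + x^2). At x = 0 the integrand behaves like 1 / t,
  and the divergent integral has the default value 0.\<close>

definition laplace_nrm :: "real \<Rightarrow> real \<Rightarrow> real"
  where "laplace_nrm \<mu> x = (LINT t:{0<..}|lborel. exp (- (t * \<mu>)) / sqrt (t\<^sup>2 + x\<^sup>2))"

lemma laplace_nrm_measurable [measurable]: "laplace_nrm \<mu> \<in> borel_measurable borel"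
  unfolding laplace_nrm_def[abs_def] set_lebesgue_integral_def by measurable

lemma laplace_nrm_nonneg [simp]: "0 \<le> laplace_nrm \<mu> x"
  unfolding laplace_nrm_def set_lebesgue_integral_def
  by (intro Bochner_Integration.integral_nonneg) (auto simp: indicator_def)

lemma laplace_nrm_uminus [simp]: "laplace_nrm \<mu> (- x) = laplace_nrm \<mu> x"
  by (simp add: laplace_nrm_def)

lemma abs_le_sqrt_sum: "\<bar>x\<bar> \<le> sqrt (t\<^sup>2 + x\<^sup>2)" for x t :: real
  by (simp add: real_le_rsqrt)

lemma laplace_integrable:
  assumes "0 < \<mu>" "x \<noteq> 0"
  shows "set_integrable lborel {0<..} (\<lambda>t. exp (- (t * \<mu>)) / sqrt (t\<^sup>2 + x\<^sup>2))"
proof (rule set_integrable_bound)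
  show "set_integrable lborel {0<..} (\<lambda>t. exp (- (t * \<mu>)) / \<bar>x\<bar>)"
    using integrable_I0i_exp_mscale[OF assms(1)] by (rule set_integrable_divide)
  have "norm (exp (- (t * \<mu>)) / sqrt (t\<^sup>2 + x\<^sup>2)) \<le> norm (exp (- (t * \<mu>)) / \<bar>x\<bar>)" for t
  proof -
    have "exp (- (t * \<mu>)) / sqrt (t\<^sup>2 + x\<^sup>2) \<le> exp (- (t * \<mu>)) / \<bar>x\<bar>"
      using assms(2) abs_le_sqrt_sum[of x t] by (intro divide_left_mono mult_pos_pos) (auto simp: sum_power2_gt_zero_iff)
    moreover have "0 \<le> exp (- (t * \<mu>)) / sqrt (t\<^sup>2 + x\<^sup>2)"
      by (intro divide_nonneg_nonneg) auto
    ultimately show ?thesis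
      by (simp only: real_norm_def)
  qed
  then show "AE t in lborel. t \<in> {0<..} \<longrightarrow> norm (exp (- (t * \<mu>)) / sqrt (t\<^sup>2 + x\<^sup>2)) \<le> norm (exp (- (t * \<mu>)) / \<bar>x\<bar>)"
    by simp
  show "set_borel_measurable lborel {0<..} (\<lambda>t. exp (- (t * \<mu>)) / sqrt (t\<^sup>2 + x\<^sup>2))"
    unfolding set_borel_measurable_def by measurable
qed

lemma laplace_nrm_antimono:
  assumes "0 < \<mu>" "\<mu> \<le> \<nu>" "x \<noteq> 0"
  shows "laplace_nrm \<nu> x \<le> laplace_nrm \<mu> x"
  unfolding laplace_nrm_def
proof (rule set_integral_mono)
  fix t :: real assume "t \<in> {0<..}"
  then show "exp (- (t * \<nu>)) / sqrt (t\<^sup>2 + x\<^sup>2) \<le> exp (- (t * \<mu>)) / sqrt (t\<^sup>2 + x\<^sup>2)"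
    using assms by (intro divide_right_mono) auto
qed (use assms in \<open>auto intro!: laplace_integrable\<close>)

text \<open>This is Gamma(1/2) = sqrt pi after scaling t by \<mu>.\<close>

lemma nn_integral_exp_div_sqrt:
  assumes \<mu>: "0 < \<mu>"
  shows "(\<integral>\<^sup>+t. ennreal (indicator {0<..} t * (exp (- (t * \<mu>)) / sqrt t)) \<partial>lborel) = ennreal (sqrt (pi / \<mu>))"
proof -
  have "ennreal (sqrt pi) = (\<integral>\<^sup>+t. ennreal (indicator {0..} t * t powr (1/2 - 1) / exp t) \<partial>lborel)"
    using Gamma_conv_nn_integral_real[of "1/2"] by (simp add: Gamma_one_half_real)
  also have "\<dots> = \<bar>\<mu>\<bar> * (\<integral>\<^sup>+t. ennreal (indicator {0..} (0 + \<mu> * t) * (0 + \<mu> * t) powr (1/2 - 1) / exp (0 + \<mu> * t)) \<partial>lborel)"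
    using \<mu> by (intro nn_integral_real_affine) auto
  also have "(\<integral>\<^sup>+t. ennreal (indicator {0..} (0 + \<mu> * t) * (0 + \<mu> * t) powr (1/2 - 1) / exp (0 + \<mu> * t)) \<partial>lborel)
    = (\<integral>\<^sup>+t. ennreal (1 / sqrt \<mu>) * ennreal (indicator {0<..} t * (exp (- (t * \<mu>)) / sqrt t)) \<partial>lborel)"
  proof (rule nn_integral_cong)
    fix t :: real
    have "indicator {0..} (0 + \<mu> * t) * (0 + \<mu> * t) powr (1/2 - 1) / exp (0 + \<mu> * t)
      = 1 / sqrt \<mu> * (indicator {0<..} t * (exp (- (t * \<mu>)) / sqrt t))"
    proof (cases "0 < t")
      case True
      have "(\<mu> * t) powr (1/2 - 1) = 1 / sqrt (\<mu> * t)"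
        using powr_minus[of "\<mu> * t" "1/2"] \<mu> True by (simp add: powr_half_sqrt inverse_eq_divide)
      then show ?thesis
        using \<mu> True by (simp add: indicator_def exp_minus real_sqrt_mult field_simps)
    next
      case False
      then show ?thesis
        using \<mu> by (cases "t = 0") (auto simp: indicator_def zero_le_mult_iff)
    qed
    then show "ennreal (indicator {0..} (0 + \<mu> * t) * (0 + \<mu> * t) powr (1/2 - 1) / exp (0 + \<mu> * t))
      = ennreal (1 / sqrt \<mu>) * ennreal (indicator {0<..} t * (exp (- (t * \<mu>)) / sqrt t))"
      using \<mu> by (simp only: ennreal_mult'[of "1 / sqrt \<mu>"] zero_le_divide_1_iff real_sqrt_ge_zero less_imp_le)
  qed
  also have "\<dots> = ennreal (1 / sqrt \<mu>) * (\<integral>\<^sup>+t. ennreal (indicator {0<..} t * (exp (- (t * \<mu>)) / sqrt t)) \<partial>lborel)"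
    by (rule nn_integral_cmult) measurable
  finally have "ennreal (sqrt pi) = ennreal (\<mu> * (1 / sqrt \<mu>)) * (\<integral>\<^sup>+t. ennreal (indicator {0<..} t * (exp (- (t * \<mu>)) / sqrt t)) \<partial>lborel)"
    using \<mu> by (simp only: ennreal_mult'[of \<mu>] less_imp_le mult.assoc abs_of_pos)
  moreover have "\<mu> * (1 / sqrt \<mu>) = sqrt \<mu>"
    using \<mu> by (simp add: real_div_sqrt)
  ultimately have eq: "ennreal (sqrt \<mu>) * (\<integral>\<^sup>+t. ennreal (indicator {0<..} t * (exp (- (t * \<mu>)) / sqrt t)) \<partial>lborel) = ennreal (sqrt pi)"
    by simp
  have "ennreal (1 / sqrt \<mu>) * (ennreal (sqrt \<mu>) * (\<integral>\<^sup>+t. ennreal (indicator {0<..} t * (exp (- (t * \<mu>)) / sqrt t)) \<partial>lborel))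
     = ennreal (1 / sqrt \<mu> * sqrt pi)"
    unfolding eq using \<mu> by (subst ennreal_mult') auto
  then show ?thesis
    using \<mu> by (simp add: mult.assoc[symmetric] ennreal_mult'[symmetric] real_sqrt_divide)
qed

lemma nn_integral_inverse_sum_squares:
  assumes t: "0 < t"
  shows "(\<integral>\<^sup>+x. ennreal (1 / (t\<^sup>2 + x\<^sup>2)) \<partial>lborel) = ennreal (pi / t)"
proof -
  have "integrable lborel (\<lambda>x::real. inverse (1 + x\<^sup>2))"
    using integrable_inverse_1_plus_square by (simp add: set_integrable_def)
  moreover have "(LINT x|lborel. inverse (1 + x\<^sup>2)) = pi"
    using LBINT_inverse_1_plus_square by (simp add: interval_lebesgue_integral_def set_lebesgue_integral_def)
  ultimately have 1: "(\<integral>\<^sup>+x. ennreal (inverse (1 + x\<^sup>2)) \<partial>lborel) = ennreal pi"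
    by (subst nn_integral_eq_integral) auto
  have "(\<integral>\<^sup>+x. ennreal (1 / (t\<^sup>2 + x\<^sup>2)) \<partial>lborel) = \<bar>t\<bar> * (\<integral>\<^sup>+x. ennreal (1 / (t\<^sup>2 + (0 + t * x)\<^sup>2)) \<partial>lborel)"
    using t by (intro nn_integral_real_affine) auto
  also have "(\<integral>\<^sup>+x. ennreal (1 / (t\<^sup>2 + (0 + t * x)\<^sup>2)) \<partial>lborel) = (\<integral>\<^sup>+x. ennreal (1 / t\<^sup>2) * ennreal (inverse (1 + x\<^sup>2)) \<partial>lborel)"
  proof (rule nn_integral_cong)
    fix x :: real
    have "1 / (t\<^sup>2 + (0 + t * x)\<^sup>2) = 1 / t\<^sup>2 * inverse (1 + x\<^sup>2)"
      using t by (simp add: power_mult_distrib inverse_eq_divide flip: distrib_left[of "t\<^sup>2" 1, simplified])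
    then show "ennreal (1 / (t\<^sup>2 + (0 + t * x)\<^sup>2)) = ennreal (1 / t\<^sup>2) * ennreal (inverse (1 + x\<^sup>2))"
      by (simp only: ennreal_mult'[of "1 / t\<^sup>2"] zero_le_divide_1_iff zero_le_power2)
  qed
  also have "\<dots> = ennreal (1 / t\<^sup>2) * ennreal pi"
    unfolding 1[symmetric] by (rule nn_integral_cmult) measurable
  finally show ?thesis
    using t by (simp add: ennreal_mult'[symmetric] power2_eq_square)
qed

text \<open>Cauchy-Schwarz after distributing weights t^(-1/2) and t^(1/2) over two equal shares of
  the integrand. These exponents make the first factor free of x, while the second becomes the same
  integral again once integration over x has produced pi / t.\<close>

lemma laplace_nrm_power2_le:
  assumes \<mu>: "0 < \<mu>"
  shows "ennreal ((laplace_nrm \<mu> x)\<^sup>2) \<le> ennreal (sqrt (pi / \<mu>)) *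
    (\<integral>\<^sup>+t. ennreal (indicator {0<..} t * (exp (- (t * \<mu>)) * sqrt t / (t\<^sup>2 + x\<^sup>2))) \<partial>lborel)"
proof -
  define f where "f t = ennreal (indicator {0<..} t * sqrt (exp (- (t * \<mu>)) / sqrt t))" for t
  define g where "g t = ennreal (indicator {0<..} t * sqrt (exp (- (t * \<mu>)) * sqrt t / (t\<^sup>2 + x\<^sup>2)))" for t
  have [measurable]: "f \<in> borel_measurable borel" "g \<in> borel_measurable borel"
    unfolding f_def[abs_def] g_def[abs_def] by measurable
  have fg: "f t * g t = ennreal (indicator {0<..} t * (exp (- (t * \<mu>)) / sqrt (t\<^sup>2 + x\<^sup>2)))" for t
  proof (cases "0 < t")
    case True
    then have "sqrt (exp (- (t * \<mu>)) / sqrt t) * sqrt (exp (- (t * \<mu>)) * sqrt t / (t\<^sup>2 + x\<^sup>2))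
       = sqrt ((exp (- (t * \<mu>)))\<^sup>2 / (t\<^sup>2 + x\<^sup>2))"
      by (simp flip: real_sqrt_mult add: power2_eq_square)
    also have "\<dots> = exp (- (t * \<mu>)) / sqrt (t\<^sup>2 + x\<^sup>2)"
      by (simp add: real_sqrt_divide)
    finally show ?thesis
      using True by (simp add: f_def g_def ennreal_mult'[symmetric])
  qed (simp add: f_def g_def)
  have "ennreal (laplace_nrm \<mu> x) \<le> (\<integral>\<^sup>+t. f t * g t \<partial>lborel)"
  \<comment> \<open>Where the Laplace integral diverges, as at x = 0, its value is 0 by the
    convention for Bochner integrals.\<close>
  proof (cases "set_integrable lborel {0<..} (\<lambda>t. exp (- (t * \<mu>)) / sqrt (t\<^sup>2 + x\<^sup>2))")
    case True
    then show ?thesis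
      unfolding fg laplace_nrm_def set_lebesgue_integral_def set_integrable_def
      by (subst nn_integral_eq_integral) (auto simp: indicator_def)
  next
    case False
    then have "laplace_nrm \<mu> x = 0"
      unfolding laplace_nrm_def set_lebesgue_integral_def set_integrable_def
      by (simp add: not_integrable_integral_eq)
    then show ?thesis by simp
  qed
  then have "ennreal ((laplace_nrm \<mu> x)\<^sup>2) \<le> (\<integral>\<^sup>+t. f t * g t \<partial>lborel)\<^sup>2"
    by (simp add: ennreal_power[symmetric] power_mono)
  also have "\<dots> \<le> (\<integral>\<^sup>+t. (f t)\<^sup>2 \<partial>lborel) * (\<integral>\<^sup>+t. (g t)\<^sup>2 \<partial>lborel)"
    by (rule Cauchy_Schwarz_nn_integral) auto
  also have "(\<integral>\<^sup>+t. (f t)\<^sup>2 \<partial>lborel) = ennreal (sqrt (pi / \<mu>))"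
    unfolding nn_integral_exp_div_sqrt[OF \<mu>, symmetric] f_def
    by (intro nn_integral_cong) (auto simp: ennreal_power indicator_def)
  also have "(\<integral>\<^sup>+t. (g t)\<^sup>2 \<partial>lborel) = (\<integral>\<^sup>+t. ennreal (indicator {0<..} t * (exp (- (t * \<mu>)) * sqrt t / (t\<^sup>2 + x\<^sup>2))) \<partial>lborel)"
    unfolding g_def by (intro nn_integral_cong) (auto simp: ennreal_power indicator_def)
  finally show ?thesis .
qed

text \<open>By Tonelli and the integral pi / t of 1 / (t^2 + x^2) over x, the squared norm is at
  most sqrt (pi / \<mu>) * pi * sqrt (pi / \<mu>). The power \<mu>^(-1/2) is dictated by scaling, as
  the function depends on \<mu> x only.\<close>

lemma laplace_nrm_L2:
  assumes \<mu>: "0 < \<mu>"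
  shows "in_L2 lborel (laplace_nrm \<mu>)" and "L2_nrm (laplace_nrm \<mu>) \<le> pi / sqrt \<mu>"
proof -
  let ?K = "ennreal (sqrt (pi / \<mu>))"
  have "(\<integral>\<^sup>+x. ennreal ((laplace_nrm \<mu> x)\<^sup>2) \<partial>lborel) \<le>
    (\<integral>\<^sup>+x. ?K * (\<integral>\<^sup>+t. ennreal (indicator {0<..} t * (exp (- (t * \<mu>)) * sqrt t / (t\<^sup>2 + x\<^sup>2))) \<partial>lborel) \<partial>lborel)"
    by (intro nn_integral_mono laplace_nrm_power2_le \<mu>)
  also have "\<dots> = ?K * (\<integral>\<^sup>+x. (\<integral>\<^sup>+t. ennreal (indicator {0<..} t * (exp (- (t * \<mu>)) * sqrt t / (t\<^sup>2 + x\<^sup>2))) \<partial>lborel) \<partial>lborel)"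
    by (rule nn_integral_cmult) measurable
  also have "(\<integral>\<^sup>+x. (\<integral>\<^sup>+t. ennreal (indicator {0<..} t * (exp (- (t * \<mu>)) * sqrt t / (t\<^sup>2 + x\<^sup>2))) \<partial>lborel) \<partial>lborel)
    = (\<integral>\<^sup>+t. (\<integral>\<^sup>+x. ennreal (indicator {0<..} t * (exp (- (t * \<mu>)) * sqrt t / (t\<^sup>2 + x\<^sup>2))) \<partial>lborel) \<partial>lborel)"
    by (rule lborel_pair.Fubini') measurable
  also have "\<dots> = (\<integral>\<^sup>+t. ennreal pi * ennreal (indicator {0<..} t * (exp (- (t * \<mu>)) / sqrt t)) \<partial>lborel)"
  proof (rule nn_integral_cong)
    fix t :: real
    show "(\<integral>\<^sup>+x. ennreal (indicator {0<..} t * (exp (- (t * \<mu>)) * sqrt t / (t\<^sup>2 + x\<^sup>2))) \<partial>lborel)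
      = ennreal pi * ennreal (indicator {0<..} t * (exp (- (t * \<mu>)) / sqrt t))"
    proof (cases "0 < t")
      case True
      have "(\<integral>\<^sup>+x. ennreal (indicator {0<..} t * (exp (- (t * \<mu>)) * sqrt t / (t\<^sup>2 + x\<^sup>2))) \<partial>lborel)
        = (\<integral>\<^sup>+x. ennreal (exp (- (t * \<mu>)) * sqrt t) * ennreal (1 / (t\<^sup>2 + x\<^sup>2)) \<partial>lborel)"
        using True by (intro nn_integral_cong) (simp add: ennreal_mult'[symmetric])
      also have "\<dots> = ennreal (exp (- (t * \<mu>)) * sqrt t) * ennreal (pi / t)"
        unfolding nn_integral_inverse_sum_squares[OF True, symmetric] by (rule nn_integral_cmult) measurable
      also have "\<dots> = ennreal (exp (- (t * \<mu>)) * sqrt t * (pi / t))"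
        using True by (subst ennreal_mult') auto
      also have "exp (- (t * \<mu>)) * sqrt t * (pi / t) = pi * (exp (- (t * \<mu>)) / sqrt t)"
        using True by (simp add: field_simps)
      also have "ennreal (pi * (exp (- (t * \<mu>)) / sqrt t)) = ennreal pi * ennreal (exp (- (t * \<mu>)) / sqrt t)"
        by (rule ennreal_mult') simp
      finally show ?thesis
        using True by simp
    qed simp
  qed
  also have "\<dots> = ennreal pi * ?K"
    unfolding nn_integral_exp_div_sqrt[OF \<mu>, symmetric] by (rule nn_integral_cmult) measurable
  also have "?K * (ennreal pi * ?K) = ennreal (pi\<^sup>2 / \<mu>)"
  proof -
    have "sqrt (pi / \<mu>) * (pi * sqrt (pi / \<mu>)) = pi * (sqrt (pi / \<mu>) * sqrt (pi / \<mu>))"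
      by (rule mult.left_commute)
    also have "\<dots> = pi\<^sup>2 / \<mu>"
      using \<mu> by (simp add: power2_eq_square)
    finally show ?thesis
      using \<mu> by (simp only: ennreal_mult'[symmetric] pi_ge_zero real_sqrt_ge_zero divide_nonneg_pos)
  qed
  finally have le: "(\<integral>\<^sup>+x. ennreal ((laplace_nrm \<mu> x)\<^sup>2) \<partial>lborel) \<le> ennreal (pi\<^sup>2 / \<mu>)" .
  have int: "integrable lborel (\<lambda>x. (laplace_nrm \<mu> x)\<^sup>2)"
    by (rule integrableI_bounded) (use le in \<open>auto simp: order.strict_trans1\<close>)
  then show "in_L2 lborel (laplace_nrm \<mu>)"
    by (simp add: in_L2_def)
  have "ennreal (LINT x|lborel. (laplace_nrm \<mu> x)\<^sup>2) \<le> ennreal (pi\<^sup>2 / \<mu>)"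
    using le by (subst (asm) nn_integral_eq_integral[OF int]) auto
  then have "(LINT x|lborel. (laplace_nrm \<mu> x)\<^sup>2) \<le> pi\<^sup>2 / \<mu>"
    using \<mu> by (subst (asm) ennreal_le_iff) auto
  then have "sqrt (LINT x|lborel. (laplace_nrm \<mu> x)\<^sup>2) \<le> sqrt (pi\<^sup>2 / \<mu>)"
    by simp
  then show "L2_nrm (laplace_nrm \<mu>) \<le> pi / sqrt \<mu>"
    by (simp add: L2_nrm_def real_sqrt_divide)
qed

lemma integrable_product_bound:
  fixes F :: "real \<Rightarrow> real \<Rightarrow> complex" and f g :: "real \<Rightarrow> real"
  assumes F [measurable]: "(\<lambda>(x, y). F x y) \<in> borel_measurable (lborel \<Otimes>\<^sub>M lborel)"
    and f: "integrable lborel f" and g: "integrable lborel g"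
    and le: "\<And>x y. norm (F x y) \<le> f x * g y"
  shows "integrable (lborel \<Otimes>\<^sub>M lborel) (\<lambda>(x, y). F x y)"
proof (rule lborel_pair.Fubini_integrable)
  have le': "norm (F x y) \<le> norm (f x * g y)" for x y
    using le[of x y] by simp
  have int: "integrable lborel (\<lambda>y. F x y)" for x
    by (rule Bochner_Integration.integrable_bound[OF integrable_mult_right[OF g] _ AE_I2[OF le']]) measurable
  then show "AE x in lborel. integrable lborel (\<lambda>y. case (x, y) of (x, y) \<Rightarrow> F x y)"
    by simp
  have bound: "norm (LINT y|lborel. norm (F x y)) \<le> norm (f x * (LINT y|lborel. g y))" for x
  proof -
    have "(LINT y|lborel. norm (F x y)) \<le> (LINT y|lborel. f x * g y)"
      by (rule integral_mono[OF integrable_norm[OF int] integrable_mult_right[OF g] le])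
    moreover have "0 \<le> (LINT y|lborel. norm (F x y))" by simp
    ultimately show ?thesis by simp
  qed
  have "integrable lborel (\<lambda>x. LINT y|lborel. norm (F x y))"
    by (rule Bochner_Integration.integrable_bound[OF integrable_mult_left[OF f] _ AE_I2[OF bound]]) measurable
  then show "integrable lborel (\<lambda>x. LINT y|lborel. norm (case (x, y) of (x, y) \<Rightarrow> F x y))"
    by simp
qed (rule F)

lemma Fubini_product_bound:
  fixes F :: "real \<Rightarrow> real \<Rightarrow> complex" and f g :: "real \<Rightarrow> real"
  assumes "(\<lambda>(x, y). F x y) \<in> borel_measurable (lborel \<Otimes>\<^sub>M lborel)"
    and "integrable lborel f" "integrable lborel g" "\<And>x y. norm (F x y) \<le> f x * g y"
  shows "(LINT x|lborel. LINT y|lborel. F x y) = (LINT y|lborel. LINT x|lborel. F x y)"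
  using lborel_pair.Fubini_integral[OF integrable_product_bound[OF assms]] by simp

lemma set_integrable_exp_complex:
  assumes z: "0 < Re z"
  shows "set_integrable lborel {0<..} (\<lambda>t. exp (- z * of_real t))"
proof (rule set_integrable_bound[OF integrable_I0i_exp_mscale[OF z]])
  show "set_borel_measurable lborel {0<..} (\<lambda>t. exp (- z * complex_of_real t))"
    unfolding set_borel_measurable_def by measurable
qed (auto simp: norm_exp mult.commute)

lemma integral_exp_complex:
  assumes z: "0 < Re z"
  shows "(LINT t:{0<..}|lborel. exp (- z * of_real t)) = 1 / z"
proof -
  let ?f = "\<lambda>t. exp (- z * complex_of_real t)"
  have z0: "z \<noteq> 0" using z by auto
  have "((\<lambda>R. LINT t:{..R}|lborel. indicator {0<..} t *\<^sub>R ?f t) \<longlongrightarrow> (LINT t:{0<..}|lborel. ?f t)) at_top"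
    using integral_atMost_tendsto(2)[OF set_integrable_exp_complex[OF z, unfolded set_integrable_def]]
    by (simp add: set_lebesgue_integral_def)
  moreover have "\<forall>\<^sub>F R in at_top. (LINT t:{..R}|lborel. indicator {0<..} t *\<^sub>R ?f t) = 1 / z - exp (- z * of_real R) / z"
    using eventually_ge_at_top[of 0]
  proof eventually_elim
    case (elim R)
    define F where "F t = - exp (- z * of_real t) / z" for t :: real
    have "(LINT t:{..R}|lborel. indicator {0<..} t *\<^sub>R ?f t) = (LINT t|lborel. indicator {0..R} t *\<^sub>R ?f t)"
      unfolding set_lebesgue_integral_def
    proof (rule integral_cong_AE)
      show "AE t in lborel. indicator {..R} t *\<^sub>R indicator {0<..} t *\<^sub>R ?f t = indicator {0..R} t *\<^sub>R ?f t"
        using AE_lborel_singleton[of "0::real"] by eventually_elim (auto simp: indicator_def)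
    qed measurable
    also have "\<dots> = F R - F 0"
    proof (rule integral_FTC_atLeastAtMost[OF elim])
      fix t :: real
      have "((\<lambda>w. - exp (- z * w) / z) has_field_derivative exp (- z * of_real t)) (at (of_real t))"
        by (rule derivative_eq_intros refl | use z0 in simp)+
      from has_vector_derivative_real_field[OF this]
      show "(F has_vector_derivative exp (- z * of_real t)) (at t within {0..R})"
        by (simp add: F_def[abs_def])
    qed (intro continuous_intros)
    finally show ?case by (simp add: F_def)
  qed
  ultimately have "((\<lambda>R. 1 / z - exp (- z * of_real R) / z) \<longlongrightarrow> (LINT t:{0<..}|lborel. ?f t)) at_top"
    by (rule Lim_transform_eventually)
  moreover have "((\<lambda>R. 1 / z - exp (- z * of_real R) / z) \<longlongrightarrow> 1 / z - 0 / z) at_top"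
  proof (intro tendsto_intros)
    have "((\<lambda>R. exp (- (Re z * R))) \<longlongrightarrow> 0) at_top"
      using z by real_asymp
    then show "((\<lambda>R. exp (- z * complex_of_real R)) \<longlongrightarrow> 0) at_top"
      by (intro tendsto_norm_zero_cancel[where f="\<lambda>R. exp (- z * complex_of_real R)"]) (simp add: norm_exp)
  qed (use z0 in auto)
  ultimately show ?thesis
    using tendsto_unique[OF trivial_limit_at_top_linorder] by fastforce
qed

section \<open>Rotation of the half line onto a ray\<close>

definition ray_kernel :: "complex \<Rightarrow> complex \<Rightarrow> real \<Rightarrow> complex"
  where "ray_kernel c k x =
    (LINT t:{0<..}|lborel. c * exp (c * k * of_real t) / (c * of_real t - \<i> * of_real x))"

definition half_line_integral :: "complex \<Rightarrow> real \<Rightarrow> real \<Rightarrow> complex"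
  where "half_line_integral k x R = integral {0..R} (\<lambda>\<xi>. iexp (x * \<xi>) / (of_real \<xi> - k))"

lemma ray_kernel_measurable [measurable]: "ray_kernel c k \<in> borel_measurable borel"
  unfolding ray_kernel_def[abs_def] set_lebesgue_integral_def by measurable

text \<open>The ray \<open>{c t | t > 0}\<close> is the contour to which the half line is rotated; it lies in the
  half plane where \<open>exp (k z)\<close> decays and stays away from the pole \<open>z = \<i> x\<close>.\<close>

locale ray =
  fixes c k :: complex and \<delta> \<mu> x :: real
  assumes c: "0 < Re c" and \<delta>: "0 < \<delta>" and \<mu>: "0 < \<mu>" and x: "x \<noteq> 0"
    and decay: "Re (c * k) = - \<mu>"
    and away: "\<And>t. 0 \<le> t \<Longrightarrow> \<delta> * sqrt (t\<^sup>2 + x\<^sup>2) \<le> cmod (c * of_real t - \<i> * of_real x)"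
begin

lemma denom_pos: "0 \<le> t \<Longrightarrow> 0 < \<delta> * sqrt (t\<^sup>2 + x\<^sup>2)"
  using \<delta> x by (auto intro!: mult_pos_pos simp: sum_power2_gt_zero_iff)

lemma denom_nz: "0 \<le> t \<Longrightarrow> c * of_real t - \<i> * of_real x \<noteq> 0"
  using denom_pos[of t] away[of t] by auto

text \<open>Value of the inner integral over the frequencies [0, R] at fixed t, after the order of
  integration is exchanged. The subtracted exponential is the contribution of the endpoint
  R.\<close>

definition integrand :: "real \<Rightarrow> real \<Rightarrow> complex"
  where "integrand R t = c * exp (c * k * of_real t) * (1 - exp ((\<i> * of_real x - c * of_real t) * of_real R))
    / (c * of_real t - \<i> * of_real x)"

lemma norm_exp_ck: "cmod (exp (c * k * of_real t)) = exp (- (t * \<mu>))"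
proof -
  have "Re (c * k * of_real t) = Re (c * k) * t"
    by simp
  then show ?thesis
    by (simp only: norm_exp decay) (simp add: mult.commute)
qed

lemma base_bound:
  assumes t: "0 < t"
  shows "cmod (c * exp (c * k * of_real t) / (c * of_real t - \<i> * of_real x))
    \<le> cmod c / \<delta> * (exp (- (t * \<mu>)) / sqrt (t\<^sup>2 + x\<^sup>2))"
proof -
  have "cmod (c * exp (c * k * of_real t) / (c * of_real t - \<i> * of_real x))
      = cmod c * exp (- (t * \<mu>)) / cmod (c * of_real t - \<i> * of_real x)"
    by (simp only: norm_mult norm_divide norm_exp_ck)
  also have "\<dots> \<le> cmod c * exp (- (t * \<mu>)) / (\<delta> * sqrt (t\<^sup>2 + x\<^sup>2))"
    using t denom_pos[of t] away[of t]
    by (intro divide_left_mono mult_pos_pos[OF less_le_trans[OF denom_pos away] denom_pos]) auto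
  finally show ?thesis by simp
qed

lemma integrand_bound:
  assumes t: "0 < t" and R: "0 \<le> R"
  shows "cmod (integrand R t) \<le> 2 * cmod c / \<delta> * (exp (- (t * \<mu>)) / sqrt (t\<^sup>2 + x\<^sup>2))"
proof -
  have "cmod (1 - exp ((\<i> * of_real x - c * of_real t) * of_real R)) \<le> 1 + 1"
    using t R c by (intro norm_triangle_le_diff add_mono) (auto simp: norm_exp)
  then have "cmod (1 - exp ((\<i> * of_real x - c * of_real t) * of_real R)) *
      cmod (c * exp (c * k * of_real t) / (c * of_real t - \<i> * of_real x))
     \<le> 2 * (cmod c / \<delta> * (exp (- (t * \<mu>)) / sqrt (t\<^sup>2 + x\<^sup>2)))"
    using base_bound[OF t] by (intro mult_mono) auto
  then show ?thesis
    by (simp add: integrand_def norm_mult norm_divide mult_ac)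
qed

lemma dominating: "integrable lborel (\<lambda>t. indicator {0<..} t * (C * (exp (- (t * \<mu>)) / sqrt (t\<^sup>2 + x\<^sup>2))))"
  using integrable_mult_right[OF laplace_integrable[OF \<mu> x, unfolded set_integrable_def], of C]
  by (simp add: mult_ac)

lemma integrand_measurable [measurable]: "integrand R \<in> borel_measurable borel"
  unfolding integrand_def[abs_def] by measurable

text \<open>Fubini performs the rotation: 1 / (\<xi> - k) is c times the integral over t > 0 of exp
  (- c (\<xi> - k) t), which converges because Re (c (\<xi> - k)) >= \<mu> > 0 for \<xi> >= 0.
  Integrating over \<xi> before t leaves \<open>integrand\<close>.\<close>

lemma half_line_integral_eq:
  assumes R: "0 \<le> R"
  shows "half_line_integral k x R = (LINT t:{0<..}|lborel. integrand R t)"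
proof -
  define z where "z \<xi> = c * (of_real \<xi> - k)" for \<xi> :: real
  have z: "0 < Re (z \<xi>)" if "0 \<le> \<xi>" for \<xi>
  proof -
    have "Re (z \<xi>) = Re c * \<xi> + \<mu>"
      using decay by (simp add: z_def right_diff_distrib)
    then show ?thesis using c \<mu> that by (simp add: add_nonneg_pos)
  qed
  have c0: "c \<noteq> 0" using c by auto
  have nz: "of_real \<xi> - k \<noteq> 0" if "0 \<le> \<xi>" for \<xi>
    using z[OF that] by (auto simp: z_def)
  define F where "F \<xi> t = indicator {0..R} \<xi> *\<^sub>R indicator {0<..} t *\<^sub>R
    (iexp (x * \<xi>) * c * exp (- z \<xi> * of_real t))" for \<xi> t :: real
  have "set_integrable lborel {0..R} (\<lambda>\<xi>. iexp (x * \<xi>) / (of_real \<xi> - k))"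
    unfolding set_integrable_def
    by (intro borel_integrable_compact continuous_intros) (use nz in auto)
  then have "half_line_integral k x R = (LINT \<xi>:{0..R}|lborel. iexp (x * \<xi>) / (of_real \<xi> - k))"
    unfolding half_line_integral_def by (rule set_borel_integral_eq_integral(2)[symmetric])
  also have "\<dots> = (LINT \<xi>|lborel. LINT t|lborel. F \<xi> t)"
    unfolding set_lebesgue_integral_def
  proof (rule Bochner_Integration.integral_cong[OF refl])
    fix \<xi> :: real
    show "indicator {0..R} \<xi> *\<^sub>R (iexp (x * \<xi>) / (of_real \<xi> - k)) = (LINT t|lborel. F \<xi> t)"
    proof (cases "\<xi> \<in> {0..R}")
      case True
      then have "0 \<le> \<xi>" by simp
      have "(LINT t|lborel. F \<xi> t) = (LINT t:{0<..}|lborel. iexp (x * \<xi>) * c * exp (- z \<xi> * of_real t))"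
        by (simp only: F_def set_lebesgue_integral_def indicator_simps(1)[OF True] scaleR_one)
      also have "\<dots> = iexp (x * \<xi>) * c * (1 / z \<xi>)"
        unfolding set_integral_mult_right integral_exp_complex[OF z[OF \<open>0 \<le> \<xi>\<close>]] ..
      finally show ?thesis
        using True c0 by (simp add: z_def)
    qed (simp add: F_def)
  qed
  also have "\<dots> = (LINT t|lborel. LINT \<xi>|lborel. F \<xi> t)"
  proof (rule Fubini_product_bound)
    show "(\<lambda>(\<xi>, t). F \<xi> t) \<in> borel_measurable (lborel \<Otimes>\<^sub>M lborel)"
      unfolding F_def z_def by measurable
    show "integrable lborel (indicator {0..R} :: real \<Rightarrow> real)"
      by (simp add: integrable_indicator_iff emeasure_lborel_Icc_eq)
    show "integrable lborel (\<lambda>t. cmod c * (indicator {0<..} t *\<^sub>R exp (- (t * \<mu>))))"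
      using integrable_I0i_exp_mscale[OF \<mu>] unfolding set_integrable_def by (rule integrable_mult_right)
    fix \<xi> t :: real
    show "norm (F \<xi> t) \<le> indicator {0..R} \<xi> * (cmod c * (indicator {0<..} t *\<^sub>R exp (- (t * \<mu>))))"
    proof (cases "\<xi> \<in> {0..R} \<and> 0 < t")
      case True
      then have "Re (z \<xi>) * t \<ge> t * \<mu>"
        using c decay by (simp add: z_def right_diff_distrib distrib_right mult.commute)
      then have "norm (F \<xi> t) \<le> cmod c * exp (- (t * \<mu>))"
        using True by (simp add: F_def norm_mult norm_exp mult_left_mono)
      then show ?thesis using True by simp
    qed (auto simp: F_def)
  qed
  also have "\<dots> = (LINT t:{0<..}|lborel. integrand R t)"
    unfolding set_lebesgue_integral_def
  proof (rule Bochner_Integration.integral_cong[OF refl])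
    fix t :: real
    show "(LINT \<xi>|lborel. F \<xi> t) = indicator {0<..} t *\<^sub>R integrand R t"
    proof (cases "0 < t")
      case True
      define w where "w = \<i> * of_real x - c * of_real t"
      have w: "w \<noteq> 0" using denom_nz[of t] True by (auto simp: w_def)
      define H where "H \<xi> = c * exp (c * k * of_real t) * exp (w * of_real \<xi>) / w" for \<xi> :: real
      have "(LINT \<xi>|lborel. F \<xi> t) = (LINT \<xi>|lborel. indicator {0..R} \<xi> *\<^sub>R (c * exp (c * k * of_real t) * exp (w * of_real \<xi>)))"
      proof (rule Bochner_Integration.integral_cong[OF refl])
        fix \<xi> :: real
        have "iexp (x * \<xi>) * c * exp (- z \<xi> * of_real t) = c * (iexp (x * \<xi>) * exp (- z \<xi> * of_real t))"
          by (simp add: mult_ac)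
        also have "\<dots> = c * exp (c * k * of_real t) * exp (w * of_real \<xi>)"
          unfolding mult.assoc exp_add[symmetric] z_def w_def by (simp add: algebra_simps)
        finally show "F \<xi> t = indicator {0..R} \<xi> *\<^sub>R (c * exp (c * k * of_real t) * exp (w * of_real \<xi>))"
          using True by (simp add: F_def)
      qed
      also have "\<dots> = H R - H 0"
      proof (rule integral_FTC_atLeastAtMost[OF R])
        fix \<xi> :: real
        have "((\<lambda>\<zeta>. c * exp (c * k * of_real t) * exp (w * \<zeta>) / w) has_field_derivative
            c * exp (c * k * of_real t) * exp (w * of_real \<xi>)) (at (of_real \<xi>))"
          by (rule derivative_eq_intros refl | use w in simp)+
        from has_vector_derivative_real_field[OF this]
        show "(H has_vector_derivative c * exp (c * k * of_real t) * exp (w * of_real \<xi>)) (at \<xi> within {0..R})"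
          by (simp add: H_def[abs_def])
      qed (intro continuous_intros)
      also have "\<dots> = integrand R t"
      proof -
        have "c * of_real t - \<i> * of_real x = - w" by (simp add: w_def)
        then have "integrand R t = c * exp (c * k * of_real t) * (1 - exp (w * of_real R)) / (- w)"
          by (simp only: integrand_def w_def)
        then show ?thesis
          using w by (simp add: H_def field_simps)
      qed
      finally show ?thesis using True by simp
    qed (simp add: F_def)
  qed
  finally show ?thesis .
qed

text \<open>The factor 2 accounts for the endpoint exponential, of modulus at most 1. Uniformity in
  the cutoff R lets the same majorant dominate truncated kernels and not only their limit.\<close>

lemma half_line_integral_bound:
  assumes R: "0 \<le> R"
  shows "cmod (half_line_integral k x R) \<le> 2 * cmod c / \<delta> * laplace_nrm \<mu> x"
proof -
  let ?g = "\<lambda>t. indicator {0<..} t * (2 * cmod c / \<delta> * (exp (- (t * \<mu>)) / sqrt (t\<^sup>2 + x\<^sup>2)))"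
  have le: "norm (indicator {0<..} t *\<^sub>R integrand R t) \<le> ?g t" for t
    using integrand_bound[OF _ R, of t] by (simp add: indicator_def)
  have le': "norm (indicator {0<..} t *\<^sub>R integrand R t) \<le> norm (?g t)" for t
    using le[of t] abs_ge_self[of "?g t"] by (simp only: real_norm_def)
  have "integrable lborel (\<lambda>t. indicator {0<..} t *\<^sub>R integrand R t)"
    by (rule Bochner_Integration.integrable_bound[OF dominating _ AE_I2[OF le']]) measurable
  then have "cmod (LINT t|lborel. indicator {0<..} t *\<^sub>R integrand R t) \<le> (LINT t|lborel. ?g t)"
    by (intro order_trans[OF integral_norm_bound integral_mono] le dominating integrable_norm)
  also have "(LINT t|lborel. ?g t) = 2 * cmod c / \<delta> * laplace_nrm \<mu> x"
    unfolding laplace_nrm_def set_lebesgue_integral_def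
    by (subst integral_mult_right_zero[symmetric]) (simp add: mult_ac)
  finally show ?thesis
    unfolding half_line_integral_eq[OF R] set_lebesgue_integral_def .
qed

lemma half_line_integral_tendsto: "(half_line_integral k x \<longlongrightarrow> ray_kernel c k x) at_top"
proof (rule Lim_transform_eventually)
  show "\<forall>\<^sub>F R in at_top. (LINT t:{0<..}|lborel. integrand R t) = half_line_integral k x R"
    using eventually_ge_at_top[of 0] by eventually_elim (simp add: half_line_integral_eq)
  show "((\<lambda>R. LINT t:{0<..}|lborel. integrand R t) \<longlongrightarrow> ray_kernel c k x) at_top"
    unfolding ray_kernel_def set_lebesgue_integral_def
  proof (rule integral_dominated_convergence_at_top[OF _ _ dominating])
    show "\<forall>\<^sub>F R in at_top. AE t in lborel. norm (indicator {0<..} t *\<^sub>R integrand R t)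
       \<le> indicator {0<..} t * (2 * cmod c / \<delta> * (exp (- (t * \<mu>)) / sqrt (t\<^sup>2 + x\<^sup>2)))"
      using eventually_ge_at_top[of 0]
      by eventually_elim (rule AE_I2, use integrand_bound in \<open>auto simp: indicator_def\<close>)
    show "AE t in lborel. ((\<lambda>R. indicator {0<..} t *\<^sub>R integrand R t) \<longlongrightarrow>
       indicator {0<..} t *\<^sub>R (c * exp (c * k * of_real t) / (c * of_real t - \<i> * of_real x))) at_top"
    proof (rule AE_I2)
      fix t :: real
      show "((\<lambda>R. indicator {0<..} t *\<^sub>R integrand R t) \<longlongrightarrow>
       indicator {0<..} t *\<^sub>R (c * exp (c * k * of_real t) / (c * of_real t - \<i> * of_real x))) at_top"
      proof (cases "0 < t")
        case True
        have "((\<lambda>R. exp (- (Re c * t * R))) \<longlongrightarrow> 0) at_top"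
          using c True by real_asymp
        then have "((\<lambda>R. exp ((\<i> * of_real x - c * of_real t) * of_real R)) \<longlongrightarrow> 0) at_top"
          by (intro tendsto_norm_zero_cancel[where f="\<lambda>R. exp ((\<i> * of_real x - c * of_real t) * of_real R)"])
            (simp add: norm_exp mult_ac)
        then have "((\<lambda>R. integrand R t) \<longlongrightarrow>
          c * exp (c * k * of_real t) * (1 - 0) / (c * of_real t - \<i> * of_real x)) at_top"
          unfolding integrand_def by (intro tendsto_intros) (use denom_nz[of t] True in auto)
        then show ?thesis using True by auto
      qed simp
    qed
  qed measurable
qed

lemma ray_kernel_bound: "cmod (ray_kernel c k x) \<le> 2 * cmod c / \<delta> * laplace_nrm \<mu> x"
proof (rule tendsto_upperbound[OF tendsto_norm[OF half_line_integral_tendsto]])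
  show "\<forall>\<^sub>F R in at_top. cmod (half_line_integral k x R) \<le> 2 * cmod c / \<delta> * laplace_nrm \<mu> x"
    using eventually_ge_at_top[of 0] by eventually_elim (rule half_line_integral_bound)
qed simp

end

lemma G_off_eqI:
  assumes "(half_line_integral k x \<longlongrightarrow> L) at_top"
  shows "G_off k x = L / (2 * of_real pi)"
proof -
  have "Lim at_top (half_line_integral k x) = L"
    by (rule tendsto_Lim[OF _ assms]) simp
  then show ?thesis
    unfolding G_off_def half_line_integral_def[abs_def] by simp
qed

lemma half_line_integral_cnj: "half_line_integral (cnj k) x R = cnj (half_line_integral k (- x) R)"
  unfolding half_line_integral_def integral_cnj by (simp add: exp_cnj)

lemma ray_one:
  assumes "Re k < 0" "x \<noteq> 0" shows "ray 1 k 1 (- Re k) x"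
proof
  show "1 * sqrt (t\<^sup>2 + x\<^sup>2) \<le> cmod (1 * complex_of_real t - \<i> * complex_of_real x)" for t
    by (simp add: cmod_def)
qed (use assms in auto)

text \<open>For this direction Re ((1 + \<i>) k) = Re k - Im k, so it also reaches points k with
  nonnegative real part. The constant 1/2 comes from t^2 + x^2 <= 4 (t^2 + (t - x)^2), whose
  difference is written as a sum of squares.\<close>

lemma ray_one_plus_i:
  assumes "Re k < Im k" "x \<noteq> 0" shows "ray (1 + \<i>) k (1/2) (Im k - Re k) x"
proof
  fix t :: real
  have "t\<^sup>2 + x\<^sup>2 \<le> 4 * (t\<^sup>2 + (t - x)\<^sup>2)"
  proof -
    have "4 * (t\<^sup>2 + (t - x)\<^sup>2) - (t\<^sup>2 + x\<^sup>2) = (3 * (x - 4 / 3 * t)\<^sup>2) + (5 / 3) * t\<^sup>2"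
      by (simp add: power2_eq_square field_simps)
    moreover have "0 \<le> (3 * (x - 4 / 3 * t)\<^sup>2) + (5 / 3) * t\<^sup>2" by simp
    ultimately show ?thesis by linarith
  qed
  then have "sqrt (t\<^sup>2 + x\<^sup>2) \<le> sqrt (4 * (t\<^sup>2 + (t - x)\<^sup>2))"
    by (rule real_sqrt_le_mono)
  also have "\<dots> = 2 * sqrt (t\<^sup>2 + (t - x)\<^sup>2)"
    by (simp only: real_sqrt_mult real_sqrt_four)
  finally show "1 / 2 * sqrt (t\<^sup>2 + x\<^sup>2) \<le> cmod ((1 + \<i>) * complex_of_real t - \<i> * complex_of_real x)"
    by (simp add: cmod_def)
qed (use assms in auto)

section \<open>Evaluation of the kernels\<close>

text \<open>The integral over the whole line, by Cauchy's formula on the rectangle of height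
  \<open>sqrt R\<close> in the half plane where the exponential decays.\<close>

lemma rectangle_sides_bound:
  fixes x R :: real and k :: complex
  assumes R: "0 < R" "cmod k < R" "cmod k < sqrt R" and s: "s = 1 \<or> s = -1" and sx: "0 < s * x"
  defines "f \<equiv> \<lambda>w. exp (\<i> * of_real x * w) / (w - k)"
  defines "p \<equiv> Complex R (s * sqrt R)" and "q \<equiv> Complex (- R) (s * sqrt R)"
  shows "cmod (contour_integral (linepath (of_real R) p) f) \<le> 1 / (R - cmod k) * sqrt R" (is ?A)
    and "cmod (contour_integral (linepath p q) f) \<le> exp (- (\<bar>x\<bar> * sqrt R)) / (sqrt R - cmod k) * (2 * R)" (is ?B)
    and "cmod (contour_integral (linepath q (- of_real R)) f) \<le> 1 / (R - cmod k) * sqrt R" (is ?C)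
    and "k \<notin> closed_segment (of_real R) p" "k \<notin> closed_segment p q" "k \<notin> closed_segment q (- of_real R)"
proof -
  have sx': "s * x = \<bar>x\<bar>" using s sx by auto
  have im: "- (x * (s * b)) = - (\<bar>x\<bar> * b)" for b
    unfolding sx'[symmetric] by simp
  have fn: "cmod (f w) \<le> exp (- (x * Im w)) / D" if "0 < D" "D \<le> cmod (w - k)" for w D
    unfolding f_def norm_divide norm_exp using that by (auto intro!: divide_left_mono mult_pos_pos)
  have seg1: "\<bar>Re w\<bar> = R \<and> x * Im w \<ge> 0" if "w \<in> closed_segment (of_real R) p \<or> w \<in> closed_segment q (- of_real R)" for w
  proof -
    obtain t where t: "0 \<le> t" "t \<le> 1" and w: "\<bar>Re w\<bar> = R" "Im w = t * (s * sqrt R)"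
    proof (cases "w \<in> closed_segment (of_real R) p")
      case True
      then obtain t where t: "0 \<le> t" "t \<le> 1" and w: "w = (1 - t) *\<^sub>R of_real R + t *\<^sub>R p"
        by (auto simp: in_segment)
      have "Re w = R" "Im w = t * (s * sqrt R)"
        by (simp_all add: w p_def left_diff_distrib)
      then show thesis
        using R t by (intro that[of t]) auto
    next
      case False
      with \<open>w \<in> closed_segment (of_real R) p \<or> w \<in> closed_segment q (- of_real R)\<close>
      have "w \<in> closed_segment q (- of_real R)" by simp
      then obtain t where t: "0 \<le> t" "t \<le> 1" and w: "w = (1 - t) *\<^sub>R q + t *\<^sub>R (- of_real R)"
        by (auto simp: in_segment)
      have "Re w = - R" "Im w = (1 - t) * (s * sqrt R)"
        by (simp_all add: w q_def left_diff_distrib)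
      then show thesis
        using R t by (intro that[of "1 - t"]) auto
    qed
    have "x * Im w = t * sqrt R * (s * x)" by (simp add: w mult_ac)
    moreover have "0 \<le> t * sqrt R * (s * x)"
      using R by (intro mult_nonneg_nonneg[OF mult_nonneg_nonneg[OF t(1)] less_imp_le[OF sx]]) simp
    ultimately show ?thesis by (simp only: w(1) simp_thms)
  qed
  have seg2: "Im w = s * sqrt R" if mem: "w \<in> closed_segment p q" for w
  proof -
    obtain t where w: "w = (1 - t) *\<^sub>R p + t *\<^sub>R q"
      using mem unfolding in_segment by blast
    show ?thesis
      by (simp add: w p_def q_def left_diff_distrib)
  qed
  have d1: "R - cmod k \<le> cmod (w - k)" if "\<bar>Re w\<bar> = R" for w
    using abs_Re_le_cmod[of w] norm_triangle_ineq2[of w k] that by linarith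
  have d2: "sqrt R - cmod k \<le> cmod (w - k)" if "Im w = s * sqrt R" for w
    using abs_Im_le_cmod[of w] norm_triangle_ineq2[of w k] that s R by (auto simp: abs_mult)
  have k1: "w \<noteq> k" if "\<bar>Re w\<bar> = R" for w
    using d1[OF that] R by auto
  have k2: "w \<noteq> k" if "Im w = s * sqrt R" for w
    using d2[OF that] R by auto
  show "k \<notin> closed_segment (of_real R) p" "k \<notin> closed_segment q (- of_real R)" "k \<notin> closed_segment p q"
    using seg1 k1 seg2 k2 by blast+
  have ci: "f contour_integrable_on linepath a b" if "k \<notin> closed_segment a b" for a b
    unfolding f_def by (intro contour_integrable_continuous_linepath continuous_intros) (use that in auto)
  have side: "cmod (contour_integral (linepath a b) f) \<le> 1 / (R - cmod k) * sqrt R"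
    if sg: "\<And>w. w \<in> closed_segment a b \<Longrightarrow> \<bar>Re w\<bar> = R \<and> x * Im w \<ge> 0" and len: "cmod (b - a) = sqrt R" for a b
  proof -
    have "cmod (f w) \<le> 1 / (R - cmod k)" if w: "w \<in> closed_segment a b" for w
    proof -
      have "cmod (f w) \<le> exp (- (x * Im w)) / (R - cmod k)"
        using R d1 sg[OF w] by (intro fn) auto
      also have "\<dots> \<le> 1 / (R - cmod k)"
        using R sg[OF w] by (intro divide_right_mono) auto
      finally show ?thesis .
    qed
    then show ?thesis
      unfolding len[symmetric] using R sg k1
      by (intro contour_integral_bound_linepath ci) auto
  qed
  have lens: "cmod (p - of_real R) = sqrt R" "cmod (- of_real R - q) = sqrt R"
    using s R by (auto simp: p_def q_def cmod_def)
  show ?A by (rule side[OF _ lens(1)]) (rule seg1, simp)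
  show ?C by (rule side[OF _ lens(2)]) (rule seg1, simp)
  have "cmod (f w) \<le> exp (- (\<bar>x\<bar> * sqrt R)) / (sqrt R - cmod k)" if mem: "w \<in> closed_segment p q" for w
    using fn[of "sqrt R - cmod k" w] d2[OF seg2[OF mem]] R im[of "sqrt R"] unfolding seg2[OF mem] by simp
  moreover have len: "cmod (q - p) = 2 * R"
  proof -
    have "q - p = of_real (- (2 * R))"
      by (simp add: complex_eq_iff p_def q_def)
    then show ?thesis
      using R by (simp only: norm_of_real)
  qed
  moreover have "f contour_integrable_on linepath p q"
    by (rule ci) (use k2 seg2 in blast)
  ultimately show ?B
    unfolding len[symmetric] using R by (intro contour_integral_bound_linepath) auto
qed

text \<open>For x > 0 the rectangle points upwards and the residue at k is the wave; for x < 0 it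
  points downwards and stays in Im w < Im k, where the integrand is holomorphic. The height sqrt R
  balances the sides: the vertical ones are of order R^(-1/2), the far one of order sqrt R * exp (-
  |x| sqrt R).\<close>

lemma line_integral_tendsto:
  fixes x :: real and k :: complex
  assumes k: "0 < Im k" and x: "x \<noteq> 0"
  shows "((\<lambda>R. integral {-R..R} (\<lambda>\<xi>. iexp (x * \<xi>) / (of_real \<xi> - k)))
    \<longlongrightarrow> 2 * of_real pi * \<i> * exp (\<i> * k * of_real x) * indicator {0<..} x) at_top"
proof -
  define V where "V = 2 * of_real pi * \<i> * exp (\<i> * k * of_real x) * indicator {0<..} x"
  define I where "I R = integral {-R..R} (\<lambda>\<xi>. iexp (x * \<xi>) / (of_real \<xi> - k))" for R
  define s :: real where "s = sgn x"
  have s: "s = 1 \<or> s = -1" and sx: "0 < s * x"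
    using x by (auto simp: s_def sgn_if)
  define f where "f w = exp (\<i> * of_real x * w) / (w - k)" for w
  have main: "cmod (I R - V) \<le> 2 * (1 / (R - cmod k) * sqrt R) + exp (- (\<bar>x\<bar> * sqrt R)) / (sqrt R - cmod k) * (2 * R)"
    if R: "0 < R" "cmod k < R" "cmod k < sqrt R" for R
  proof -
    define p where "p = Complex R (s * sqrt R)"
    define q where "q = Complex (- R) (s * sqrt R)"
    note sides = rectangle_sides_bound[OF R s sx, folded f_def p_def q_def]
    have base: "k \<notin> closed_segment (- of_real R) (of_real R)"
    proof
      assume "k \<in> closed_segment (- of_real R) (of_real R)"
      then have "Im k = 0" by (auto simp: in_segment)
      with k show False by simp
    qed
    have ci: "f contour_integrable_on linepath a b" if "k \<notin> closed_segment a b" for a b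
      unfolding f_def by (intro contour_integrable_continuous_linepath continuous_intros) (use that in auto)
    define \<gamma> where "\<gamma> = linepath (- of_real R) (of_real R) +++ linepath (of_real R) p +++ linepath p q +++ linepath q (- of_real R)"
    have "contour_integral \<gamma> f = V"
    proof (cases "0 < x")
      case True
      have "\<gamma> = rectpath (- of_real R) p"
        using True by (simp add: \<gamma>_def rectpath_def Let_def p_def q_def s_def complex_eq_iff flip: complex_of_real_def)
      moreover have box: "k \<in> box (- of_real R) p"
        using k True R abs_Re_le_cmod[of k] abs_Im_le_cmod[of k] by (auto simp: p_def s_def in_box_complex_iff)
      have "((\<lambda>w. exp (\<i> * of_real x * w) / (w - k)) has_contour_integral
         2 * pi * \<i> * winding_number (rectpath (- of_real R) p) k * exp (\<i> * of_real x * k)) (rectpath (- of_real R) p)"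
      proof (rule Cauchy_integral_formula_convex_simple[of UNIV])
        show "path_image (rectpath (- complex_of_real R) p) \<subseteq> UNIV - {k}"
          using box path_image_rectpath_inter_box[of "- complex_of_real R" p] R True
          by (auto simp: p_def s_def)
      qed (auto intro!: holomorphic_intros)
      ultimately show ?thesis
        using True unfolding winding_number_rectpath[OF box]
        by (simp add: V_def f_def[abs_def] contour_integral_unique mult_ac)
    next
      case False
      let ?S = "{w. Im w < Im k}"
      have "convex ?S" by (rule convex_halfspace_Im_lt)
      have mem: "- of_real R \<in> ?S" "of_real R \<in> ?S" "p \<in> ?S" "q \<in> ?S"
        using k False x R by (auto simp: p_def q_def s_def intro: less_trans[of _ 0])
      note seg = closed_segment_subset[OF _ _ \<open>convex ?S\<close>]
      have "path_image \<gamma> \<subseteq> ?S"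
        unfolding \<gamma>_def
        by (simp only: path_image_join pathstart_linepath pathfinish_linepath pathstart_join path_image_linepath Un_least seg mem)
      moreover have "f holomorphic_on ?S"
        unfolding f_def by (intro holomorphic_intros) auto
      ultimately have "(f has_contour_integral 0) \<gamma>"
        using \<open>convex ?S\<close> by (intro Cauchy_theorem_convex_simple[of f ?S]) (auto simp: \<gamma>_def)
      then show ?thesis
        using False by (simp add: V_def contour_integral_unique)
    qed
    moreover have "contour_integral \<gamma> f = contour_integral (linepath (- of_real R) (of_real R)) f +
       (contour_integral (linepath (of_real R) p) f + (contour_integral (linepath p q) f + contour_integral (linepath q (- of_real R)) f))"
      unfolding \<gamma>_def using ci sides(4-6) base
      by (simp add: contour_integrable_joinI)
    moreover have "contour_integral (linepath (- of_real R) (of_real R)) f = I R"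
      using contour_integral_linepath_Reals_eq[of "- of_real R" "of_real R" f] R
      by (simp add: I_def f_def mult.assoc)
    ultimately have "I R - V = - (contour_integral (linepath (of_real R) p) f + (contour_integral (linepath p q) f + contour_integral (linepath q (- of_real R)) f))"
      by (simp add: algebra_simps)
    then have "cmod (I R - V) \<le> cmod (contour_integral (linepath (of_real R) p) f) +
      (cmod (contour_integral (linepath p q) f) + cmod (contour_integral (linepath q (- of_real R)) f))"
      by (simp only: norm_minus_cancel) (intro norm_triangle_mono order_refl)
    with sides(1-3) show ?thesis by linarith
  qed
  have "((\<lambda>R. I R - V) \<longlongrightarrow> 0) at_top"
  proof (rule Lim_null_comparison)
    have ev: "\<forall>\<^sub>F R in at_top. 0 < R \<and> cmod k < R \<and> cmod k < sqrt R"
      by (intro eventually_conj eventually_gt_at_top filterlim_at_top_dense[THEN iffD1, OF sqrt_at_top, rule_format])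
    then show "\<forall>\<^sub>F R in at_top. cmod (I R - V) \<le> 2 * (1 / (R - cmod k) * sqrt R) + exp (- (\<bar>x\<bar> * sqrt R)) / (sqrt R - cmod k) * (2 * R)"
      by eventually_elim (blast intro: main)
    have "((\<lambda>R. 2 * (1 / (R - c) * sqrt R) + exp (- (d * sqrt R)) / (sqrt R - c) * (2 * R)) \<longlongrightarrow> 0) at_top" if "0 < d" for c d :: real
      using that by real_asymp
    then show "((\<lambda>R. 2 * (1 / (R - cmod k) * sqrt R) + exp (- (\<bar>x\<bar> * sqrt R)) / (sqrt R - cmod k) * (2 * R)) \<longlongrightarrow> 0) at_top"
      using x by simp
  qed
  then show ?thesis
    unfolding I_def V_def by (simp only: LIM_zero_cancel)
qed

text \<open>Reflection moves the negative half line with parameters k, x to the positive one with -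
  k, - x. If Re k > 0, the new parameter has negative real part, where the ray c = 1 is
  admissible.\<close>

lemma negative_half_line_integral:
  "integral {-R..0} (\<lambda>\<xi>. iexp (x * \<xi>) / (of_real \<xi> - k)) = - half_line_integral (- k) (- x) R"
proof -
  have "integral {-R..-0} (\<lambda>\<xi>. iexp (x * - (- \<xi>)) / (of_real (- (- \<xi>)) - k))
     = integral {0..R} (\<lambda>\<xi>. iexp (x * - \<xi>) / (of_real (- \<xi>) - k))"
    by (rule Henstock_Kurzweil_Integration.integral_reflect_real)
  also have "\<dots> = integral {0..R} (\<lambda>\<xi>. - (iexp (- x * \<xi>) / (of_real \<xi> - (- k))))"
  proof (rule Henstock_Kurzweil_Integration.integral_cong)
    fix \<xi> :: real
    have "of_real (- \<xi>) - k = - (of_real \<xi> - (- k))" by simp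
    then show "iexp (x * - \<xi>) / (of_real (- \<xi>) - k) = - (iexp (- x * \<xi>) / (of_real \<xi> - (- k)))"
      by (simp only: minus_divide_right mult_minus_left mult_minus_right)
  qed
  finally show ?thesis
    by (simp add: half_line_integral_def)
qed

text \<open>Minus the integral over the negative half line, normalised by 2 pi: on an edge this is
  minus \<open>G_tilde\<close>, and the formula continues it to Re k > 0. Completing the half line
  to the whole line separates the wave from this rest. The value at the origin is a
  convention.\<close>

definition edge_kernel :: "complex \<Rightarrow> real \<Rightarrow> complex"
  where "edge_kernel k x = (if x = 0 then 0 else ray_kernel 1 (- k) (- x) / (2 * of_real pi))"

definition far_kernel :: "complex \<Rightarrow> real \<Rightarrow> complex"
  where "far_kernel k x = (if x = 0 then 0 else ray_kernel (1 + \<i>) k x / (2 * of_real pi))"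

lemma edge_kernel_bound:
  assumes "0 < Re k" shows "cmod (edge_kernel k x) \<le> laplace_nrm (Re k) x"
proof (cases "x = 0")
  case False
  then have "cmod (ray_kernel 1 (- k) (- x)) \<le> 2 * laplace_nrm (Re k) x"
    using ray.ray_kernel_bound[OF ray_one[of "- k" "- x"]] assms by simp
  moreover have "2 * laplace_nrm (Re k) x \<le> laplace_nrm (Re k) x * (2 * pi)"
    using pi_gt3 mult_left_mono[of 1 pi "2 * laplace_nrm (Re k) x"] by simp
  ultimately show ?thesis
    using False by (simp add: edge_kernel_def norm_divide norm_mult pos_divide_le_eq)
qed (simp add: edge_kernel_def)

text \<open>The ray 1 + \<i> produces the constant 2 sqrt 2 / (1/2) = 4 sqrt 2, just below 2 pi, so
  the normalisation leaves the majorant with constant 1.\<close>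

lemma far_kernel_bound:
  assumes "Re k < Im k" shows "cmod (far_kernel k x) \<le> laplace_nrm (Im k - Re k) x"
proof (cases "x = 0")
  case False
  have "cmod (1 + \<i>) \<le> 3 / 2"
  proof -
    have "sqrt 2 \<le> 3 / 2" by (rule real_le_lsqrt) (auto simp: power2_eq_square)
    then show ?thesis by (simp add: cmod_def)
  qed
  then have "2 * cmod (1 + \<i>) / (1 / 2) \<le> 2 * pi"
    using pi_gt3 by simp
  then have "2 * cmod (1 + \<i>) / (1 / 2) * laplace_nrm (Im k - Re k) x \<le> 2 * pi * laplace_nrm (Im k - Re k) x"
    by (rule mult_right_mono) simp
  then have "cmod (ray_kernel (1 + \<i>) k x) \<le> laplace_nrm (Im k - Re k) x * (2 * pi)"
    using ray.ray_kernel_bound[OF ray_one_plus_i[OF assms False]] by (simp only: mult.commute)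
  then show ?thesis
    using False by (simp add: far_kernel_def norm_divide norm_mult pos_divide_le_eq)
qed (simp add: far_kernel_def)

lemma edge_kernel_measurable [measurable]: "edge_kernel k \<in> borel_measurable borel"
  unfolding edge_kernel_def[abs_def] by measurable

lemma far_kernel_measurable [measurable]: "far_kernel k \<in> borel_measurable borel"
  unfolding far_kernel_def[abs_def] by measurable

lemma laplace_dominated_L2:
  assumes \<mu>: "0 < \<mu>" and E: "E \<in> borel_measurable borel" and le: "\<And>x. cmod (E x) \<le> laplace_nrm \<mu> x"
  shows "in_L2 lborel E" and "L2_nrm E \<le> pi / sqrt \<mu>"
proof -
  have le': "norm (E x) \<le> 1 * norm (laplace_nrm \<mu> x)" for x
    using le[of x] by simp
  show "in_L2 lborel E"
    by (rule in_L2_bound[OF laplace_nrm_L2(1)[OF \<mu>] _ le']) (use E in simp)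
  show "L2_nrm E \<le> pi / sqrt \<mu>"
    using L2_nrm_mono[OF laplace_nrm_L2(1)[OF \<mu>] E _ le'] laplace_nrm_L2(2)[OF \<mu>] by simp
qed

lemma G_tilde_eq:
  assumes "0 < l" "x \<noteq> 0" shows "G_tilde l x = - edge_kernel (of_real l) x"
proof -
  interpret ray 1 "- complex_of_real l" 1 l "- x"
    using ray_one[of "- complex_of_real l" "- x"] assms by simp
  have "Lim at_top (\<lambda>R. integral {-R..0} (\<lambda>\<xi>. iexp (x * \<xi>) / (of_real \<xi> - of_real l)))
     = - ray_kernel 1 (- of_real l) (- x)"
    unfolding negative_half_line_integral
    by (rule tendsto_Lim[OF _ tendsto_minus[OF half_line_integral_tendsto]]) simp
  then show ?thesis
    using assms by (simp add: G_tilde_def edge_kernel_def)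
qed

text \<open>The half line is the whole line minus the negative half line: the whole line yields the
  residue at k, the negative part the edge kernel. Symmetric intervals give both pieces the same
  cutoff.\<close>

lemma G_off_edge_tendsto:
  assumes k: "0 < Re k" "0 < Im k" and nz: "x \<noteq> 0"
  shows "(half_line_integral k x \<longlongrightarrow>
    2 * of_real pi * (\<i> * exp (\<i> * k * of_real x) * indicator {0<..} x + edge_kernel k x)) at_top"
proof -
  interpret ray 1 "- k" 1 "Re k" "- x"
    using ray_one[of "- k" "- x"] k nz by simp
  have lim: "((\<lambda>R. integral {-R..R} (\<lambda>\<xi>. iexp (x * \<xi>) / (of_real \<xi> - k)) + half_line_integral (- k) (- x) R)
    \<longlongrightarrow> 2 * of_real pi * \<i> * exp (\<i> * k * of_real x) * indicator {0<..} x + ray_kernel 1 (- k) (- x)) at_top"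
    by (rule tendsto_add[OF line_integral_tendsto[OF k(2) nz] half_line_integral_tendsto])
  have val: "2 * of_real pi * \<i> * exp (\<i> * k * of_real x) * indicator {0<..} x + ray_kernel 1 (- k) (- x)
    = 2 * of_real pi * (\<i> * exp (\<i> * k * of_real x) * indicator {0<..} x + edge_kernel k x)"
    using nz by (simp add: edge_kernel_def algebra_simps)
  have ev: "\<forall>\<^sub>F R in at_top. integral {-R..R} (\<lambda>\<xi>. iexp (x * \<xi>) / (of_real \<xi> - k))
      + half_line_integral (- k) (- x) R = half_line_integral k x R"
    using eventually_ge_at_top[of 0]
  proof eventually_elim
    case (elim R)
    have "complex_of_real \<xi> - k \<noteq> 0" for \<xi>
      using k by (auto simp: complex_eq_iff)
    then have "(\<lambda>\<xi>. iexp (x * \<xi>) / (of_real \<xi> - k)) integrable_on {-R..R}"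
      by (intro integrable_continuous_real continuous_intros) auto
    then have "integral {-R..R} (\<lambda>\<xi>. iexp (x * \<xi>) / (of_real \<xi> - k))
      = integral {-R..0} (\<lambda>\<xi>. iexp (x * \<xi>) / (of_real \<xi> - k))
       + integral {0..R} (\<lambda>\<xi>. iexp (x * \<xi>) / (of_real \<xi> - k))"
      using elim by (intro Henstock_Kurzweil_Integration.integral_combine[symmetric]) auto
    then show ?case
      unfolding negative_half_line_integral half_line_integral_def[of k] by simp
  qed
  show ?thesis
    by (rule Lim_transform_eventually[OF lim[unfolded val] ev])
qed

lemma G_off_far_tendsto:
  assumes "Re k < Im k" "x \<noteq> 0"
  shows "(half_line_integral k x \<longlongrightarrow> 2 * of_real pi * far_kernel k x) at_top"
  using ray.half_line_integral_tendsto[OF ray_one_plus_i[OF assms]] assms(2) by (simp add: far_kernel_def)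

section \<open>The Fourier transform\<close>

definition fourier :: "(real \<Rightarrow> complex) \<Rightarrow> real \<Rightarrow> complex"
  where "fourier a \<xi> = (LINT x|lborel. a x * exp (- (\<i> * of_real (\<xi> * x))))"

lemma fourier_measurable [measurable]:
  assumes [measurable]: "a \<in> borel_measurable borel"
  shows "fourier a \<in> borel_measurable borel"
  unfolding fourier_def[abs_def] by measurable

lemma norm_fourier_le:
  assumes "integrable lborel a"
  shows "cmod (fourier a \<xi>) \<le> (LINT x|lborel. cmod (a x))"
  unfolding fourier_def
  by (rule order_trans[OF integral_norm_bound]) (simp add: norm_mult norm_exp)

lemma fourier_cnj: "fourier (\<lambda>x. cnj (a x)) (- \<xi>) = cnj (fourier a \<xi>)"
  unfolding fourier_def by (simp flip: Bochner_Integration.integral_cnj add: exp_cnj)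

lemma integrable_mult_fourier:
  assumes w: "integrable lborel w" and b: "integrable lborel b"
  shows "integrable lborel (\<lambda>\<xi>. w \<xi> * fourier b (c * \<xi>))"
proof -
  have [measurable]: "w \<in> borel_measurable borel" "b \<in> borel_measurable borel"
    using w b by auto
  have le: "norm (w \<xi> * fourier b (c * \<xi>)) \<le> norm (norm (w \<xi>) * (LINT x|lborel. cmod (b x)))" for \<xi>
    using norm_fourier_le[OF b, of "c * \<xi>"] by (simp add: norm_mult mult_left_mono)
  show ?thesis
    by (rule Bochner_Integration.integrable_bound[OF integrable_mult_left[OF integrable_norm[OF w]] _ AE_I2[OF le]]) measurable
qed

lemma fourier_multiplication:
  assumes a: "integrable lborel a" and w: "integrable lborel w"
  shows "(LINT x|lborel. a x * fourier w x) = (LINT \<xi>|lborel. w \<xi> * fourier a \<xi>)"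
proof -
  have [measurable]: "a \<in> borel_measurable borel" "w \<in> borel_measurable borel"
    using a w by auto
  have "(LINT x|lborel. LINT \<xi>|lborel. a x * w \<xi> * exp (- (\<i> * of_real (x * \<xi>))))
    = (LINT \<xi>|lborel. LINT x|lborel. a x * w \<xi> * exp (- (\<i> * of_real (x * \<xi>))))"
    by (rule Fubini_product_bound[where f="\<lambda>x. norm (a x)" and g="\<lambda>x. norm (w x)"])
      (use a w in \<open>auto simp: norm_mult norm_exp\<close>)
  moreover have "a x * w \<xi> * exp (- (\<i> * of_real (x * \<xi>))) = w \<xi> * (a x * exp (- (\<i> * of_real (\<xi> * x))))" for x \<xi>
    by (simp add: mult_ac)
  ultimately have "(LINT x|lborel. LINT \<xi>|lborel. a x * (w \<xi> * exp (- (\<i> * of_real (x * \<xi>)))))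
    = (LINT \<xi>|lborel. LINT x|lborel. w \<xi> * (a x * exp (- (\<i> * of_real (\<xi> * x)))))"
    by (simp only: mult.assoc)
  then show ?thesis
    unfolding fourier_def by (simp only: integral_mult_right_zero)
qed

text \<open>Convolution with \<open>fourier w\<close> acts on the frequency side as multiplication
  by w, so the form becomes diagonal. It is bilinear, without conjugation, which is why the
  transform of b is taken at - \<xi>.\<close>

lemma fourier_double_integral:
  assumes a: "integrable lborel a" and b: "integrable lborel b" and w: "integrable lborel w"
  shows "(LINT x|lborel. a x * (LINT y|lborel. fourier w (x - y) * b y))
    = (LINT \<xi>|lborel. w \<xi> * fourier b (- \<xi>) * fourier a \<xi>)"
proof -
  have [measurable]: "b \<in> borel_measurable borel" "w \<in> borel_measurable borel"
    using b w by auto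
  have inner: "(LINT y|lborel. fourier w (x - y) * b y) = fourier (\<lambda>\<xi>. w \<xi> * fourier b (- 1 * \<xi>)) x" for x
  proof -
    have "(LINT y|lborel. LINT \<xi>|lborel. b y * w \<xi> * exp (- (\<i> * of_real ((x - y) * \<xi>))))
      = (LINT \<xi>|lborel. LINT y|lborel. b y * w \<xi> * exp (- (\<i> * of_real ((x - y) * \<xi>))))"
      by (rule Fubini_product_bound[where f="\<lambda>x. norm (b x)" and g="\<lambda>x. norm (w x)"])
        (use b w in \<open>auto simp: norm_mult norm_exp\<close>)
    moreover have "(LINT \<xi>|lborel. b y * w \<xi> * exp (- (\<i> * of_real ((x - y) * \<xi>)))) = fourier w (x - y) * b y" for y
    proof -
      have "(LINT \<xi>|lborel. b y * w \<xi> * exp (- (\<i> * of_real ((x - y) * \<xi>))))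
         = (LINT \<xi>|lborel. b y * (w \<xi> * exp (- (\<i> * of_real ((x - y) * \<xi>)))))"
        by (simp only: mult.assoc)
      then show ?thesis
        by (simp only: integral_mult_right_zero fourier_def mult.commute)
    qed
    moreover have "(LINT y|lborel. b y * w \<xi> * exp (- (\<i> * of_real ((x - y) * \<xi>))))
       = w \<xi> * fourier b (- 1 * \<xi>) * exp (- (\<i> * of_real (x * \<xi>)))" for \<xi>
    proof -
      have "b y * w \<xi> * exp (- (\<i> * of_real ((x - y) * \<xi>)))
         = (w \<xi> * exp (- (\<i> * of_real (x * \<xi>)))) * (b y * exp (- (\<i> * of_real (- 1 * \<xi> * y))))" for y
      proof -
        have "exp (- (\<i> * of_real ((x - y) * \<xi>))) = exp (- (\<i> * of_real (x * \<xi>))) * exp (- (\<i> * of_real (- 1 * \<xi> * y)))"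
          unfolding exp_add[symmetric] by (simp add: algebra_simps)
        then show ?thesis by (simp only: mult_ac)
      qed
      then show ?thesis
        unfolding fourier_def[of b] by (simp only: integral_mult_right_zero) (simp only: mult_ac)
    qed
    ultimately show ?thesis
      unfolding fourier_def[of "\<lambda>\<xi>. w \<xi> * fourier b (- 1 * \<xi>)"] by (simp only:)
  qed
  have "(LINT x|lborel. a x * fourier (\<lambda>\<xi>. w \<xi> * fourier b (- 1 * \<xi>)) x)
     = (LINT \<xi>|lborel. w \<xi> * fourier b (- 1 * \<xi>) * fourier a \<xi>)"
    by (rule fourier_multiplication[OF a integrable_mult_fourier[OF w b]])
  then show ?thesis
    unfolding inner by simp
qed

lemma fourier_gaussian:
  assumes e: "0 < e"
  shows "integrable lborel (\<lambda>\<xi>. complex_of_real (std_normal_density (e * \<xi>)))"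
    and "fourier (\<lambda>\<xi>. of_real (std_normal_density (e * \<xi>))) t = of_real (sqrt (2 * pi) / e * std_normal_density (t / e))"
proof -
  have "integrable lborel (std_normal_density :: real \<Rightarrow> real)"
    by simp
  from lborel_integrable_real_affine[OF this, of e 0]
  have "integrable lborel (\<lambda>\<xi>. std_normal_density (e * \<xi>))"
    using e by simp
  then show "integrable lborel (\<lambda>\<xi>. complex_of_real (std_normal_density (e * \<xi>)))"
    by (rule integrable_of_real)
  have "complex_of_real (exp (- ((- t / e)\<^sup>2) / 2)) = char std_normal_distribution (- t / e)"
    by (simp only: char_std_normal_distribution)
  also have "\<dots> = (LINT x|lborel. of_real (std_normal_density x) * iexp (- t / e * x))"
    unfolding char_def by (subst integral_density) (auto simp: scaleR_conv_of_real)
  also have "\<dots> = \<bar>e\<bar> *\<^sub>R (LINT x|lborel. of_real (std_normal_density (0 + e * x)) * iexp (- t / e * (0 + e * x)))"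
    using e by (intro lborel_integral_real_affine) auto
  also have "(LINT x|lborel. of_real (std_normal_density (0 + e * x)) * iexp (- t / e * (0 + e * x)))
    = fourier (\<lambda>\<xi>. of_real (std_normal_density (e * \<xi>))) t"
    unfolding fourier_def using e by (intro Bochner_Integration.integral_cong) (auto simp: field_simps)
  finally have "complex_of_real (exp (- ((- t / e)\<^sup>2) / 2)) = of_real e * fourier (\<lambda>\<xi>. of_real (std_normal_density (e * \<xi>))) t"
    using e by (simp add: scaleR_conv_of_real)
  moreover have "exp (- ((- t / e)\<^sup>2) / 2) = sqrt (2 * pi) * std_normal_density (t / e)"
    by (simp add: std_normal_density_def)
  ultimately have "of_real e * fourier (\<lambda>\<xi>. of_real (std_normal_density (e * \<xi>))) t = complex_of_real (sqrt (2 * pi) * std_normal_density (t / e))"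
    by simp
  then have "fourier (\<lambda>\<xi>. of_real (std_normal_density (e * \<xi>))) t = complex_of_real (sqrt (2 * pi) * std_normal_density (t / e)) / of_real e"
    using e by (simp add: field_simps)
  then show "fourier (\<lambda>\<xi>. of_real (std_normal_density (e * \<xi>))) t = of_real (sqrt (2 * pi) / e * std_normal_density (t / e))"
    by simp
qed

text \<open>A Bochner integral that does not exist is 0, so the estimate holds for all measurable
  functions, with a right side that may be infinite.\<close>

lemma norm_double_integral_le:
  fixes a b g :: "real \<Rightarrow> complex"
  assumes [measurable]: "a \<in> borel_measurable borel" "b \<in> borel_measurable borel" "g \<in> borel_measurable borel"
  shows "ennreal (cmod (LINT x|lborel. a x * (LINT y|lborel. g (x - y) * b y)))
    \<le> (\<integral>\<^sup>+x. \<integral>\<^sup>+y. ennreal (cmod (a x) * (cmod (g (x - y)) * cmod (b y))) \<partial>lborel \<partial>lborel)"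
proof -
  have bound: "ennreal (cmod (LINT x|lborel. f x)) \<le> (\<integral>\<^sup>+x. ennreal (cmod (f x)) \<partial>lborel)" for f :: "real \<Rightarrow> complex"
    using integral_norm_bound_ennreal[of lborel f] not_integrable_integral_eq[of lborel f]
    by (cases "integrable lborel f") auto
  have "ennreal (cmod (LINT x|lborel. a x * (LINT y|lborel. g (x - y) * b y)))
     \<le> (\<integral>\<^sup>+x. ennreal (cmod (a x * (LINT y|lborel. g (x - y) * b y))) \<partial>lborel)"
    by (rule bound)
  also have "\<dots> \<le> (\<integral>\<^sup>+x. ennreal (cmod (a x)) * (\<integral>\<^sup>+y. ennreal (cmod (g (x - y) * b y)) \<partial>lborel) \<partial>lborel)"
  proof (rule nn_integral_mono)
    fix x :: real
    show "ennreal (cmod (a x * (LINT y|lborel. g (x - y) * b y)))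
      \<le> ennreal (cmod (a x)) * (\<integral>\<^sup>+y. ennreal (cmod (g (x - y) * b y)) \<partial>lborel)"
      using mult_left_mono[OF bound[of "\<lambda>y. g (x - y) * b y"], of "ennreal (cmod (a x))"]
      by (simp add: norm_mult[of "a x"] ennreal_mult')
  qed
  also have "\<dots> = (\<integral>\<^sup>+x. \<integral>\<^sup>+y. ennreal (cmod (a x)) * ennreal (cmod (g (x - y) * b y)) \<partial>lborel \<partial>lborel)"
    by (intro nn_integral_cong nn_integral_cmult[symmetric]) measurable
  finally show ?thesis
    by (simp add: norm_mult ennreal_mult')
qed

text \<open>Gaussian regularisation: weighting |fourier a|^2 by the normal density at e \<xi>
  amounts to pairing a with its conjugate through a positive convolution kernel of mass sqrt (2 pi),
  whatever e is. As e decreases to 0 the weight increases to 1 / sqrt (2 pi), and the two factors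
  combine to 2 pi.\<close>

theorem Plancherel_bound:
  assumes a: "integrable lborel a" and a2: "in_L2 lborel a"
  shows "in_L2 lborel (fourier a)" and "L2_nrm (fourier a) \<le> sqrt (2 * pi) * L2_nrm a"
proof -
  have [measurable]: "a \<in> borel_measurable borel"
    using a by auto
  define A where "A = (\<integral>\<^sup>+x. ennreal ((cmod (a x))\<^sup>2) \<partial>lborel)"
  have A: "A = ennreal ((L2_nrm a)\<^sup>2)"
    unfolding A_def L2_nrm_power2 using a2 by (subst nn_integral_eq_integral) (auto simp: in_L2_def)
  have gauss: "(\<integral>\<^sup>+\<xi>. ennreal (std_normal_density (e * \<xi>) * (cmod (fourier a \<xi>))\<^sup>2) \<partial>lborel) \<le> ennreal (sqrt (2 * pi)) * A"
    if e: "0 < e" for e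
  proof -
    define w where "w \<xi> = complex_of_real (std_normal_density (e * \<xi>))" for \<xi>
    define g where "g t = sqrt (2 * pi) / e * std_normal_density (t / e)" for t
    have w: "integrable lborel w" and fw: "fourier w t = of_real (g t)" for t
      using fourier_gaussian[OF e] unfolding w_def[abs_def] g_def by auto
    have g0: "0 \<le> g t" for t
      using e unfolding g_def by simp
    have gm [measurable]: "g \<in> borel_measurable borel"
      unfolding g_def[abs_def] by measurable
    have mass: "(\<integral>\<^sup>+t. ennreal (g t) \<partial>lborel) = ennreal (sqrt (2 * pi))"
    proof -
      have "(\<integral>\<^sup>+t. ennreal (g t) \<partial>lborel) = \<bar>e\<bar> * (\<integral>\<^sup>+t. ennreal (g (0 + e * t)) \<partial>lborel)"
        using e by (intro nn_integral_real_affine) auto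
      also have "(\<integral>\<^sup>+t. ennreal (g (0 + e * t)) \<partial>lborel) = (\<integral>\<^sup>+t. ennreal (sqrt (2 * pi) / e) * ennreal (std_normal_density t) \<partial>lborel)"
        using e by (intro nn_integral_cong) (simp add: g_def ennreal_mult'[symmetric])
      also have "\<dots> = ennreal (sqrt (2 * pi) / e) * (\<integral>\<^sup>+t. ennreal (std_normal_density t) \<partial>lborel)"
        by (rule nn_integral_cmult) measurable
      also have "(\<integral>\<^sup>+t. ennreal (std_normal_density t) \<partial>lborel) = 1"
        by (subst nn_integral_eq_integral) auto
      finally show ?thesis
        using e by (simp add: ennreal_mult'[symmetric])
    qed
    have mass1: "(\<integral>\<^sup>+y. ennreal (g (x - y)) \<partial>lborel) = ennreal (sqrt (2 * pi))" for x
      using nn_integral_real_affine[of "\<lambda>t. ennreal (g t)" "-1" x] mass by simp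
    have mass2: "(\<integral>\<^sup>+x. ennreal (g (x - y)) \<partial>lborel) = ennreal (sqrt (2 * pi))" for y
      using nn_integral_real_affine[of "\<lambda>t. ennreal (g t)" 1 "-y"] mass by (simp add: add.commute)
    note ca = fourier_double_integral[OF a _ w, of "\<lambda>x. cnj (a x)"]
    have sq: "w \<xi> * fourier (\<lambda>x. cnj (a x)) (- \<xi>) * fourier a \<xi> = of_real (std_normal_density (e * \<xi>) * (cmod (fourier a \<xi>))\<^sup>2)" for \<xi>
      unfolding fourier_cnj w_def by (simp only: of_real_mult complex_norm_square mult_ac)
    have int: "integrable lborel (\<lambda>\<xi>. std_normal_density (e * \<xi>) * (cmod (fourier a \<xi>))\<^sup>2)"
    proof -
      have le: "norm (std_normal_density (e * \<xi>) * (cmod (fourier a \<xi>))\<^sup>2) \<le> norm (norm (w \<xi>) * (LINT x|lborel. cmod (a x))\<^sup>2)" for \<xi>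
        using power_mono[OF norm_fourier_le[OF a, of \<xi>], of 2] by (simp add: w_def abs_mult mult_left_mono)
      show ?thesis
        by (rule Bochner_Integration.integrable_bound[OF integrable_mult_left[OF integrable_norm[OF w]] _ AE_I2[OF le]]) measurable
    qed
    have "(\<integral>\<^sup>+\<xi>. ennreal (std_normal_density (e * \<xi>) * (cmod (fourier a \<xi>))\<^sup>2) \<partial>lborel)
      = ennreal (LINT \<xi>|lborel. std_normal_density (e * \<xi>) * (cmod (fourier a \<xi>))\<^sup>2)"
      by (rule nn_integral_eq_integral[OF int]) simp
    also have "\<dots> = ennreal (cmod (LINT x|lborel. a x * (LINT y|lborel. fourier w (x - y) * cnj (a y))))"
    proof -
      have "(LINT x|lborel. a x * (LINT y|lborel. fourier w (x - y) * cnj (a y)))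
        = of_real (LINT \<xi>|lborel. std_normal_density (e * \<xi>) * (cmod (fourier a \<xi>))\<^sup>2)"
        using ca a by (simp only: sq integral_complex_of_real complex_integrable_cnj)
      then show ?thesis
        by (simp add: Bochner_Integration.integral_nonneg)
    qed
    also have "\<dots> \<le> (\<integral>\<^sup>+x. \<integral>\<^sup>+y. ennreal (cmod (a x) * (cmod (of_real (g (x - y))) * cmod (cnj (a y)))) \<partial>lborel \<partial>lborel)"
    proof -
      have "(\<lambda>t. complex_of_real (g t)) \<in> borel_measurable borel"
        by (rule measurable_compose[OF gm borel_measurable_continuous_onI]) (intro continuous_intros)
      moreover have "(\<lambda>t. cnj (a t)) \<in> borel_measurable borel"
        by (rule measurable_compose[where f=a and g=cnj and N=borel])
          (measurable, intro borel_measurable_continuous_onI continuous_intros)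
      ultimately show ?thesis
        unfolding fw by (intro norm_double_integral_le) auto
    qed
    \<comment> \<open>The arithmetic-geometric mean inequality separates |a x| and |a y|; each
      square then sees the full mass of g in the other variable.\<close>
    also have "\<dots> \<le> (\<integral>\<^sup>+x. \<integral>\<^sup>+y. (ennreal ((cmod (a x))\<^sup>2 / 2) * ennreal (g (x - y)) + ennreal ((cmod (a y))\<^sup>2 / 2) * ennreal (g (x - y))) \<partial>lborel \<partial>lborel)"
    proof (intro nn_integral_mono)
      fix x y :: real
      have "cmod (a x) * cmod (a y) \<le> (cmod (a x))\<^sup>2 / 2 + (cmod (a y))\<^sup>2 / 2"
        using sum_squares_bound[of "cmod (a x)" "cmod (a y)"] by simp
      from mult_right_mono[OF this g0[of "x - y"]]
      have "cmod (a x) * (cmod (of_real (g (x - y))) * cmod (cnj (a y))) \<le> (cmod (a x))\<^sup>2 / 2 * g (x - y) + (cmod (a y))\<^sup>2 / 2 * g (x - y)"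
        using g0[of "x - y"] by (simp add: algebra_simps)
      then have "ennreal (cmod (a x) * (cmod (of_real (g (x - y))) * cmod (cnj (a y)))) \<le> ennreal ((cmod (a x))\<^sup>2 / 2 * g (x - y) + (cmod (a y))\<^sup>2 / 2 * g (x - y))"
        by (rule ennreal_leI)
      also have "\<dots> = ennreal ((cmod (a x))\<^sup>2 / 2) * ennreal (g (x - y)) + ennreal ((cmod (a y))\<^sup>2 / 2) * ennreal (g (x - y))"
        using g0[of "x - y"]
        by (simp only: ennreal_plus ennreal_mult[OF _ g0] zero_le_power2 mult_nonneg_nonneg divide_nonneg_nonneg zero_le_numeral)
      finally show "ennreal (cmod (a x) * (cmod (of_real (g (x - y))) * cmod (cnj (a y)))) \<le>
        ennreal ((cmod (a x))\<^sup>2 / 2) * ennreal (g (x - y)) + ennreal ((cmod (a y))\<^sup>2 / 2) * ennreal (g (x - y))" .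
    qed
    also have "\<dots> = (\<integral>\<^sup>+x. \<integral>\<^sup>+y. ennreal ((cmod (a x))\<^sup>2 / 2) * ennreal (g (x - y)) \<partial>lborel \<partial>lborel)
       + (\<integral>\<^sup>+x. \<integral>\<^sup>+y. ennreal ((cmod (a y))\<^sup>2 / 2) * ennreal (g (x - y)) \<partial>lborel \<partial>lborel)"
      by (subst nn_integral_add[symmetric]) (auto intro!: nn_integral_cong nn_integral_add)
    also have "(\<integral>\<^sup>+x. \<integral>\<^sup>+y. ennreal ((cmod (a y))\<^sup>2 / 2) * ennreal (g (x - y)) \<partial>lborel \<partial>lborel)
       = (\<integral>\<^sup>+y. \<integral>\<^sup>+x. ennreal ((cmod (a y))\<^sup>2 / 2) * ennreal (g (x - y)) \<partial>lborel \<partial>lborel)"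
      by (rule lborel_pair.Fubini') measurable
    also have "\<dots> = (\<integral>\<^sup>+y. ennreal ((cmod (a y))\<^sup>2 / 2) * ennreal (sqrt (2 * pi)) \<partial>lborel)"
      by (intro nn_integral_cong) (simp add: nn_integral_cmult mass2)
    also have "(\<integral>\<^sup>+x. \<integral>\<^sup>+y. ennreal ((cmod (a x))\<^sup>2 / 2) * ennreal (g (x - y)) \<partial>lborel \<partial>lborel)
       = (\<integral>\<^sup>+y. ennreal ((cmod (a y))\<^sup>2 / 2) * ennreal (sqrt (2 * pi)) \<partial>lborel)"
      by (intro nn_integral_cong) (simp add: nn_integral_cmult mass1)
    also have "(\<integral>\<^sup>+y. ennreal ((cmod (a y))\<^sup>2 / 2) * ennreal (sqrt (2 * pi)) \<partial>lborel)
      + (\<integral>\<^sup>+y. ennreal ((cmod (a y))\<^sup>2 / 2) * ennreal (sqrt (2 * pi)) \<partial>lborel) = ennreal (sqrt (2 * pi)) * A"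
    proof -
      have "ennreal ((cmod (a y))\<^sup>2 / 2) * ennreal (sqrt (2 * pi)) + ennreal ((cmod (a y))\<^sup>2 / 2) * ennreal (sqrt (2 * pi))
         = ennreal (sqrt (2 * pi)) * ennreal ((cmod (a y))\<^sup>2)" for y
        by (simp add: ennreal_mult[symmetric] ennreal_plus[symmetric] del: ennreal_plus)
      then show ?thesis
        unfolding A_def by (subst nn_integral_add[symmetric]) (auto simp: nn_integral_cmult)
    qed
    finally show ?thesis .
  qed
  have "(\<integral>\<^sup>+\<xi>. ennreal (std_normal_density 0 * (cmod (fourier a \<xi>))\<^sup>2) \<partial>lborel) \<le> ennreal (sqrt (2 * pi)) * A"
  proof (rule LIMSEQ_le_const2)
    show "(\<lambda>n. \<integral>\<^sup>+\<xi>. ennreal (std_normal_density (1 / real (Suc n) * \<xi>) * (cmod (fourier a \<xi>))\<^sup>2) \<partial>lborel)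
      \<longlonglongrightarrow> (\<integral>\<^sup>+\<xi>. ennreal (std_normal_density 0 * (cmod (fourier a \<xi>))\<^sup>2) \<partial>lborel)"
    proof (rule nn_integral_LIMSEQ)
      show "incseq (\<lambda>n \<xi>. ennreal (std_normal_density (1 / real (Suc n) * \<xi>) * (cmod (fourier a \<xi>))\<^sup>2))"
      proof (intro incseq_SucI le_funI ennreal_leI mult_right_mono)
        fix n and \<xi> :: real
        have "(1 / real (Suc (Suc n)))\<^sup>2 \<le> (1 / real (Suc n))\<^sup>2"
          by (intro power_mono) (auto simp: field_simps)
        then have "(1 / real (Suc (Suc n)) * \<xi>)\<^sup>2 \<le> (1 / real (Suc n) * \<xi>)\<^sup>2"
          unfolding power_mult_distrib by (rule mult_right_mono) simp
        then show "std_normal_density (1 / real (Suc n) * \<xi>) \<le> std_normal_density (1 / real (Suc (Suc n)) * \<xi>)"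
          unfolding std_normal_density_def by (intro mult_left_mono) auto
      qed simp
      fix \<xi> :: real
      have "(\<lambda>n. 1 / real (Suc n) * \<xi>) \<longlonglongrightarrow> 0 * \<xi>"
        by (intro tendsto_intros LIMSEQ_Suc[OF lim_1_over_n])
      moreover have "isCont std_normal_density 0"
        unfolding std_normal_density_def by (intro continuous_intros) auto
      ultimately have "(\<lambda>n. std_normal_density (1 / real (Suc n) * \<xi>)) \<longlonglongrightarrow> std_normal_density 0"
        using isCont_tendsto_compose by fastforce
      then show "(\<lambda>n. ennreal (std_normal_density (1 / real (Suc n) * \<xi>) * (cmod (fourier a \<xi>))\<^sup>2)) \<longlonglongrightarrow> ennreal (std_normal_density 0 * (cmod (fourier a \<xi>))\<^sup>2)"
        by (intro tendsto_ennrealI tendsto_mult[OF _ tendsto_const])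
    qed measurable
    show "\<exists>N. \<forall>n\<ge>N. (\<integral>\<^sup>+\<xi>. ennreal (std_normal_density (1 / real (Suc n) * \<xi>) * (cmod (fourier a \<xi>))\<^sup>2) \<partial>lborel) \<le> ennreal (sqrt (2 * pi)) * A"
      by (intro exI[of _ 0] allI impI gauss) simp
  qed
  also have "(\<integral>\<^sup>+\<xi>. ennreal (std_normal_density 0 * (cmod (fourier a \<xi>))\<^sup>2) \<partial>lborel)
     = ennreal (1 / sqrt (2 * pi)) * (\<integral>\<^sup>+\<xi>. ennreal ((cmod (fourier a \<xi>))\<^sup>2) \<partial>lborel)"
    by (subst nn_integral_cmult[symmetric]) (auto simp: std_normal_density_def ennreal_mult'[symmetric])
  finally have "ennreal (sqrt (2 * pi)) * (ennreal (1 / sqrt (2 * pi)) * (\<integral>\<^sup>+\<xi>. ennreal ((cmod (fourier a \<xi>))\<^sup>2) \<partial>lborel))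
     \<le> ennreal (sqrt (2 * pi)) * (ennreal (sqrt (2 * pi)) * A)"
    by (rule mult_left_mono) simp
  then have le: "(\<integral>\<^sup>+\<xi>. ennreal ((cmod (fourier a \<xi>))\<^sup>2) \<partial>lborel) \<le> ennreal (2 * pi * (L2_nrm a)\<^sup>2)"
    unfolding A mult.assoc[symmetric] by (simp add: ennreal_mult'[symmetric])
  have int: "integrable lborel (\<lambda>\<xi>. (cmod (fourier a \<xi>))\<^sup>2)"
    by (rule integrableI_bounded) (use le in \<open>auto simp: order.strict_trans1\<close>)
  then show "in_L2 lborel (fourier a)"
    by (simp add: in_L2_def)
  have "ennreal (LINT \<xi>|lborel. (cmod (fourier a \<xi>))\<^sup>2) \<le> ennreal (2 * pi * (L2_nrm a)\<^sup>2)"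
    using le by (subst (asm) nn_integral_eq_integral[OF int]) auto
  then have "(LINT \<xi>|lborel. (cmod (fourier a \<xi>))\<^sup>2) \<le> 2 * pi * (L2_nrm a)\<^sup>2"
    by (subst (asm) ennreal_le_iff) auto
  then have "sqrt (LINT \<xi>|lborel. (cmod (fourier a \<xi>))\<^sup>2) \<le> sqrt (2 * pi * (L2_nrm a)\<^sup>2)"
    by simp
  also have "\<dots> = sqrt (2 * pi) * L2_nrm a"
    by (simp only: real_sqrt_mult real_sqrt_abs abs_of_nonneg L2_nrm_nonneg)
  finally show "L2_nrm (fourier a) \<le> sqrt (2 * pi) * L2_nrm a"
    by (simp add: L2_nrm_def)
qed

text \<open>A bound with absolute values inside would lose a logarithm: the gain \<open>1 / l\<close> is the supremum of
  the Fourier multiplier of the kernel.\<close>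

lemma edge_kernel_bilinear:
  assumes l: "0 < l" and a: "integrable lborel a" "in_L2 lborel a" and b: "integrable lborel b" "in_L2 lborel b"
  shows "cmod (LINT x|lborel. a x * (LINT y|lborel. edge_kernel (of_real l) (x - y) * b y)) \<le> L2_nrm a * L2_nrm b / l"
proof -
  have [measurable]: "a \<in> borel_measurable borel" "b \<in> borel_measurable borel"
    using a b by auto
  \<comment> \<open>The multiplier of the edge kernel is 1 / (2 pi (\<xi> + l)) on the positive half
    axis, with supremum 1 / (2 pi l). The cutoff at n makes it integrable.\<close>
  define w where "w n \<xi> = indicator {0..real n} \<xi> *\<^sub>R (1 / (2 * of_real pi) / complex_of_real (\<xi> + l))" for n \<xi>
  have wi: "integrable lborel (w n)" for n
    unfolding w_def[abs_def] using l
    by (intro borel_integrable_compact continuous_intros) (auto simp: complex_eq_iff)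
  then have [measurable]: "w n \<in> borel_measurable borel" for n
    by auto
  have wb: "cmod (w n \<xi>) \<le> 1 / (2 * pi * l)" for n \<xi>
  proof (cases "\<xi> \<in> {0..real n}")
    case True
    have "cmod (w n \<xi>) = 1 / (2 * pi * (\<xi> + l))"
      using True l by (simp add: w_def norm_divide norm_mult flip: of_real_add)
    also have "\<dots> \<le> 1 / (2 * pi * l)"
      using True l by (intro divide_left_mono mult_left_mono mult_pos_pos) auto
    finally show ?thesis .
  qed (use l in \<open>simp add: w_def\<close>)
  have fw: "fourier (w n) t = half_line_integral (- of_real l) (- t) (real n) / (2 * of_real pi)" for n t
  proof -
    have "set_integrable lborel {0..real n} (\<lambda>\<xi>. iexp (- t * \<xi>) / (of_real \<xi> - (- of_real l)))"
      unfolding set_integrable_def using l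
      by (intro borel_integrable_compact continuous_intros) (auto simp: complex_eq_iff)
    then have "half_line_integral (- of_real l) (- t) (real n)
       = (LINT \<xi>:{0..real n}|lborel. iexp (- t * \<xi>) / (of_real \<xi> - (- of_real l)))"
      unfolding half_line_integral_def by (rule set_borel_integral_eq_integral(2)[symmetric])
    also have "\<dots> / (2 * of_real pi) = (LINT \<xi>|lborel. indicator {0..real n} \<xi> *\<^sub>R (iexp (- t * \<xi>) / (of_real \<xi> - (- of_real l))) / (2 * of_real pi))"
      unfolding set_lebesgue_integral_def by (rule integral_divide_zero[symmetric])
    also have "\<dots> = fourier (w n) t"
      unfolding fourier_def w_def by (intro Bochner_Integration.integral_cong) (auto simp: indicator_def)
    finally show ?thesis ..
  qed
  have fb: "cmod (fourier (w n) t) \<le> laplace_nrm l t" and lim: "(\<lambda>n. fourier (w n) t) \<longlonglongrightarrow> edge_kernel (of_real l) t"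
    if t: "t \<noteq> 0" for n t
  proof -
    interpret ray 1 "- complex_of_real l" 1 l "- t"
      using ray_one[of "- complex_of_real l" "- t"] l t by simp
    have "cmod (fourier (w n) t) = cmod (half_line_integral (- of_real l) (- t) (real n)) / (2 * pi)"
      by (simp add: fw norm_divide norm_mult)
    also have "\<dots> \<le> 2 * laplace_nrm l t / (2 * pi)"
      using half_line_integral_bound[of "real n"] by (intro divide_right_mono) auto
    also have "\<dots> \<le> laplace_nrm l t"
      using pi_gt3 mult_left_mono[of 1 pi "2 * laplace_nrm l t"] by (simp add: pos_divide_le_eq mult.commute)
    finally show "cmod (fourier (w n) t) \<le> laplace_nrm l t" .
    have "(\<lambda>n. half_line_integral (- of_real l) (- t) (real n) / (2 * of_real pi)) \<longlonglongrightarrow> ray_kernel 1 (- of_real l) (- t) / (2 * of_real pi)"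
      by (intro tendsto_divide tendsto_const filterlim_compose[OF half_line_integral_tendsto filterlim_real_sequentially]) simp
    then show "(\<lambda>n. fourier (w n) t) \<longlonglongrightarrow> edge_kernel (of_real l) t"
      using t by (simp add: fw edge_kernel_def)
  qed
  have bn: "in_L2 lborel (\<lambda>y. cmod (b y))"
    using b(2) by (simp add: in_L2_def)
  note conv = integral_convolution_bound[OF laplace_nrm_L2(1)[OF l] bn]
  have ae: "AE y in lborel. x - y \<noteq> 0" for x :: real
    using AE_lborel_singleton[of x] by eventually_elim simp
  have dom: "AE y in lborel. norm (fourier (w n) (x - y) * b y) \<le> laplace_nrm l (x - y) * cmod (b y)" for n x
    using ae[of x] by eventually_elim (simp add: norm_mult mult_right_mono fb)
  have inner: "(\<lambda>n. LINT y|lborel. fourier (w n) (x - y) * b y) \<longlonglongrightarrow> (LINT y|lborel. edge_kernel (of_real l) (x - y) * b y)" for x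
  proof (rule integral_dominated_convergence[OF _ _ conv(1)[of x]])
    show "AE y in lborel. (\<lambda>n. fourier (w n) (x - y) * b y) \<longlonglongrightarrow> edge_kernel (of_real l) (x - y) * b y"
      using ae[of x] by eventually_elim (intro tendsto_mult tendsto_const lim)
  qed (use dom in auto)
  have ib: "cmod (LINT y|lborel. fourier (w n) (x - y) * b y) \<le> L2_nrm (laplace_nrm l) * L2_nrm (\<lambda>y. cmod (b y))" for n x
  proof -
    have int: "integrable lborel (\<lambda>y. fourier (w n) (x - y) * b y)"
      by (rule Bochner_Integration.integrable_bound[OF conv(1)[of x]]) (use dom[of n x] in \<open>auto elim!: eventually_mono\<close>)
    have "cmod (LINT y|lborel. fourier (w n) (x - y) * b y) \<le> (LINT y|lborel. laplace_nrm l (x - y) * cmod (b y))"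
      by (rule order_trans[OF integral_norm_bound integral_mono_AE[OF integrable_norm[OF int] conv(1) dom]])
    then show ?thesis
      using conv(2)[of x] by (simp add: abs_le_iff)
  qed
  have outer: "(\<lambda>n. LINT x|lborel. a x * (LINT y|lborel. fourier (w n) (x - y) * b y))
     \<longlonglongrightarrow> (LINT x|lborel. a x * (LINT y|lborel. edge_kernel (of_real l) (x - y) * b y))"
  proof (rule integral_dominated_convergence)
    show "integrable lborel (\<lambda>x. cmod (a x) * (L2_nrm (laplace_nrm l) * L2_nrm (\<lambda>y. cmod (b y))))"
      using a(1) by (intro integrable_mult_left integrable_norm)
    show "AE x in lborel. (\<lambda>n. a x * (LINT y|lborel. fourier (w n) (x - y) * b y))
      \<longlonglongrightarrow> a x * (LINT y|lborel. edge_kernel (of_real l) (x - y) * b y)"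
      by (intro AE_I2 tendsto_mult tendsto_const inner)
    show "AE x in lborel. norm (a x * (LINT y|lborel. fourier (w n) (x - y) * b y)) \<le> cmod (a x) * (L2_nrm (laplace_nrm l) * L2_nrm (\<lambda>y. cmod (b y)))" for n
      unfolding norm_mult by (intro AE_I2 mult_left_mono ib) simp
  qed measurable
  have "cmod (LINT x|lborel. a x * (LINT y|lborel. fourier (w n) (x - y) * b y)) \<le> L2_nrm a * L2_nrm b / l" for n
  proof -
    note Pa = Plancherel_bound[OF a] and Pb = Plancherel_bound[OF b]
    have Pb1: "in_L2 lborel (\<lambda>\<xi>. fourier b (0 - \<xi>))"
      by (rule in_L2_reflect[OF Pb(1)])
    have int: "integrable lborel (\<lambda>\<xi>. norm (fourier b (0 - \<xi>)) * norm (fourier a \<xi>))"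
      by (rule in_L2_mult_integrable[OF Pb1 Pa(1)])
    have le: "norm (w n \<xi> * fourier b (- \<xi>) * fourier a \<xi>) \<le> 1 / (2 * pi * l) * (norm (fourier b (0 - \<xi>)) * norm (fourier a \<xi>))" for \<xi>
      using mult_right_mono[OF wb[of n \<xi>], of "norm (fourier b (- \<xi>)) * norm (fourier a \<xi>)"] by (simp add: norm_mult)
    have le': "norm (w n \<xi> * fourier b (- \<xi>) * fourier a \<xi>) \<le> norm (1 / (2 * pi * l) * (norm (fourier b (0 - \<xi>)) * norm (fourier a \<xi>)))" for \<xi>
      using le[of \<xi>] l by simp
    have int2: "integrable lborel (\<lambda>\<xi>. w n \<xi> * fourier b (- \<xi>) * fourier a \<xi>)"
      by (rule Bochner_Integration.integrable_bound[OF integrable_mult_right[OF int] _ AE_I2[OF le']]) measurable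
    have "cmod (LINT x|lborel. a x * (LINT y|lborel. fourier (w n) (x - y) * b y))
       \<le> (LINT \<xi>|lborel. 1 / (2 * pi * l) * (norm (fourier b (0 - \<xi>)) * norm (fourier a \<xi>)))"
      unfolding fourier_double_integral[OF a(1) b(1) wi]
      by (rule order_trans[OF integral_norm_bound integral_mono[OF integrable_norm[OF int2] integrable_mult_right[OF int] le]])
    also have "\<dots> = 1 / (2 * pi * l) * (LINT \<xi>|lborel. norm (fourier b (0 - \<xi>)) * norm (fourier a \<xi>))"
      by (rule integral_mult_right_zero)
    \<comment> \<open>Each Plancherel bound contributes sqrt (2 pi); together they cancel the 2 pi
      in the supremum of the multiplier.\<close>
    also have "\<dots> \<le> 1 / (2 * pi * l) * ((sqrt (2 * pi) * L2_nrm b) * (sqrt (2 * pi) * L2_nrm a))"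
      using l Pa(2) Pb(2) L2_Cauchy_Schwarz[OF Pb1 Pa(1)]
      by (intro mult_left_mono order_trans[OF L2_Cauchy_Schwarz[OF Pb1 Pa(1)] mult_mono]) (auto simp: L2_nrm_reflect[of _ 0, simplified])
    also have "\<dots> = (sqrt (2 * pi) * sqrt (2 * pi)) / (2 * pi) * (L2_nrm a * L2_nrm b / l)"
      by (simp only: times_divide_eq_left times_divide_eq_right mult_ac mult_1_left divide_divide_eq_left)
    finally show ?thesis
      by simp
  qed
  then show ?thesis
    by (intro tendsto_upperbound[OF tendsto_norm[OF outer]]) auto
qed

section \<open>Asymptotics of the solutions and the coefficients\<close>

definition plane_wave :: "real \<Rightarrow> real \<Rightarrow> complex"
  where "plane_wave l x = iexp (l * x)"

lemma plane_wave_measurable [measurable]: "plane_wave l \<in> borel_measurable borel"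
  unfolding plane_wave_def[abs_def] by measurable

lemma norm_plane_wave [simp]: "cmod (plane_wave l x) = 1"
  by (simp add: plane_wave_def norm_exp)

context potential
begin

text \<open>Two independent thresholds: \<open>d\<close> makes the rest term small, and
  \<open>B\<close> makes the oscillatory integral of \<open>v\<close> small by Riemann-Lebesgue.
  Both depend on the potential and e alone, so they serve all admissible k, E and m at once.\<close>

lemma jost_1_uniform_limit:
  assumes e: "0 < e"
  shows "\<exists>d>0. \<exists>B. \<forall>k E m. 0 \<le> Im k \<longrightarrow> B \<le> cmod k \<longrightarrow> in_L2 lborel E \<longrightarrow> L2_nrm E \<le> d \<longrightarrow>
    jost_eq k E (\<lambda>_. 1) m \<longrightarrow> (\<forall>x. cmod (m x - 1) \<le> e)"
proof -
  define a where "a = L2_nrm u * (1 + u_L1nrm)"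
  define C where "C = 2 * (1 + u_L1nrm)\<^sup>2 * L2_nrm u"
  have a0: "0 \<le> a" and C0: "0 \<le> C"
    unfolding a_def C_def by (auto intro!: mult_nonneg_nonneg add_nonneg_nonneg)
  \<comment> \<open>The first entry secures the smallness hypothesis of the a priori bound, the
    second an error of at most e / 2. Adding 1 to \<open>a\<close> and \<open>C\<close> guards
    against division by 0 when u vanishes.\<close>
  define d where "d = min (1 / (2 * (a + 1))) (e / (2 * (C + 1)))"
  have d: "0 < d" "d * a \<le> 1 / 2" "C * d \<le> e / 2"
  proof -
    show d0: "0 < d" using a0 C0 e by (simp add: d_def)
    have "d * a \<le> 1 / (2 * (a + 1)) * (a + 1)"
      using a0 d0 by (intro mult_mono) (auto simp: d_def)
    also have "\<dots> = 1 / 2" using a0 by (simp add: field_simps)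
    finally show "d * a \<le> 1 / 2" .
    have "C * d \<le> (C + 1) * (e / (2 * (C + 1)))"
      using C0 d0 by (intro mult_mono) (auto simp: d_def)
    also have "\<dots> = e / 2" using C0 by (simp add: field_simps)
    finally show "C * d \<le> e / 2" .
  qed
  have "oscillation_decay v"
    by (rule Riemann_Lebesgue_phase[OF v_integrable])
  then obtain B where B: "\<And>k x. 0 \<le> Im k \<Longrightarrow> B \<le> cmod k \<Longrightarrow> norm (phase_int k v x) \<le> e / 2"
    unfolding oscillation_decay_def using e half_gt_zero by blast
  show ?thesis
  proof (rule exI[of _ d], rule conjI[OF d(1)], rule exI[of _ B], intro allI impI)
    fix k E m x
    assume k: "0 \<le> Im k" "B \<le> cmod k" and E: "in_L2 lborel E" "L2_nrm E \<le> d" and m: "jost_eq k E (\<lambda>_. 1) m"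
    have "L2_nrm E * a \<le> d * a"
      using E(2) a0 by (rule mult_right_mono)
    then have "L2_nrm E * a \<le> 1 / 2"
      using d(2) by simp
    then have small: "L2_nrm E * L2_nrm u * (1 + u_L1nrm) \<le> 1 / 2"
      by (simp only: a_def mult.assoc)
    have "cmod (m x - (1 + \<i> * iexp (U x) * phase_int k v x)) \<le> C * L2_nrm E"
      using jost_eq_approx[OF k(1) E(1) _ _ m small, of x] by (simp add: C_def mult.assoc)
    also have "\<dots> \<le> C * d"
      using E(2) C0 by (rule mult_left_mono)
    finally have "cmod (m x - (1 + \<i> * iexp (U x) * phase_int k v x)) \<le> e / 2"
      using d(3) by simp
    moreover have "cmod (\<i> * iexp (U x) * phase_int k v x) \<le> e / 2"
      using B[OF k] by (simp add: norm_mult norm_exp_U)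
    ultimately have "cmod ((m x - (1 + \<i> * iexp (U x) * phase_int k v x)) + \<i> * iexp (U x) * phase_int k v x) \<le> e / 2 + e / 2"
      by (rule norm_triangle_mono)
    then show "cmod (m x - 1) \<le> e" by simp
  qed
qed

section \<open>Plane waves and the scattering coefficients at large frequencies\<close>

lemma phase_int_plane_wave:
  "phase_int (of_real l) (\<lambda>y. w y * plane_wave l y) x = plane_wave l x * (LINT y:{..x}|lborel. w y)"
proof -
  have "exp (- \<i> * of_real l * of_real y) * plane_wave l y = 1" for y
    by (simp add: plane_wave_def mult.assoc flip: exp_add)
  then have "exp (- \<i> * of_real l * of_real y) * (w y * plane_wave l y) = w y" for y
    by (metis mult.left_commute mult.right_neutral)
  then show ?thesis
    unfolding phase_int_eq by (simp only: plane_wave_def of_real_mult mult.assoc)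
qed

text \<open>For a plane wave the phases in the Volterra solution cancel and the remaining integral
  of \<open>v\<close> is explicit: 1 + \<i> exp (\<i> U) times \<i> (exp (- \<i> U) - 1) equals exp
  (\<i> U).\<close>

lemma jost_e_approx:
  assumes E: "in_L2 lborel E" and m: "jost_eq (of_real l) E (plane_wave l) m"
    and small: "L2_nrm E * L2_nrm u * (1 + u_L1nrm) \<le> 1 / 2"
  shows "cmod (m x - plane_wave l x * iexp (U x)) \<le> 2 * (1 + u_L1nrm)\<^sup>2 * (L2_nrm u * L2_nrm E)"
proof -
  have "plane_wave l x + \<i> * iexp (U x) * phase_int (of_real l) (\<lambda>y. v y * plane_wave l y) x
     = plane_wave l x * iexp (U x)"
    unfolding phase_int_plane_wave integral_v_atMost
    by (simp add: exp_minus field_simps)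
  then show ?thesis
    using jost_eq_approx[OF _ E _ _ m small, of x] by simp
qed

text \<open>Limit of the Volterra identity at plus infinity: after cancellation of the common factor
  exp (\<i> l x), the partial integrals on both sides tend to Fourier integrals and U tends to
  \<open>U_inf\<close>.\<close>

lemma scattering_integral:
  assumes E: "in_L2 lborel E" and h: "h \<in> borel_measurable borel" "\<And>x. cmod (h x) \<le> 1"
    and m: "jost_eq (of_real l) E h m"
  shows "fourier (\<lambda>x. of_real (u x) * m x) l
    = iexp U_inf * (fourier (\<lambda>x. v x * h x) l + fourier (\<lambda>x. v x * rest E m x) l)"
proof -
  note meas [measurable] = jost_eq_meas[OF _ E h m, simplified]
  have "bounded (range m)"
    using m unfolding jost_eq_def by blast
  then obtain C where C: "\<And>x. norm (m x) \<le> C"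
    unfolding bounded_iff by blast
  note rb = rest_bound[OF E meas(1) C]
  have ui: "integrable lborel (\<lambda>x. of_real (u x) * m x)"
    by (rule integrable_um(1)[OF _ C]) measurable
  have vi: "integrable lborel (\<lambda>x. v x * h x)" "integrable lborel (\<lambda>x. v x * rest E m x)"
    by (rule integrable_vm(1)[OF _ h(2)] integrable_vm(1)[OF _ rb], measurable)+
  have vhi: "integrable lborel (\<lambda>x. v x * (h x + rest E m x))"
    using vi by (simp add: distrib_left)
  have lim: "((\<lambda>x. LINT y:{..x}|lborel. exp (- \<i> * of_real l * of_real y) * w y) \<longlongrightarrow> fourier w l) at_top"
    if w: "integrable lborel w" for w
  proof -
    have [measurable]: "w \<in> borel_measurable borel" using w by auto
    have "integrable lborel (\<lambda>y. exp (- \<i> * of_real l * of_real y) * w y)"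
      by (rule Bochner_Integration.integrable_bound[OF w]) (auto simp: norm_mult norm_exp)
    from integral_atMost_tendsto(2)[OF this] show ?thesis
      by (simp add: fourier_def mult_ac)
  qed
  have eq: "(LINT y:{..x}|lborel. exp (- \<i> * of_real l * of_real y) * (of_real (u y) * m y))
    = iexp (U x) * (LINT y:{..x}|lborel. exp (- \<i> * of_real l * of_real y) * (v y * (h y + rest E m y)))" for x
  proof -
    have "exp (\<i> * of_real l * of_real x) * (LINT y:{..x}|lborel. exp (- \<i> * of_real l * of_real y) * (of_real (u y) * m y))
      = exp (\<i> * of_real l * of_real x) * (iexp (U x) * (LINT y:{..x}|lborel. exp (- \<i> * of_real l * of_real y) * (v y * (h y + rest E m y))))"
      using jost_eq_volterra[OF _ E h m, of x] unfolding phase_int_eq by (simp add: mult.left_commute)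
    then show ?thesis by simp
  qed
  have lim1: "((\<lambda>x. iexp (U x) * (LINT y:{..x}|lborel. exp (- \<i> * of_real l * of_real y) * (v y * (h y + rest E m y))))
    \<longlongrightarrow> iexp U_inf * fourier (\<lambda>x. v x * (h x + rest E m x)) l) at_top"
    by (intro tendsto_mult lim vhi tendsto_exp tendsto_const tendsto_of_real U_tendsto)
  have "fourier (\<lambda>x. of_real (u x) * m x) l = iexp U_inf * fourier (\<lambda>x. v x * (h x + rest E m x)) l"
    by (rule tendsto_unique[OF _ lim[OF ui, unfolded eq] lim1]) simp
  also have "fourier (\<lambda>x. v x * (h x + rest E m x)) l = fourier (\<lambda>x. v x * h x) l + fourier (\<lambda>x. v x * rest E m x) l"
  proof -
    have "integrable lborel (\<lambda>x. w x * exp (- (\<i> * of_real (l * x))))" if w: "integrable lborel w" for w :: "real \<Rightarrow> complex"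
    proof -
      have [measurable]: "w \<in> borel_measurable borel" using w by auto
      show ?thesis
        by (rule Bochner_Integration.integrable_bound[OF w]) (auto simp: norm_mult norm_exp)
    qed
    from Bochner_Integration.integral_add[OF this[OF vi(1)] this[OF vi(2)]] show ?thesis
      by (simp add: fourier_def algebra_simps)
  qed
  finally show ?thesis .
qed

text \<open>An L2 bound says nothing about a Fourier transform at a single frequency. Here the phase
  exp (- \<i> l x) is absorbed into the left factor, which keeps the modulus |u|, and the bilinear
  bound applies directly at l.\<close>

lemma fourier_rest_bound:
  assumes l: "0 < l" and m: "m \<in> borel_measurable borel" "\<And>x. cmod (m x) \<le> C"
  shows "cmod (fourier (\<lambda>x. v x * rest (edge_kernel (of_real l)) m x) l) \<le> (L2_nrm u)\<^sup>2 * C / l"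
proof -
  define a where "a x = v x * exp (- (\<i> * of_real (l * x)))" for x
  have a_meas [measurable]: "a \<in> borel_measurable borel"
    unfolding a_def[abs_def] by measurable
  have ab: "norm (a x) = \<bar>u x\<bar>" for x
    by (simp add: a_def norm_mult norm_v norm_exp)
  note ai = integrable_u_mult[where w=a and m="\<lambda>_. 1" and C=1, simplified, OF ab]
  have C: "0 \<le> C" using m(2)[of 0] norm_ge_zero order_trans by blast
  have "cmod (LINT x|lborel. a x * (LINT y|lborel. edge_kernel (of_real l) (x - y) * (of_real (u y) * m y)))
     \<le> L2_nrm a * L2_nrm (\<lambda>y. of_real (u y) * m y) / l"
    by (rule edge_kernel_bilinear[OF l ai(1,3) integrable_um(1,3)[OF m]])
  also have "\<dots> \<le> L2_nrm u * (C * L2_nrm u) / l"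
    using l ai(4) integrable_um(4)[OF m] by (intro divide_right_mono mult_mono) auto
  finally have "cmod (LINT x|lborel. a x * rest (edge_kernel (of_real l)) m x) \<le> (L2_nrm u)\<^sup>2 * C / l"
    by (simp add: rest_def power2_eq_square mult_ac)
  moreover have "(LINT x|lborel. a x * rest (edge_kernel (of_real l)) m x) = fourier (\<lambda>x. v x * rest (edge_kernel (of_real l)) m x) l"
    unfolding fourier_def a_def by (simp add: mult_ac)
  ultimately show ?thesis by simp
qed

lemma fourier_v_plane_wave: "fourier (\<lambda>x. v x * plane_wave l x) l = \<i> * (exp (- \<i> * of_real U_inf) - 1)"
proof -
  have "plane_wave l x * exp (- (\<i> * of_real (l * x))) = 1" for x
    by (simp add: plane_wave_def flip: exp_add)
  then have "fourier (\<lambda>x. v x * plane_wave l x) l = (LINT x|lborel. v x)"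
    by (simp only: fourier_def mult.assoc mult_1_right)
  moreover have "((\<lambda>x. LINT y:{..x}|lborel. v y) \<longlongrightarrow> \<i> * (exp (- \<i> * of_real U_inf) - 1)) at_top"
    unfolding integral_v_atMost by (intro tendsto_intros U_tendsto)
  then have "(LINT x|lborel. v x) = \<i> * (exp (- \<i> * of_real U_inf) - 1)"
    by (rule tendsto_unique[OF _ integral_atMost_tendsto(2)[OF v_integrable], rotated]) simp
  ultimately show ?thesis by simp
qed

lemma edge_kernel_L2:
  assumes "0 < l"
  shows "in_L2 lborel (edge_kernel (of_real l))" "L2_nrm (edge_kernel (of_real l)) \<le> pi / sqrt l"
  using laplace_dominated_L2[of l "edge_kernel (of_real l)"] edge_kernel_bound[of "of_real l"] assms by auto

text \<open>The inequality pi / sqrt l * ||u||_2 * (1 + ||u||_1) <= 1/2 solved for l: from here on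
  the norm bound of the edge kernel meets the smallness hypothesis.\<close>

definition smallness_threshold :: real
  where "smallness_threshold = (2 * pi * L2_nrm u * (1 + u_L1nrm))\<^sup>2"

lemma edge_small:
  assumes l: "0 < l" "smallness_threshold \<le> l"
  shows "L2_nrm (edge_kernel (of_real l)) * L2_nrm u * (1 + u_L1nrm) \<le> 1 / 2"
proof -
  have "2 * pi * L2_nrm u * (1 + u_L1nrm) \<le> sqrt l"
    using l by (intro real_le_rsqrt) (simp add: smallness_threshold_def)
  then have half: "pi / sqrt l * (L2_nrm u * (1 + u_L1nrm)) \<le> 1 / 2"
    using l by (simp add: pos_divide_le_eq mult_ac)
  have "L2_nrm (edge_kernel (of_real l)) * (L2_nrm u * (1 + u_L1nrm)) \<le> pi / sqrt l * (L2_nrm u * (1 + u_L1nrm))"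
    using edge_kernel_L2(2)[OF l(1)] by (intro mult_right_mono) (auto intro!: mult_nonneg_nonneg add_nonneg_nonneg)
  also note half
  finally show ?thesis
    by (simp only: mult.assoc)
qed

text \<open>With c = \<open>U_inf\<close>, the main terms cancel exactly, since 1 + \<i> exp (\<i>
  c) times \<i> (exp (- \<i> c) - 1) is exp (\<i> c). What is left is the bilinear error of order 1
  / l.\<close>

lemma gamma_estimate:
  assumes l: "0 < l" "smallness_threshold \<le> l" and m: "jost_eq (of_real l) (edge_kernel (of_real l)) (plane_wave l) m"
  shows "cmod (1 + \<i> * fourier (\<lambda>x. of_real (u x) * m x) l - iexp U_inf)
    \<le> 2 * (1 + u_L1nrm) * (L2_nrm u)\<^sup>2 / l"
proof -
  note E = edge_kernel_L2(1)[OF l(1)]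
  have mb: "cmod (m x) \<le> 2 * (1 + u_L1nrm)" for x
    by (rule jost_eq_bound[OF _ E _ _ m edge_small[OF l]]) auto
  have mm: "m \<in> borel_measurable borel"
    using m by (simp add: jost_eq_def)
  have "1 + \<i> * fourier (\<lambda>x. of_real (u x) * m x) l - iexp U_inf
    = \<i> * iexp U_inf * fourier (\<lambda>x. v x * rest (edge_kernel (of_real l)) m x) l"
    unfolding scattering_integral[OF E plane_wave_measurable eq_refl[OF norm_plane_wave] m] fourier_v_plane_wave
    by (simp add: exp_minus field_simps)
  then have "cmod (1 + \<i> * fourier (\<lambda>x. of_real (u x) * m x) l - iexp U_inf)
    = cmod (fourier (\<lambda>x. v x * rest (edge_kernel (of_real l)) m x) l)"
    by (simp add: norm_mult norm_exp)
  also have "\<dots> \<le> (L2_nrm u)\<^sup>2 * (2 * (1 + u_L1nrm)) / l"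
    by (rule fourier_rest_bound[OF l(1) mm mb])
  finally show ?thesis
    by (simp add: mult_ac)
qed

text \<open>No exact cancellation takes place here, but the main term \<open>fourier v l\<close> is
  square integrable in l by Plancherel and tends to 0 by Riemann-Lebesgue; the error 1 / l has both
  properties away from 0.\<close>

lemma beta_estimate:
  assumes l: "0 < l" "smallness_threshold \<le> l" and m: "jost_eq (of_real l) (edge_kernel (of_real l)) (\<lambda>_. 1) m"
  shows "cmod (fourier (\<lambda>x. of_real (u x) * m x) l)
    \<le> cmod (fourier v l) + 2 * (1 + u_L1nrm) * (L2_nrm u)\<^sup>2 / l"
proof -
  note E = edge_kernel_L2(1)[OF l(1)]
  have mb: "cmod (m x) \<le> 2 * (1 + u_L1nrm)" for x
    by (rule jost_eq_bound[OF _ E _ _ m edge_small[OF l]]) auto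
  have mm: "m \<in> borel_measurable borel"
    using m by (simp add: jost_eq_def)
  have "cmod (fourier (\<lambda>x. of_real (u x) * m x) l)
    = cmod (fourier (\<lambda>x. v x * 1) l + fourier (\<lambda>x. v x * rest (edge_kernel (of_real l)) m x) l)"
    by (subst scattering_integral[OF E _ _ m]) (auto simp: norm_mult norm_exp)
  also have "\<dots> \<le> cmod (fourier v l) + (L2_nrm u)\<^sup>2 * (2 * (1 + u_L1nrm)) / l"
    using fourier_rest_bound[OF l(1) mm mb] by (intro norm_triangle_mono) auto
  finally show ?thesis
    by (simp add: mult_ac)
qed

lemma fourier_v_tendsto: "(fourier v \<longlongrightarrow> 0) at_top"
proof (rule tendstoI)
  fix e :: real assume e: "0 < e"
  then have "0 < e / 2" by simp
  moreover have "oscillation_decay v"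
    by (rule Riemann_Lebesgue_phase[OF v_integrable])
  ultimately obtain B where B: "\<And>k x. 0 \<le> Im k \<Longrightarrow> B \<le> cmod k \<Longrightarrow> norm (phase_int k v x) \<le> e / 2"
    unfolding oscillation_decay_def by blast
  have "cmod (fourier v l) \<le> e / 2" if l: "B \<le> l" for l
  proof -
    have "integrable lborel (\<lambda>y. exp (- \<i> * of_real l * of_real y) * v y)"
      by (rule Bochner_Integration.integrable_bound[OF v_integrable]) (auto simp: norm_mult norm_exp)
    from integral_atMost_tendsto(2)[OF this]
    have "((\<lambda>x. LINT y:{..x}|lborel. exp (- \<i> * of_real l * of_real y) * v y) \<longlongrightarrow> fourier v l) at_top"
      by (simp add: fourier_def mult_ac)
    moreover have "cmod (LINT y:{..x}|lborel. exp (- \<i> * of_real l * of_real y) * v y) \<le> e / 2" for x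
      using B[of "of_real l" x] l by (simp add: phase_int_eq norm_mult norm_exp)
    ultimately show ?thesis
      by (intro tendsto_upperbound[OF tendsto_norm]) auto
  qed
  then have "dist (fourier v l) 0 < e" if "B \<le> l" for l
    using that e by (simp add: dist_norm) (smt (verit) field_sum_of_halves)
  then show "\<forall>\<^sub>F l in at_top. dist (fourier v l) 0 < e"
    by (rule eventually_mono[OF eventually_ge_at_top[of B]])
qed

end

section \<open>Continuity of the coefficient in the spectral parameter\<close>

lemma edge_kernel_alt:
  assumes "x \<noteq> 0"
  shows "edge_kernel (of_real l) x = (LINT t:{0<..}|lborel. of_real (exp (- (t * l))) / (of_real t + \<i> * of_real x)) / (2 * of_real pi)"
proof -
  have "exp (- (complex_of_real l * of_real t)) = of_real (exp (- (t * l)))" for t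
    by (simp add: mult.commute flip: exp_of_real)
  then show ?thesis
    using assms by (simp add: edge_kernel_def ray_kernel_def)
qed

lemma norm_of_real_plus_i: "cmod (of_real t + \<i> * of_real x) = sqrt (t\<^sup>2 + x\<^sup>2)"
  by (simp add: cmod_def)

lemma edge_integrand_integrable:
  assumes "0 < l" "x \<noteq> 0"
  shows "set_integrable lborel {0<..} (\<lambda>t. of_real (exp (- (t * l))) / (of_real t + \<i> * of_real x))"
proof (rule set_integrable_bound[OF laplace_integrable[OF assms]])
  show "set_borel_measurable lborel {0<..} (\<lambda>t. of_real (exp (- (t * l))) / (complex_of_real t + \<i> * of_real x))"
    unfolding set_borel_measurable_def by measurable
qed (auto simp: norm_divide norm_of_real_plus_i)

lemma edge_kernel_continuous:
  fixes ls :: "nat \<Rightarrow> real"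
  assumes l: "0 < l" and ls: "ls \<longlonglongrightarrow> l" and x: "x \<noteq> 0"
  shows "(\<lambda>n. edge_kernel (of_real (ls n)) x) \<longlonglongrightarrow> edge_kernel (of_real l) x"
proof -
  have "0 < l / 2" using l by simp
  have ev: "\<forall>\<^sub>F n in sequentially. l / 2 < ls n"
    using order_tendstoD(1)[OF ls, of "l / 2"] l by simp
  then obtain N where N: "\<And>n. N \<le> n \<Longrightarrow> l / 2 < ls n"
    by (auto simp: eventually_sequentially)
  have "(\<lambda>n. LINT t|lborel. indicator {0<..} t *\<^sub>R (of_real (exp (- (t * ls (n + N)))) / (of_real t + \<i> * of_real x)))
    \<longlonglongrightarrow> (LINT t|lborel. indicator {0<..} t *\<^sub>R (of_real (exp (- (t * l))) / (complex_of_real t + \<i> * of_real x)))"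
  proof (rule integral_dominated_convergence)
    show "integrable lborel (\<lambda>t. indicator {0<..} t *\<^sub>R (exp (- (t * (l / 2))) / sqrt (t\<^sup>2 + x\<^sup>2)))"
      using laplace_integrable[OF \<open>0 < l / 2\<close> x] by (simp add: set_integrable_def)
    show "AE t in lborel. (\<lambda>n. indicator {0<..} t *\<^sub>R (of_real (exp (- (t * ls (n + N)))) / (complex_of_real t + \<i> * of_real x)))
       \<longlonglongrightarrow> indicator {0<..} t *\<^sub>R (of_real (exp (- (t * l))) / (complex_of_real t + \<i> * of_real x))"
      using x by (intro AE_I2 tendsto_intros LIMSEQ_ignore_initial_segment[OF ls]) (auto simp: complex_eq_iff)
    show "AE t in lborel. norm (indicator {0<..} t *\<^sub>R (of_real (exp (- (t * ls (n + N)))) / (complex_of_real t + \<i> * of_real x)))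
      \<le> indicator {0<..} t *\<^sub>R (exp (- (t * (l / 2))) / sqrt (t\<^sup>2 + x\<^sup>2))" for n
    proof (rule AE_I2)
      fix t :: real
      show "norm (indicator {0<..} t *\<^sub>R (of_real (exp (- (t * ls (n + N)))) / (complex_of_real t + \<i> * of_real x)))
        \<le> indicator {0<..} t *\<^sub>R (exp (- (t * (l / 2))) / sqrt (t\<^sup>2 + x\<^sup>2))"
      proof (cases "0 < t")
        case True
        then have "t * (l / 2) \<le> t * ls (n + N)"
          using N[of "n + N"] by (intro mult_left_mono) auto
        then have "exp (- (t * ls (n + N))) / sqrt (t\<^sup>2 + x\<^sup>2) \<le> exp (- (t * (l / 2))) / sqrt (t\<^sup>2 + x\<^sup>2)"
          by (intro divide_right_mono) auto
        then show ?thesis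
          using True by (simp add: norm_divide norm_of_real_plus_i)
      qed simp
    qed
  qed measurable
  then have "(\<lambda>n. edge_kernel (of_real (ls (n + N))) x) \<longlonglongrightarrow> edge_kernel (of_real l) x"
    unfolding edge_kernel_alt[OF x] set_lebesgue_integral_def by (intro tendsto_divide tendsto_const) auto
  then show ?thesis
    by (rule LIMSEQ_offset)
qed

text \<open>The singular part of the kernel, over small \<open>t\<close>, is small in mean square; the rest is Lipschitz.\<close>

lemma edge_kernel_diff:
  assumes a: "0 < a" "a \<le> l" and d: "0 < d" and p: "p \<noteq> 0" and q: "q \<noteq> 0"
  shows "cmod (edge_kernel (of_real l) p - edge_kernel (of_real l) q)
    \<le> exp 1 * (laplace_nrm (1 / d) p + laplace_nrm (1 / d) q) + \<bar>p - q\<bar> / d\<^sup>2 / a"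
proof -
  have l: "0 < l" using a by simp
  define f where "f x t = of_real (exp (- (t * l))) / (complex_of_real t + \<i> * of_real x)" for x t
  define g where "g t = exp 1 * (exp (- (t * (1 / d))) / sqrt (t\<^sup>2 + p\<^sup>2)) + exp 1 * (exp (- (t * (1 / d))) / sqrt (t\<^sup>2 + q\<^sup>2))
    + \<bar>p - q\<bar> / d\<^sup>2 * exp (- (t * a))" for t
  note fi = edge_integrand_integrable[OF l p, folded f_def] edge_integrand_integrable[OF l q, folded f_def]
  have d': "0 < 1 / d" using d by simp
  have gi1: "set_integrable lborel {0<..} (\<lambda>t. exp 1 * (exp (- (t * (1 / d))) / sqrt (t\<^sup>2 + x\<^sup>2)))" if "x \<noteq> 0" for x
    using laplace_integrable[OF d' that] by (intro set_integrable_mult_right)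
  have gi2: "set_integrable lborel {0<..} (\<lambda>t. \<bar>p - q\<bar> / d\<^sup>2 * exp (- (t * a)))"
    using integrable_I0i_exp_mscale[OF a(1)] by (intro set_integrable_mult_right)
  have gi12: "set_integrable lborel {0<..} (\<lambda>t. exp 1 * (exp (- (t * (1 / d))) / sqrt (t\<^sup>2 + p\<^sup>2)) + exp 1 * (exp (- (t * (1 / d))) / sqrt (t\<^sup>2 + q\<^sup>2)))"
    by (rule set_integral_add(1)[OF gi1[OF p] gi1[OF q]])
  have gi: "set_integrable lborel {0<..} g"
    unfolding g_def[abs_def] by (rule set_integral_add(1)[OF gi12 gi2])
  have le: "cmod (f p t - f q t) \<le> g t" if t: "0 < t" for t
  proof (cases "t \<le> d")
    case True
    \<comment> \<open>For t <= d the factor exp (- t / d) is at least 1 / exp 1, hence the constant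
      exp 1. The small t are thereby dominated by a Laplace majorant of rate 1 / d, whose L2 norm is
      at most pi sqrt d.\<close>
    have e: "exp (- (t * l)) \<le> exp 1 * exp (- (t * (1 / d)))"
    proof -
      have "- (t * l) \<le> 1 + - (t * (1 / d))"
        using True t l d mult_pos_pos[OF t l] by (simp add: field_simps) (smt (verit) mult_pos_pos)
      then show ?thesis by (simp flip: exp_add)
    qed
    have *: "cmod (f x t) \<le> exp 1 * (exp (- (t * (1 / d))) / sqrt (t\<^sup>2 + x\<^sup>2))" for x
      unfolding f_def norm_divide norm_of_real_plus_i times_divide_eq_right
      using e by (intro divide_right_mono) auto
    have "cmod (f p t - f q t) \<le> cmod (f p t) + cmod (f q t)"
      by (rule norm_triangle_ineq4)
    moreover have "0 \<le> \<bar>p - q\<bar> / d\<^sup>2 * exp (- (t * a))" by simp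
    ultimately show ?thesis
      using *[of p] *[of q] unfolding g_def by linarith
  next
    case False
    then have td: "d < t" by simp
    have nz: "complex_of_real t + \<i> * of_real x \<noteq> 0" for x
      using t by (simp add: complex_eq_iff)
    have "f p t - f q t = of_real (exp (- (t * l))) * (\<i> * of_real (q - p)) / ((complex_of_real t + \<i> * of_real p) * (complex_of_real t + \<i> * of_real q))"
      unfolding f_def using nz[of p] nz[of q] by (simp add: field_simps)
    then have "cmod (f p t - f q t) = exp (- (t * l)) * \<bar>p - q\<bar> / (sqrt (t\<^sup>2 + p\<^sup>2) * sqrt (t\<^sup>2 + q\<^sup>2))"
      by (simp add: norm_mult norm_divide norm_of_real_plus_i abs_minus_commute flip: of_real_diff)
    also have "\<dots> \<le> exp (- (t * a)) * \<bar>p - q\<bar> / (d * d)"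
    proof (rule frac_le)
      show "exp (- (t * l)) * \<bar>p - q\<bar> \<le> exp (- (t * a)) * \<bar>p - q\<bar>"
        using a t by (intro mult_right_mono) auto
      have "d \<le> sqrt (t\<^sup>2 + x\<^sup>2)" for x
      proof -
        have "\<bar>t\<bar> \<le> sqrt (t\<^sup>2 + x\<^sup>2)" by (simp add: real_le_rsqrt)
        then show ?thesis using td by linarith
      qed
      then show "d * d \<le> sqrt (t\<^sup>2 + p\<^sup>2) * sqrt (t\<^sup>2 + q\<^sup>2)"
        using d by (intro mult_mono) auto
    qed (use d in auto)
    also have "\<dots> = \<bar>p - q\<bar> / d\<^sup>2 * exp (- (t * a))"
      by (simp add: power2_eq_square)
    also have "\<dots> \<le> g t"
      unfolding g_def by simp
    finally show ?thesis .
  qed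
  have "cmod ((LINT t:{0<..}|lborel. f p t) - (LINT t:{0<..}|lborel. f q t)) \<le> (LINT t:{0<..}|lborel. g t)"
  proof -
    have "(LINT t:{0<..}|lborel. f p t) - (LINT t:{0<..}|lborel. f q t) = (LINT t:{0<..}|lborel. f p t - f q t)"
      by (rule set_integral_diff(2)[OF fi, symmetric])
    also have "cmod \<dots> \<le> (LINT t:{0<..}|lborel. cmod (f p t - f q t))"
      unfolding set_lebesgue_integral_def
      by (rule order_trans[OF integral_norm_bound]) simp
    also have "\<dots> \<le> (LINT t:{0<..}|lborel. g t)"
      using le gi set_integral_diff(1)[OF fi] by (intro set_integral_mono set_integrable_norm) auto
    finally show ?thesis .
  qed
  also have "(LINT t:{0<..}|lborel. g t) = exp 1 * laplace_nrm (1 / d) p + exp 1 * laplace_nrm (1 / d) q + \<bar>p - q\<bar> / d\<^sup>2 * (LINT t:{0<..}|lborel. exp (- (t * a)))"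
    unfolding g_def set_integral_add(2)[OF gi12 gi2] set_integral_add(2)[OF gi1[OF p] gi1[OF q]] set_integral_mult_right laplace_nrm_def ..
  also have "(LINT t:{0<..}|lborel. exp (- (t * a))) = 1 / a"
    using LBINT_I0i_exp_mscale[OF a(1)] by (simp add: interval_lebesgue_integral_0_infty)
  finally have main: "cmod ((LINT t:{0<..}|lborel. f p t) - (LINT t:{0<..}|lborel. f q t))
    \<le> exp 1 * (laplace_nrm (1 / d) p + laplace_nrm (1 / d) q) + \<bar>p - q\<bar> / d\<^sup>2 / a"
    by (simp add: distrib_left)
  have "cmod (edge_kernel (of_real l) p - edge_kernel (of_real l) q) = cmod ((LINT t:{0<..}|lborel. f p t) - (LINT t:{0<..}|lborel. f q t)) / (2 * pi)"
    unfolding edge_kernel_alt[OF p] edge_kernel_alt[OF q] f_def by (simp add: norm_divide norm_mult flip: diff_divide_distrib)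
  also have "\<dots> \<le> cmod ((LINT t:{0<..}|lborel. f p t) - (LINT t:{0<..}|lborel. f q t)) / 1"
    using pi_gt3 by (intro divide_left_mono) auto
  finally show ?thesis using main by simp
qed

context potential
begin

section \<open>The operator of the Jost equation: linearity, limits and equicontinuity\<close>

definition jost_op :: "complex \<Rightarrow> (real \<Rightarrow> complex) \<Rightarrow> (real \<Rightarrow> complex) \<Rightarrow> real \<Rightarrow> complex"
  where "jost_op k E m x = rest E m x + \<i> * phase_int k (\<lambda>y. of_real (u y) * m y) x"

lemma jost_eq_iff:
  "jost_eq k E h m \<longleftrightarrow> m \<in> borel_measurable borel \<and> bounded (range m) \<and> (\<forall>x. m x = h x + jost_op k E m x)"
  by (simp add: jost_eq_def jost_op_def add.assoc)

text \<open>The bound is kept in terms of norms of u m instead of sup |m|: along a bounded sequence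
  m that tends to 0 pointwise it then gives decay uniform in x.\<close>

lemma jost_op_bound:
  assumes k: "0 \<le> Im k" and E: "in_L2 lborel E" and m: "m \<in> borel_measurable borel" "\<And>x. cmod (m x) \<le> C"
  shows "cmod (jost_op k E m x) \<le> L2_nrm E * L2_nrm (\<lambda>y. of_real (u y) * m y) + (LINT y|lborel. cmod (of_real (u y) * m y))"
  unfolding jost_op_def rest_def
  using integral_convolution_bound(2)[OF E integrable_um(3)[OF m], of x] norm_phase_int_le[OF integrable_um(1)[OF m] k, of x]
  by (intro norm_triangle_mono) (auto simp: norm_mult)

lemma jost_op_combine:
  assumes k: "0 \<le> Im k" and E: "in_L2 lborel E" and m: "m \<in> borel_measurable borel" "\<And>x. cmod (m x) \<le> C"
    and n: "n \<in> borel_measurable borel" "\<And>x. cmod (n x) \<le> D"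
  shows "jost_op k E (\<lambda>x. s * m x + t * n x) x = s * jost_op k E m x + t * jost_op k E n x"
proof -
  note um = integrable_um[OF m] and un = integrable_um[OF n]
  have "rest E (\<lambda>x. s * m x + t * n x) x = s * rest E m x + t * rest E n x"
  proof -
    have i: "integrable lborel (\<lambda>y. s * (E (x - y) * (of_real (u y) * m y)))" "integrable lborel (\<lambda>y. t * (E (x - y) * (of_real (u y) * n y)))"
      using integral_convolution_bound(1)[OF E um(3)] integral_convolution_bound(1)[OF E un(3)] by (auto intro: integrable_mult_right)
    have "rest E (\<lambda>x. s * m x + t * n x) x = (LINT y|lborel. s * (E (x - y) * (of_real (u y) * m y)) + t * (E (x - y) * (of_real (u y) * n y)))"
      unfolding rest_def by (simp add: algebra_simps)
    also have "\<dots> = (LINT y|lborel. s * (E (x - y) * (of_real (u y) * m y))) + (LINT y|lborel. t * (E (x - y) * (of_real (u y) * n y)))"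
      by (rule Bochner_Integration.integral_add[OF i])
    finally show ?thesis
      by (simp only: rest_def integral_mult_right_zero)
  qed
  moreover have "phase_int k (\<lambda>y. of_real (u y) * (s * m y + t * n y)) x
    = s * phase_int k (\<lambda>y. of_real (u y) * m y) x + t * phase_int k (\<lambda>y. of_real (u y) * n y) x"
  proof -
    have "(\<lambda>y. of_real (u y) * (s * m y + t * n y)) = (\<lambda>y. s * (of_real (u y) * m y) + t * (of_real (u y) * n y))"
      by (simp add: fun_eq_iff algebra_simps)
    then show ?thesis
      using um(1) un(1) k by (simp only: phase_int_add integrable_mult_right phase_int_cmult)
  qed
  ultimately show ?thesis
    unfolding jost_op_def by (simp add: algebra_simps)
qed

text \<open>Dominated convergence in both parts. Laplace majorants decrease in the rate, so the
  common lower bound a of the spectral parameters provides a single majorant.\<close>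

lemma jost_op_tendsto:
  fixes ls :: "nat \<Rightarrow> real" and l a :: real
  assumes l: "0 < l" and ls: "ls \<longlonglongrightarrow> l" "\<And>n. a \<le> ls n" "0 < a"
    and f: "\<And>n. f n \<in> borel_measurable borel" "\<And>n x. cmod (f n x) \<le> 1"
    and g: "\<And>x. (\<lambda>n. f n x) \<longlonglongrightarrow> g x"
  shows "(\<lambda>n. jost_op (of_real (ls n)) (edge_kernel (of_real (ls n))) (f n) x) \<longlonglongrightarrow> jost_op (of_real l) (edge_kernel (of_real l)) g x"
proof -
  note [measurable] = f(1)
  have [measurable]: "g \<in> borel_measurable borel"
    by (rule borel_measurable_LIMSEQ_metric[OF f(1) g])
  have "(\<lambda>n. rest (edge_kernel (of_real (ls n))) (f n) x) \<longlonglongrightarrow> rest (edge_kernel (of_real l)) g x"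
    unfolding rest_def
  proof (rule integral_dominated_convergence)
    show "integrable lborel (\<lambda>y. laplace_nrm a (x - y) * \<bar>u y\<bar>)"
    proof (rule integral_convolution_bound(1)[OF laplace_nrm_L2(1)[OF ls(3)]])
      show "in_L2 lborel (\<lambda>y. \<bar>u y\<bar>)" using u_L2 by (simp add: in_L2_def)
    qed
    have ae: "AE y in lborel. x - y \<noteq> 0"
      using AE_lborel_singleton[of x] by eventually_elim simp
    then show "AE y in lborel. (\<lambda>n. edge_kernel (of_real (ls n)) (x - y) * (of_real (u y) * f n y)) \<longlonglongrightarrow> edge_kernel (of_real l) (x - y) * (of_real (u y) * g y)"
      by eventually_elim (intro tendsto_mult tendsto_const g edge_kernel_continuous[OF l ls(1)])
    show "AE y in lborel. norm (edge_kernel (of_real (ls n)) (x - y) * (of_real (u y) * f n y)) \<le> laplace_nrm a (x - y) * \<bar>u y\<bar>" for n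
      using ae
    proof eventually_elim
      case (elim y)
      have ls0: "0 < ls n" using ls(2)[of n] ls(3) by simp
      have "cmod (edge_kernel (of_real (ls n)) (x - y)) \<le> laplace_nrm (ls n) (x - y)"
        using edge_kernel_bound[of "of_real (ls n)"] ls0 by simp
      also have "\<dots> \<le> laplace_nrm a (x - y)"
        by (rule laplace_nrm_antimono[OF ls(3,2) elim])
      finally have "cmod (edge_kernel (of_real (ls n)) (x - y)) * (\<bar>u y\<bar> * cmod (f n y)) \<le> laplace_nrm a (x - y) * (\<bar>u y\<bar> * 1)"
        using f(2) by (intro mult_mono mult_left_mono mult_nonneg_nonneg) auto
      then show ?case by (simp add: norm_mult)
    qed
  qed measurable
  moreover have "(\<lambda>n. phase_int (of_real (ls n)) (\<lambda>y. of_real (u y) * f n y) x) \<longlonglongrightarrow> phase_int (of_real l) (\<lambda>y. of_real (u y) * g y) x"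
    unfolding phase_int_def set_lebesgue_integral_def
  proof (rule integral_dominated_convergence)
    show "integrable lborel (\<lambda>y. \<bar>u y\<bar>)" using u_int by simp
    show "AE y in lborel. (\<lambda>n. indicator {..x} y *\<^sub>R (exp (\<i> * of_real (ls n) * of_real (x - y)) * (of_real (u y) * f n y)))
      \<longlonglongrightarrow> indicator {..x} y *\<^sub>R (exp (\<i> * of_real l * of_real (x - y)) * (of_real (u y) * g y))"
      by (intro AE_I2 tendsto_intros ls(1) g)
    show "AE y in lborel. norm (indicator {..x} y *\<^sub>R (exp (\<i> * of_real (ls n) * of_real (x - y)) * (of_real (u y) * f n y))) \<le> \<bar>u y\<bar>" for n
    proof (rule AE_I2)
      fix y
      have "\<bar>u y\<bar> * cmod (f n y) \<le> \<bar>u y\<bar> * 1"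
        using f(2) by (intro mult_left_mono) auto
      then show "norm (indicator {..x} y *\<^sub>R (exp (\<i> * of_real (ls n) * of_real (x - y)) * (of_real (u y) * f n y))) \<le> \<bar>u y\<bar>"
        by (auto simp: norm_mult norm_exp indicator_def)
    qed
  qed measurable
  ultimately show ?thesis
    unfolding jost_op_def by (intro tendsto_intros)
qed

text \<open>A modulus of continuity: integrals of functions bounded by |u| have increments of at
  most those of W.\<close>

definition "W x = (LINT y:{..x}|lborel. \<bar>u y\<bar>)"

lemma W_isCont: "isCont W x"
proof -
  have "set_integrable lborel {..x} (\<lambda>x. complex_of_real \<bar>u x\<bar>)" for x
    using u_int unfolding set_integrable_def by (intro integrable_mult_indicator integrable_of_real) auto
  then have "primitive (\<lambda>x. LINT y:{..x}|lborel. complex_of_real \<bar>u y\<bar>) (\<lambda>x. of_real \<bar>u x\<bar>)"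
    by (rule primitive_atMost)
  then have "continuous_on {x-1..x+1} (\<lambda>x. complex_of_real (W x))"
    unfolding W_def set_integral_complex_of_real[symmetric] by (rule primitive_continuous)
  then have "continuous_on {x-1..x+1} (\<lambda>x. Re (complex_of_real (W x)))"
    by (rule continuous_on_Re)
  then show ?thesis
    by (simp add: continuous_on_interior)
qed

lemma integral_atMost_diff_le:
  assumes f: "f \<in> borel_measurable borel" "\<And>y. cmod (f y) \<le> \<bar>u y\<bar>"
  shows "cmod ((LINT z:{..y}|lborel. f z) - (LINT z:{..x}|lborel. f z)) \<le> \<bar>W y - W x\<bar>"
proof -
  have *: "cmod ((LINT z:{..y}|lborel. f z) - (LINT z:{..x}|lborel. f z)) \<le> W y - W x" if xy: "x \<le> y" for x y
  proof -
    have fi: "integrable lborel f"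
      by (rule Bochner_Integration.integrable_bound[OF u_int]) (use f in auto)
    have i: "integrable lborel (\<lambda>z. indicator {..y} z *\<^sub>R f z)" for y
      by (intro integrable_mult_indicator fi) auto
    have j: "integrable lborel (\<lambda>z. indicator {..y} z *\<^sub>R \<bar>u z\<bar>)" for y
      using u_int by (intro integrable_mult_indicator) auto
    have le: "norm (indicator {..y} z *\<^sub>R f z - indicator {..x} z *\<^sub>R f z) \<le> indicator {..y} z *\<^sub>R \<bar>u z\<bar> - indicator {..x} z *\<^sub>R \<bar>u z\<bar>" for z
      using f(2)[of z] xy by (auto simp: indicator_def)
    have "(LINT z:{..y}|lborel. f z) - (LINT z:{..x}|lborel. f z) = (LINT z|lborel. indicator {..y} z *\<^sub>R f z - indicator {..x} z *\<^sub>R f z)"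
      unfolding set_lebesgue_integral_def by (rule Bochner_Integration.integral_diff[OF i i, symmetric])
    also have "cmod \<dots> \<le> (LINT z|lborel. indicator {..y} z *\<^sub>R \<bar>u z\<bar> - indicator {..x} z *\<^sub>R \<bar>u z\<bar>)"
      by (rule order_trans[OF integral_norm_bound integral_mono[OF integrable_norm[OF Bochner_Integration.integrable_diff[OF i i]] Bochner_Integration.integrable_diff[OF j j] le]])
    also have "\<dots> = W y - W x"
      unfolding W_def set_lebesgue_integral_def by (rule Bochner_Integration.integral_diff[OF j j])
    finally show ?thesis .
  qed
  show ?thesis
    using *[of x y] *[of y x] by (cases "x \<le> y") (auto simp: norm_minus_commute)
qed

lemma phase_int_diff_le:
  assumes m: "m \<in> borel_measurable borel" "\<And>x. cmod (m x) \<le> 1"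
  shows "cmod (phase_int (of_real l) (\<lambda>y. of_real (u y) * m y) y - phase_int (of_real l) (\<lambda>y. of_real (u y) * m y) x)
    \<le> \<bar>l\<bar> * \<bar>y - x\<bar> * u_L1nrm + \<bar>W y - W x\<bar>"
proof -
  note [measurable] = m(1)
  define f where "f z = exp (- \<i> * of_real l * of_real z) * (of_real (u z) * m z)" for z
  have fm [measurable]: "f \<in> borel_measurable borel" unfolding f_def[abs_def] by measurable
  have fu: "cmod (f z) \<le> \<bar>u z\<bar>" for z
    using mult_left_mono[OF m(2)[of z], of "\<bar>u z\<bar>"] by (simp add: f_def norm_mult norm_exp)
  have M: "cmod (LINT z:{..x}|lborel. f z) \<le> u_L1nrm"
  proof -
    have "integrable lborel f"
      by (rule Bochner_Integration.integrable_bound[OF u_int]) (use fu in auto)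
    then have "integrable lborel (\<lambda>z. indicator {..x} z *\<^sub>R f z)"
      by (intro integrable_mult_indicator) auto
    then have "cmod (LINT z|lborel. indicator {..x} z *\<^sub>R f z) \<le> (LINT z|lborel. \<bar>u z\<bar>)"
      by (intro order_trans[OF integral_norm_bound integral_mono] integrable_norm)
        (use fu u_int in \<open>auto simp: indicator_def\<close>)
    then show ?thesis by (simp add: set_lebesgue_integral_def u_L1nrm_def)
  qed
  have e: "exp (\<i> * of_real l * of_real z) = iexp (l * z)" for z :: real
    by (simp add: mult.assoc)
  have "phase_int (of_real l) (\<lambda>y. of_real (u y) * m y) y - phase_int (of_real l) (\<lambda>y. of_real (u y) * m y) x
    = (iexp (l * y) - iexp (l * x)) * (LINT z:{..x}|lborel. f z)
     + iexp (l * y) * ((LINT z:{..y}|lborel. f z) - (LINT z:{..x}|lborel. f z))"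
    unfolding phase_int_eq f_def[symmetric] e by (simp add: algebra_simps)
  also have "cmod \<dots> \<le> \<bar>l * y - l * x\<bar> * u_L1nrm + 1 * \<bar>W y - W x\<bar>"
  proof (rule order_trans[OF norm_triangle_ineq add_mono])
    show "cmod ((iexp (l * y) - iexp (l * x)) * (LINT z:{..x}|lborel. f z)) \<le> \<bar>l * y - l * x\<bar> * u_L1nrm"
      unfolding norm_mult by (intro mult_mono exp_i_diff_le M) auto
    show "cmod (iexp (l * y) * ((LINT z:{..y}|lborel. f z) - (LINT z:{..x}|lborel. f z))) \<le> 1 * \<bar>W y - W x\<bar>"
      unfolding norm_mult by (intro mult_mono integral_atMost_diff_le fm fu) (auto simp: norm_exp)
  qed
  also have "\<bar>l * y - l * x\<bar> = \<bar>l\<bar> * \<bar>y - x\<bar>"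
    by (simp add: abs_mult flip: right_diff_distrib)
  finally show ?thesis by simp
qed

text \<open>Two scales: the first term, from the singular part of the kernel, is small with d
  however far apart x and y are; for fixed d the second is Lipschitz in y - x. Both are uniform in l
  >= a.\<close>

lemma rest_diff_le:
  assumes m: "m \<in> borel_measurable borel" "\<And>x. cmod (m x) \<le> 1"
    and a: "0 < a" "a \<le> l" and d: "0 < d"
  shows "cmod (rest (edge_kernel (of_real l)) m y - rest (edge_kernel (of_real l)) m x)
    \<le> 2 * exp 1 * (pi * sqrt d) * L2_nrm u + \<bar>y - x\<bar> / d\<^sup>2 / a * u_L1nrm"
proof -
  note [measurable] = m(1)
  let ?E = "edge_kernel (of_real l)"
  let ?L = "laplace_nrm (1 / d)"
  have l: "0 < l" and d': "0 < 1 / d" using a d by auto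
  have au: "in_L2 lborel (\<lambda>z. \<bar>u z\<bar>)" and aun: "L2_nrm (\<lambda>z. \<bar>u z\<bar>) = L2_nrm u"
    using u_L2 by (auto simp: in_L2_def L2_nrm_def)
  note E = integral_convolution_bound(1)[OF edge_kernel_L2(1)[OF l] integrable_um(3)[OF m]]
  note L = integral_convolution_bound[OF laplace_nrm_L2(1)[OF d'] au, unfolded aun]
  have L2: "(LINT z|lborel. ?L (x - z) * \<bar>u z\<bar>) \<le> pi * sqrt d * L2_nrm u" for x
  proof -
    have "L2_nrm ?L * L2_nrm u \<le> pi * sqrt d * L2_nrm u"
      using laplace_nrm_L2(2)[OF d'] d by (intro mult_right_mono) (auto simp: real_sqrt_divide)
    then show ?thesis using L(2)[of x] by (simp add: abs_le_iff)
  qed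
  define g where "g z = exp 1 * (?L (y - z) * \<bar>u z\<bar>) + exp 1 * (?L (x - z) * \<bar>u z\<bar>) + \<bar>y - x\<bar> / d\<^sup>2 / a * \<bar>u z\<bar>" for z
  have gi1: "integrable lborel (\<lambda>z. exp 1 * (?L (x - z) * \<bar>u z\<bar>))" for x
    using L(1) by (intro integrable_mult_right)
  have gi3: "integrable lborel (\<lambda>z. \<bar>y - x\<bar> / d\<^sup>2 / a * \<bar>u z\<bar>)"
    using u_int by (intro integrable_mult_right) auto
  have gi: "integrable lborel g"
    unfolding g_def[abs_def] using gi1 gi3 by (intro Bochner_Integration.integrable_add)
  have "AE z in lborel. y - z \<noteq> 0 \<and> x - z \<noteq> 0"
    using AE_lborel_singleton[of x] AE_lborel_singleton[of y] by eventually_elim auto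
  have nn: "0 \<le> \<bar>y - x\<bar> / (d\<^sup>2 * a)" using a by simp
  from \<open>AE z in lborel. y - z \<noteq> 0 \<and> x - z \<noteq> 0\<close> have le: "AE z in lborel. norm (?E (y - z) * (of_real (u z) * m z) - ?E (x - z) * (of_real (u z) * m z)) \<le> g z"
  proof eventually_elim
    case (elim z)
    have "cmod (?E (y - z) - ?E (x - z)) \<le> exp 1 * (?L (y - z) + ?L (x - z)) + \<bar>(y - z) - (x - z)\<bar> / d\<^sup>2 / a"
      using edge_kernel_diff[OF a d] elim by blast
    then have "cmod (?E (y - z) - ?E (x - z)) * (\<bar>u z\<bar> * cmod (m z)) \<le> (exp 1 * (?L (y - z) + ?L (x - z)) + \<bar>y - x\<bar> / d\<^sup>2 / a) * (\<bar>u z\<bar> * 1)"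
      using m(2)[of z] nn
      by (intro mult_mono mult_left_mono) (auto intro!: add_nonneg_nonneg mult_nonneg_nonneg)
    moreover have "norm (?E (y - z) * (of_real (u z) * m z) - ?E (x - z) * (of_real (u z) * m z)) = cmod (?E (y - z) - ?E (x - z)) * (\<bar>u z\<bar> * cmod (m z))"
      by (simp add: norm_mult flip: left_diff_distrib)
    ultimately show ?case
      by (simp add: g_def algebra_simps)
  qed
  have "rest ?E m y - rest ?E m x = (LINT z|lborel. ?E (y - z) * (of_real (u z) * m z) - ?E (x - z) * (of_real (u z) * m z))"
    unfolding rest_def by (rule Bochner_Integration.integral_diff[OF E E, symmetric])
  also have "cmod \<dots> \<le> (LINT z|lborel. g z)"
    by (rule order_trans[OF integral_norm_bound integral_mono_AE[OF integrable_norm[OF Bochner_Integration.integrable_diff[OF E E]] gi le]])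
  also have "\<dots> = exp 1 * (LINT z|lborel. ?L (y - z) * \<bar>u z\<bar>) + exp 1 * (LINT z|lborel. ?L (x - z) * \<bar>u z\<bar>) + \<bar>y - x\<bar> / d\<^sup>2 / a * u_L1nrm"
    unfolding g_def u_L1nrm_def
    by (simp only: Bochner_Integration.integral_add[OF Bochner_Integration.integrable_add[OF gi1 gi1] gi3] Bochner_Integration.integral_add[OF gi1 gi1] integral_mult_right_zero)
  also have "\<dots> \<le> exp 1 * (pi * sqrt d * L2_nrm u) + exp 1 * (pi * sqrt d * L2_nrm u) + \<bar>y - x\<bar> / d\<^sup>2 / a * u_L1nrm"
    by (intro add_mono mult_left_mono L2 order_refl) auto
  also have "exp 1 * (pi * sqrt d * L2_nrm u) + exp 1 * (pi * sqrt d * L2_nrm u) = 2 * exp 1 * (pi * sqrt d) * L2_nrm u"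
    by simp
  finally show ?thesis .
qed

lemma jost_op_equicontinuous:
  assumes a: "0 < a" and e: "0 < e"
  shows "\<exists>d>0. \<forall>l m y. a \<le> l \<longrightarrow> l \<le> b \<longrightarrow> m \<in> borel_measurable borel \<longrightarrow> (\<forall>x. cmod (m x) \<le> 1) \<longrightarrow> \<bar>y - x\<bar> < d \<longrightarrow>
    cmod (jost_op (of_real l) (edge_kernel (of_real l)) m y - jost_op (of_real l) (edge_kernel (of_real l)) m x) \<le> e"
proof -
  define K where "K = 2 * exp 1 * pi * L2_nrm u + 1"
  have K: "0 < K" by (simp add: K_def add_nonneg_pos)
  \<comment> \<open>The scale r is fixed before the distance d: it brings the singular part of the
    kernel below e / 4. The constant c then collects the Lipschitz constants, which depend on
    r.\<close>
  define r where "r = (e / (4 * K))\<^sup>2"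
  have r: "0 < r" "2 * exp 1 * (pi * sqrt r) * L2_nrm u \<le> e / 4"
  proof -
    show "0 < r" using e K by (simp add: r_def)
    have "sqrt r = e / (4 * K)" using e K by (simp add: r_def)
    moreover have "2 * exp 1 * pi * L2_nrm u * (e / (4 * K)) \<le> K * (e / (4 * K))"
      using e K by (intro mult_right_mono) (auto simp: K_def)
    ultimately show "2 * exp 1 * (pi * sqrt r) * L2_nrm u \<le> e / 4"
      using K by (simp add: mult_ac)
  qed
  define c where "c = u_L1nrm / r\<^sup>2 / a + \<bar>b\<bar> * u_L1nrm + 1"
  have c: "0 < c" using a by (auto simp: c_def intro!: add_nonneg_pos)
  have "0 < e / 4" using e by simp
  then obtain d1 where d1: "0 < d1" "\<And>y. \<bar>y - x\<bar> < d1 \<Longrightarrow> \<bar>W y - W x\<bar> < e / 4"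
    using W_isCont[of x] unfolding continuous_at_eps_delta dist_real_def by metis
  define d where "d = min d1 (e / (4 * c))"
  show ?thesis
  proof (rule exI[of _ d], intro conjI allI impI)
    show "0 < d" using d1 e c by (simp add: d_def)
    fix l y :: real and m :: "real \<Rightarrow> complex"
    assume l: "a \<le> l" "l \<le> b" and m: "m \<in> borel_measurable borel" "\<forall>x. cmod (m x) \<le> 1" and y: "\<bar>y - x\<bar> < d"
    let ?E = "edge_kernel (of_real l)"
    let ?P = "\<lambda>x. phase_int (of_real l) (\<lambda>y. of_real (u y) * m y) x"
    have m': "\<And>x. cmod (m x) \<le> 1" using m(2) by simp
    have "\<bar>y - x\<bar> / r\<^sup>2 / a * u_L1nrm + \<bar>l\<bar> * \<bar>y - x\<bar> * u_L1nrm \<le> c * \<bar>y - x\<bar>"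
    proof -
      have "\<bar>l\<bar> * u_L1nrm \<le> \<bar>b\<bar> * u_L1nrm"
        using l a by (intro mult_right_mono) auto
      then have "(u_L1nrm / r\<^sup>2 / a + \<bar>l\<bar> * u_L1nrm) * \<bar>y - x\<bar> \<le> c * \<bar>y - x\<bar>"
        by (intro mult_right_mono) (auto simp: c_def)
      then show ?thesis by (simp add: algebra_simps)
    qed
    also have "\<dots> \<le> c * (e / (4 * c))"
      using y c by (intro mult_left_mono) (auto simp: d_def)
    also have "\<dots> = e / 4" using c by simp
    finally have small: "\<bar>y - x\<bar> / r\<^sup>2 / a * u_L1nrm + \<bar>l\<bar> * \<bar>y - x\<bar> * u_L1nrm \<le> e / 4" .
    have eq: "jost_op (of_real l) ?E m y - jost_op (of_real l) ?E m x = (rest ?E m y - rest ?E m x) + \<i> * (?P y - ?P x)"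
      by (simp add: jost_op_def algebra_simps)
    have "\<bar>y - x\<bar> < d1" using y by (simp add: d_def)
    note parts = rest_diff_le[OF m(1) m' a l(1) r(1), of y x] phase_int_diff_le[OF m(1) m', of l y x] d1(2)[OF this]
    have "cmod (jost_op (of_real l) ?E m y - jost_op (of_real l) ?E m x) \<le> cmod (rest ?E m y - rest ?E m x) + cmod (?P y - ?P x)"
      unfolding eq by (rule order_trans[OF norm_triangle_ineq]) (simp add: norm_mult)
    with parts r(2) small e show "cmod (jost_op (of_real l) ?E m y - jost_op (of_real l) ?E m x) \<le> e"
      by linarith
  qed
qed

text \<open>Compactness: bounded solutions at convergent spectral parameters have a pointwise
  convergent subsequence, and its limit solves the limit equation.\<close>

lemma jost_compactness:
  fixes ls :: "nat \<Rightarrow> real" and c :: "nat \<Rightarrow> complex"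
  assumes l: "0 < l" and ls: "ls \<longlonglongrightarrow> l" and a: "0 < a" "\<And>n. a \<le> ls n" "\<And>n. ls n \<le> b"
    and f: "\<And>n. f n \<in> borel_measurable borel" "\<And>n x. cmod (f n x) \<le> 1" and c: "c \<longlonglongrightarrow> c0"
    and eq: "\<And>n x. f n x = c n + jost_op (of_real (ls n)) (edge_kernel (of_real (ls n))) (f n) x"
  obtains r g where "strict_mono (r :: nat \<Rightarrow> nat)" "\<And>x. (\<lambda>n. f (r n) x) \<longlonglongrightarrow> g x"
    "g \<in> borel_measurable borel" "\<And>x. cmod (g x) \<le> 1"
    "\<And>x. g x = c0 + jost_op (of_real l) (edge_kernel (of_real l)) g x"
proof -
  \<comment> \<open>Diagonal selection on the rationals; equicontinuity carries the convergence to
    every x.\<close>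
  obtain r where r: "strict_mono (r :: nat \<Rightarrow> nat)" "\<And>x. x \<in> \<rat> \<Longrightarrow> \<exists>l. (\<lambda>n. f (r n) x) \<longlonglongrightarrow> l"
    using function_convergent_subsequence[of "\<rat> :: real set" f 1] countable_rat f(2) by auto
  have cr: "(\<lambda>n. c (r n)) \<longlonglongrightarrow> c0" and lr: "(\<lambda>n. ls (r n)) \<longlonglongrightarrow> l"
    using LIMSEQ_subseq_LIMSEQ[OF c r(1)] LIMSEQ_subseq_LIMSEQ[OF ls r(1)] by (auto simp: o_def)
  have "Cauchy (\<lambda>n. f (r n) x)" for x
  proof (rule metric_CauchyI)
    fix e :: real assume e: "0 < e"
    then have "0 < e / 6" by simp
    from jost_op_equicontinuous[OF a(1) this, of b x] obtain d where d: "0 < d"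
      "\<And>l m y. a \<le> l \<Longrightarrow> l \<le> b \<Longrightarrow> m \<in> borel_measurable borel \<Longrightarrow> \<forall>x. cmod (m x) \<le> 1 \<Longrightarrow> \<bar>y - x\<bar> < d \<Longrightarrow>
        cmod (jost_op (of_real l) (edge_kernel (of_real l)) m y - jost_op (of_real l) (edge_kernel (of_real l)) m x) \<le> e / 6"
      by blast
    obtain q where q: "q \<in> \<rat>" "x < q" "q < x + d"
      using Rats_dense_in_real[of x "x + d"] d(1) by auto
    \<comment> \<open>The inhomogeneity c n does not depend on the point, so it drops out of the
      difference and equicontinuity of the operator suffices.\<close>
    have near: "cmod (f n q - f n x) \<le> e / 6" for n
      unfolding arg_cong2[where f="(-)", OF eq[of n q] eq[of n x]] add_diff_cancel_left
      by (rule d(2)[OF a(2)[of n] a(3)[of n] f(1)[of n]]) (use f(2) q in auto)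
    have "Cauchy (\<lambda>n. f (r n) q)"
      using r(2)[OF q(1)] LIMSEQ_imp_Cauchy by blast
    then obtain N where N: "\<And>m n. N \<le> m \<Longrightarrow> N \<le> n \<Longrightarrow> dist (f (r m) q) (f (r n) q) < e / 6"
      using \<open>0 < e / 6\<close> unfolding Cauchy_def by blast
    show "\<exists>M. \<forall>m\<ge>M. \<forall>n\<ge>M. dist (f (r m) x) (f (r n) x) < e"
    proof (intro exI[of _ N] allI impI)
      fix m n assume "N \<le> m" "N \<le> n"
      then have "cmod (f (r m) q - f (r n) q) < e / 6" using N by (simp add: dist_norm)
      moreover have "f (r m) x - f (r n) x = (f (r m) q - f (r n) q) - (f (r m) q - f (r m) x) + (f (r n) q - f (r n) x)"
        by simp
      then have "cmod (f (r m) x - f (r n) x) \<le> cmod (f (r m) q - f (r n) q) + cmod (f (r m) q - f (r m) x) + cmod (f (r n) q - f (r n) x)"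
        by (simp only:) (rule order_trans[OF norm_triangle_ineq add_right_mono[OF norm_triangle_ineq4]])
      ultimately show "dist (f (r m) x) (f (r n) x) < e"
        using near[of "r m"] near[of "r n"] e by (simp add: dist_norm)
    qed
  qed
  then have "\<exists>l. (\<lambda>n. f (r n) x) \<longlonglongrightarrow> l" for x
    using Cauchy_convergent convergent_def by blast
  then obtain g where g: "\<And>x. (\<lambda>n. f (r n) x) \<longlonglongrightarrow> g x" by metis
  show ?thesis
  proof (rule that[OF r(1) g])
    show "g \<in> borel_measurable borel"
      by (rule borel_measurable_LIMSEQ_metric[OF f(1) g])
    show "cmod (g x) \<le> 1" for x
      by (rule tendsto_upperbound[OF tendsto_norm[OF g]]) (auto simp: f)
    show "g x = c0 + jost_op (of_real l) (edge_kernel (of_real l)) g x" for x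
    proof (rule LIMSEQ_unique[OF g])
      show "(\<lambda>n. f (r n) x) \<longlonglongrightarrow> c0 + jost_op (of_real l) (edge_kernel (of_real l)) g x"
      proof (rule Lim_transform_eventually)
        show "(\<lambda>n. c (r n) + jost_op (of_real (ls (r n))) (edge_kernel (of_real (ls (r n)))) (f (r n)) x)
          \<longlonglongrightarrow> c0 + jost_op (of_real l) (edge_kernel (of_real l)) g x"
          by (rule tendsto_add[OF cr jost_op_tendsto[OF l lr a(2) a(1) f g]])
        show "\<forall>\<^sub>F n in sequentially. c (r n) + jost_op (of_real (ls (r n))) (edge_kernel (of_real (ls (r n)))) (f (r n)) x = f (r n) x"
          by (rule always_eventually) (rule allI, rule eq[symmetric])
      qed
    qed
  qed
qed

end

text \<open>The solutions are given one l at a time, so not even measurability in l is available at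
  the outset. Triviality of the homogeneous equation is the source of all regularity in l.\<close>

locale edge_family = potential +
  fixes m :: "real \<Rightarrow> real \<Rightarrow> complex"
  assumes sol: "\<And>l. 0 < l \<Longrightarrow> jost_eq (of_real l) (edge_kernel (of_real l)) (\<lambda>_. 1) (m l)"
    and uniq: "\<And>l n. 0 < l \<Longrightarrow> jost_eq (of_real l) (edge_kernel (of_real l)) (\<lambda>_. 0) n \<Longrightarrow> AE x in lborel. n x = 0"
begin

abbreviation J :: "real \<Rightarrow> (real \<Rightarrow> complex) \<Rightarrow> real \<Rightarrow> complex"
  where "J l \<equiv> jost_op (of_real l) (edge_kernel (of_real l))"

lemma sol_measurable: "0 < l \<Longrightarrow> m l \<in> borel_measurable borel"
  and sol_bounded: "0 < l \<Longrightarrow> \<exists>C. \<forall>x. cmod (m l x) \<le> C"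
  and sol_eq: "0 < l \<Longrightarrow> m l x = 1 + J l (m l) x"
proof -
  assume l: "0 < l"
  show "m l \<in> borel_measurable borel" "m l x = 1 + J l (m l) x"
    using sol[OF l] unfolding jost_eq_iff by blast+
  have "bounded (range (m l))"
    using sol[OF l] unfolding jost_eq_iff by blast
  then show "\<exists>C. \<forall>x. cmod (m l x) \<le> C"
    unfolding bounded_iff by blast
qed

text \<open>Uniqueness gives 0 almost everywhere. The operator does not see null sets, so the
  equation itself upgrades this to every point.\<close>

lemma homogeneous_zero:
  assumes l: "0 < l" and g: "g \<in> borel_measurable borel" "\<And>x. cmod (g x) \<le> C" and eq: "\<And>x. g x = J l g x"
  shows "g x = 0"
proof -
  have "bounded (range g)"
    using g(2) unfolding bounded_iff by blast
  then have "jost_eq (of_real l) (edge_kernel (of_real l)) (\<lambda>_. 0) g"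
    unfolding jost_eq_iff using g(1) eq by simp
  then have ae: "AE x in lborel. g x = 0"
    by (rule uniq[OF l])
  have "J l g x = 0"
    unfolding jost_op_def rest_def phase_int_def set_lebesgue_integral_def
    by (subst (1 2) integral_eq_zero_AE) (use ae in \<open>auto elim!: eventually_mono\<close>)
  then show ?thesis using eq[of x] by simp
qed

lemma J_scale:
  assumes l: "0 < l" and g: "g \<in> borel_measurable borel" "\<And>x. cmod (g x) \<le> C"
  shows "J l (\<lambda>x. s * g x) x = s * J l g x"
  using jost_op_combine[OF _ edge_kernel_L2(1)[OF l] g g, of "of_real l" s 0 x] by simp

lemma scaled_solution:
  assumes l: "0 < l"
  shows "s * m l x = s + J l (\<lambda>x. s * m l x) x"
proof -
  obtain C where "\<And>x. cmod (m l x) \<le> C" using sol_bounded[OF l] by blast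
  from J_scale[OF l sol_measurable[OF l] this, of s x] show ?thesis
    using sol_eq[OF l, of x] by (metis distrib_left mult.right_neutral)
qed

lemma spectral_sequence:
  fixes l :: real
  assumes l: "0 < l" and P: "\<And>d n. 0 < d \<Longrightarrow> \<exists>l'. \<bar>l' - l\<bar> < d \<and> P (n :: nat) l'"
  obtains ls where "ls \<longlonglongrightarrow> l" "\<And>n. l / 2 \<le> ls n" "\<And>n. ls n \<le> 2 * l" "\<And>n. 0 < ls n" "\<And>n. P n (ls n)"
proof -
  have "\<exists>l'. \<bar>l' - l\<bar> < min (l / 2) (1 / real (Suc n)) \<and> P n l'" for n
    using l by (intro P) simp
  then obtain ls where ls: "\<And>n. \<bar>ls n - l\<bar> < min (l / 2) (1 / real (Suc n))" "\<And>n. P n (ls n)"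
    by metis
  show ?thesis
  proof (rule that[of ls])
    show "ls \<longlonglongrightarrow> l"
    proof (rule LIM_zero_cancel, rule Lim_null_comparison)
      show "\<forall>\<^sub>F n in sequentially. norm (ls n - l) \<le> 1 / real (Suc n)"
        using ls(1) by (intro always_eventually allI) (simp add: less_imp_le)
      show "(\<lambda>n. 1 / real (Suc n)) \<longlonglongrightarrow> 0"
        by (rule LIMSEQ_Suc[OF lim_1_over_n])
    qed
    fix n
    have "\<bar>ls n - l\<bar> < l / 2" using ls(1)[of n] by simp
    then show "l / 2 \<le> ls n" "ls n \<le> 2 * l" "0 < ls n" using l by linarith+
  qed (rule ls(2))
qed

lemma u_mult_tendsto_zero:
  assumes f: "\<And>n. f n \<in> borel_measurable borel" "\<And>n x. cmod (f n x) \<le> 1" and lim: "\<And>x. (\<lambda>n. f n x) \<longlonglongrightarrow> 0"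
  shows "(\<lambda>n. LINT y|lborel. cmod (of_real (u y) * f n y)) \<longlonglongrightarrow> 0"
    and "(\<lambda>n. L2_nrm (\<lambda>y. of_real (u y) * f n y)) \<longlonglongrightarrow> 0"
proof -
  note [measurable] = f(1)
  have le: "\<bar>u x\<bar> * cmod (f n x) \<le> \<bar>u x\<bar>" for n x
    using mult_left_mono[OF f(2)[of n x], of "\<bar>u x\<bar>"] by simp
  have "(\<lambda>n. LINT y|lborel. cmod (of_real (u y) * f n y)) \<longlonglongrightarrow> (LINT y|(lborel::real measure). 0)"
  proof (rule integral_dominated_convergence)
    show "integrable lborel (\<lambda>y. \<bar>u y\<bar>)" using u_int by simp
    show "AE x in lborel. (\<lambda>n. cmod (of_real (u x) * f n x)) \<longlonglongrightarrow> 0"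
    proof (intro AE_I2 tendsto_norm_zero)
      show "(\<lambda>n. of_real (u x) * f n x) \<longlonglongrightarrow> 0" for x
        using tendsto_mult[OF tendsto_const lim, of "of_real (u x)" x] by simp
    qed
    show "AE x in lborel. norm (cmod (of_real (u x) * f n x)) \<le> \<bar>u x\<bar>" for n
      using le by (intro AE_I2) (simp add: norm_mult)
  qed measurable
  then show "(\<lambda>n. LINT y|lborel. cmod (of_real (u y) * f n y)) \<longlonglongrightarrow> 0" by simp
  have "(\<lambda>n. LINT y|lborel. (cmod (of_real (u y) * f n y))\<^sup>2) \<longlonglongrightarrow> (LINT y|(lborel::real measure). 0)"
  proof (rule integral_dominated_convergence)
    show "integrable lborel (\<lambda>y. (u y)\<^sup>2)" using u_L2 by (simp add: in_L2_def)
    show "AE x in lborel. (\<lambda>n. (cmod (of_real (u x) * f n x))\<^sup>2) \<longlonglongrightarrow> 0"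
    proof (rule AE_I2)
      fix x
      have "(\<lambda>n. (cmod (of_real (u x) * f n x))\<^sup>2) \<longlonglongrightarrow> (cmod (of_real (u x) * 0))\<^sup>2"
        by (intro tendsto_intros lim)
      then show "(\<lambda>n. (cmod (of_real (u x) * f n x))\<^sup>2) \<longlonglongrightarrow> 0" by simp
    qed
    show "AE x in lborel. norm ((cmod (of_real (u x) * f n x))\<^sup>2) \<le> (u x)\<^sup>2" for n
    proof (rule AE_I2)
      fix x
      show "norm ((cmod (of_real (u x) * f n x))\<^sup>2) \<le> (u x)\<^sup>2"
        using power_mono[OF le[of x n], of 2] by (simp add: norm_mult)
    qed
  qed measurable
  from tendsto_real_sqrt[OF this] show "(\<lambda>n. L2_nrm (\<lambda>y. of_real (u y) * f n y)) \<longlonglongrightarrow> 0"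
    by (simp add: L2_nrm_def)
qed

text \<open>If the suprema N n blew up, the solutions divided by N n would have supremum 1 and
  inhomogeneity tending to 0. A subsequence converges pointwise to a solution of the homogeneous
  equation, which is 0; then u times these functions tends to 0 in L1 and L2, and the equation
  bounds one of them by 1/2 everywhere, a contradiction.\<close>

lemma locally_bounded:
  assumes l: "0 < l"
  shows "\<exists>d>0. \<exists>C. \<forall>l'. \<bar>l' - l\<bar> < d \<longrightarrow> (\<forall>x. cmod (m l' x) \<le> C)"
proof (rule ccontr)
  assume neg: "\<not> ?thesis"
  have "\<exists>l'. \<bar>l' - l\<bar> < d \<and> (\<exists>x. real (Suc n) < cmod (m l' x))" if "0 < d" for d n
    using neg that by (meson not_le)
  then obtain ls where ls: "ls \<longlonglongrightarrow> l" "\<And>n. l / 2 \<le> ls n" "\<And>n. ls n \<le> 2 * l" "\<And>n. 0 < ls n"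
    and big: "\<And>n. \<exists>x. real (Suc n) < cmod (m (ls n) x)"
    by (rule spectral_sequence[OF l, where P="\<lambda>n l'. \<exists>x. real (Suc n) < cmod (m l' x)"]) (assumption, rule that)
  define N where "N n = (SUP x. cmod (m (ls n) x))" for n
  have bdd: "bdd_above (range (\<lambda>x. cmod (m (ls n) x)))" for n
    using sol_bounded[OF ls(4)[of n]] by (auto intro: bdd_aboveI2)
  have le_N: "cmod (m (ls n) x) \<le> N n" for n x
    unfolding N_def by (rule cSUP_upper[OF _ bdd]) simp
  have N_gt: "real (Suc n) < N n" for n
    using big[of n] le_N[of n] by (meson order_less_le_trans)
  have N0: "0 < N n" for n
    using N_gt[of n] by (simp add: less_trans[of 0 "real (Suc n)"])
  define c where "c n = complex_of_real (1 / N n)" for n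
  define f where "f n x = c n * m (ls n) x" for n x
  have f_meas: "f n \<in> borel_measurable borel" for n
    unfolding f_def[abs_def] using sol_measurable[OF ls(4)[of n]] by simp
  have f_le: "cmod (f n x) \<le> 1" for n x
    using le_N[of n x] N0[of n] by (simp add: f_def c_def norm_mult norm_divide pos_divide_le_eq)
  have f_eq: "f n x = c n + J (ls n) (f n) x" for n x
    unfolding f_def[abs_def] by (rule scaled_solution[OF ls(4)])
  have c0: "c \<longlonglongrightarrow> 0"
  proof (rule Lim_null_comparison)
    show "\<forall>\<^sub>F n in sequentially. norm (c n) \<le> 1 / real (Suc n)"
    proof (intro always_eventually allI)
      fix n
      have "1 / N n \<le> 1 / real (Suc n)"
        using N_gt[of n] by (intro divide_left_mono) auto
      then show "norm (c n) \<le> 1 / real (Suc n)"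
        using N0[of n] by (simp add: c_def norm_divide)
    qed
    show "(\<lambda>n. 1 / real (Suc n)) \<longlonglongrightarrow> 0"
      by (rule LIMSEQ_Suc[OF lim_1_over_n])
  qed
  have l2: "0 < l / 2" using l by simp
  obtain r g where r: "strict_mono r" and fg: "\<And>x. (\<lambda>n. f (r n) x) \<longlonglongrightarrow> g x"
    and g: "g \<in> borel_measurable borel" "\<And>x. cmod (g x) \<le> 1" "\<And>x. g x = 0 + J l g x"
    by (rule jost_compactness[OF l ls(1) l2 ls(2,3) f_meas f_le c0 f_eq]) blast
  have g0: "g x = 0" for x
    by (rule homogeneous_zero[OF l g(1,2) g(3)[unfolded add_0]])
  have fr0: "(\<lambda>n. f (r n) x) \<longlonglongrightarrow> 0" for x
    using fg[of x] by (simp add: g0)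
  note small = u_mult_tendsto_zero[of "\<lambda>n. f (r n)", OF f_meas f_le fr0]
  define s where "s n = cmod (c (r n)) + (pi / sqrt (l / 2) * L2_nrm (\<lambda>y. of_real (u y) * f (r n) y) + (LINT y|lborel. cmod (of_real (u y) * f (r n) y)))" for n
  have "s \<longlonglongrightarrow> cmod 0 + (pi / sqrt (l / 2) * 0 + 0)"
    unfolding s_def[abs_def]
    by (intro tendsto_add tendsto_mult tendsto_const tendsto_norm small LIMSEQ_subseq_LIMSEQ[OF c0 r, unfolded o_def])
  then have "s \<longlonglongrightarrow> 0" by simp
  then obtain n where n: "s n < 1 / 2"
    using order_tendstoD(2)[of s 0 sequentially "1/2"] by (auto dest: eventually_happens)
  define k where "k = r n"
  have fk: "cmod (f k x) \<le> 1 / 2" for x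
  proof -
    have "L2_nrm (edge_kernel (of_real (ls k))) \<le> pi / sqrt (l / 2)"
      using edge_kernel_L2(2)[OF ls(4)[of k]] ls(2)[of k] l
      by (intro order_trans[OF edge_kernel_L2(2)[OF ls(4)] divide_left_mono]) auto
    then have "L2_nrm (edge_kernel (of_real (ls k))) * L2_nrm (\<lambda>y. of_real (u y) * f k y) \<le> pi / sqrt (l / 2) * L2_nrm (\<lambda>y. of_real (u y) * f k y)"
      by (rule mult_right_mono) simp
    moreover have "cmod (J (ls k) (f k) x) \<le> L2_nrm (edge_kernel (of_real (ls k))) * L2_nrm (\<lambda>y. of_real (u y) * f k y) + (LINT y|lborel. cmod (of_real (u y) * f k y))"
      by (rule jost_op_bound[OF _ edge_kernel_L2(1)[OF ls(4)] f_meas f_le]) simp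
    moreover have "cmod (f k x) \<le> cmod (c k) + cmod (J (ls k) (f k) x)"
      by (subst f_eq) (rule norm_triangle_ineq)
    ultimately show ?thesis
      using n unfolding s_def k_def[symmetric] by linarith
  qed
  have "cmod (m (ls k) x) \<le> N k / 2" for x
    using fk[of x] N0[of k] by (simp add: f_def c_def norm_mult norm_divide field_simps)
  then have "N k \<le> N k / 2"
    unfolding N_def[of k] by (intro cSUP_least) auto
  with N0[of k] show False by simp
qed

definition scattering_coeff :: "real \<Rightarrow> complex"
  where "scattering_coeff l = fourier (\<lambda>x. of_real (u x) * m l x) l"

text \<open>Along any sequence of parameters tending to l, a subsequence of the locally bounded
  solutions converges pointwise to a solution at l, which is \<open>m l\<close> by uniqueness.
  Dominated convergence moves the limit into the Fourier integral, which excludes a sequence with a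
  persistent gap e.\<close>

lemma scattering_coeff_isCont:
  assumes l: "0 < l"
  shows "isCont scattering_coeff l"
proof (rule ccontr)
  assume "\<not> isCont scattering_coeff l"
  then obtain e where e: "0 < e" and neg: "\<And>d. 0 < d \<Longrightarrow> \<exists>l'. \<bar>l' - l\<bar> < d \<and> e \<le> cmod (scattering_coeff l' - scattering_coeff l)"
    unfolding continuous_at_eps_delta dist_norm real_norm_def by (meson not_le)
  obtain d0 C where d0: "0 < d0" and C: "\<And>l' x. \<bar>l' - l\<bar> < d0 \<Longrightarrow> cmod (m l' x) \<le> C"
    using locally_bounded[OF l] by blast
  have "\<exists>l'. \<bar>l' - l\<bar> < d \<and> \<bar>l' - l\<bar> < d0 \<and> e \<le> cmod (scattering_coeff l' - scattering_coeff l)" if "0 < d" for d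
    using neg[of "min d d0"] that d0 by auto
  then obtain ls where ls: "ls \<longlonglongrightarrow> l" "\<And>n. l / 2 \<le> ls n" "\<And>n. ls n \<le> 2 * l" "\<And>n. 0 < ls n"
    and close: "\<And>n::nat. \<bar>ls n - l\<bar> < d0 \<and> e \<le> cmod (scattering_coeff (ls n) - scattering_coeff l)"
    by (rule spectral_sequence[OF l, where P="\<lambda>n l'. \<bar>l' - l\<bar> < d0 \<and> e \<le> cmod (scattering_coeff l' - scattering_coeff l)"]) (assumption, rule that)
  \<comment> \<open>The maximum with 1 makes the divisor positive; dividing by D brings the
    solutions into the unit ball used in the compactness argument.\<close>
  define D where "D = max C 1"
  have D: "0 < D" by (simp add: D_def)
  have mD: "cmod (m (ls n) x) \<le> D" for n x
    using C[of "ls n" x] close[of n] by (simp add: D_def)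
  define c where "c = complex_of_real (1 / D)"
  define f where "f n x = c * m (ls n) x" for n x
  have f_meas: "f n \<in> borel_measurable borel" for n
    unfolding f_def[abs_def] using sol_measurable[OF ls(4)[of n]] by simp
  have f_le: "cmod (f n x) \<le> 1" for n x
    using mD[of n x] D by (simp add: f_def c_def norm_mult norm_divide pos_divide_le_eq)
  have f_eq: "f n x = c + J (ls n) (f n) x" for n x
    unfolding f_def[abs_def] by (rule scaled_solution[OF ls(4)])
  have l2: "0 < l / 2" using l by simp
  obtain r g where r: "strict_mono r" and fg: "\<And>x. (\<lambda>n. f (r n) x) \<longlonglongrightarrow> g x"
    and g: "g \<in> borel_measurable borel" "\<And>x. cmod (g x) \<le> 1" "\<And>x. g x = c + J l g x"
    by (rule jost_compactness[OF l ls(1) l2 ls(2,3) f_meas f_le tendsto_const f_eq]) blast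
  obtain K where K: "\<And>x. cmod (m l x) \<le> K" using sol_bounded[OF l] by blast
  have "complex_of_real D * g x + (-1) * m l x = 0" for x
  proof (rule homogeneous_zero[OF l])
    show "(\<lambda>x. complex_of_real D * g x + (-1) * m l x) \<in> borel_measurable borel"
      using g(1) sol_measurable[OF l] by measurable
    show "cmod (complex_of_real D * g x + (-1) * m l x) \<le> D * 1 + 1 * K" for x
      using g(2)[of x] K[of x] D
      by (intro norm_triangle_mono) (auto simp: norm_mult mult_left_le)
    show "complex_of_real D * g x + (-1) * m l x = J l (\<lambda>x. complex_of_real D * g x + (-1) * m l x) x" for x
    proof -
      have "J l (\<lambda>x. complex_of_real D * g x + (-1) * m l x) x = complex_of_real D * J l g x + (-1) * J l (m l) x"
        by (rule jost_op_combine[OF _ edge_kernel_L2(1)[OF l] g(1,2) sol_measurable[OF l] K]) simp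
      moreover have "complex_of_real D * g x = 1 + complex_of_real D * J l g x"
        by (subst g(3)) (use D in \<open>simp add: c_def distrib_left\<close>)
      moreover have "(-1) * m l x = - 1 + (-1) * J l (m l) x"
        by (subst sol_eq[OF l]) simp
      ultimately show ?thesis by simp
    qed
  qed
  then have Dg: "complex_of_real D * g x = m l x" for x
    by simp
  have ml: "(\<lambda>n. m (ls (r n)) x) \<longlonglongrightarrow> m l x" for x
  proof -
    have "(\<lambda>n. complex_of_real D * f (r n) x) \<longlonglongrightarrow> complex_of_real D * g x"
      by (intro tendsto_mult tendsto_const fg)
    then show ?thesis
      using D by (simp add: Dg f_def c_def)
  qed
  have lr: "(\<lambda>n. ls (r n)) \<longlonglongrightarrow> l"
    using LIMSEQ_subseq_LIMSEQ[OF ls(1) r] by (simp add: o_def)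
  note meas [measurable] = sol_measurable[OF ls(4)] sol_measurable[OF l]
  have "(\<lambda>n. scattering_coeff (ls (r n))) \<longlonglongrightarrow> scattering_coeff l"
    unfolding scattering_coeff_def fourier_def
  proof (rule integral_dominated_convergence)
    show "integrable lborel (\<lambda>x. \<bar>u x\<bar> * D)" using u_int by simp
    show "AE x in lborel. (\<lambda>n. of_real (u x) * m (ls (r n)) x * exp (- (\<i> * of_real (ls (r n) * x)))) \<longlonglongrightarrow> of_real (u x) * m l x * exp (- (\<i> * of_real (l * x)))"
      by (intro AE_I2 tendsto_intros ml lr)
    show "AE x in lborel. norm (of_real (u x) * m (ls (r n)) x * exp (- (\<i> * of_real (ls (r n) * x)))) \<le> \<bar>u x\<bar> * D" for n
      using mD by (intro AE_I2) (auto simp: norm_mult norm_exp intro!: mult_left_mono)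
  qed measurable
  then have "(\<lambda>n. cmod (scattering_coeff (ls (r n)) - scattering_coeff l)) \<longlonglongrightarrow> cmod (scattering_coeff l - scattering_coeff l)"
    by (intro tendsto_intros)
  then have "e \<le> cmod (scattering_coeff l - scattering_coeff l)"
    by (rule tendsto_lowerbound) (use close in auto)
  with e show False by simp
qed

lemma scattering_coeff_bound_large:
  "\<exists>K\<ge>0. \<exists>R>0. \<forall>l\<ge>R. cmod (scattering_coeff l) \<le> cmod (fourier v l) + K / l"
proof (intro exI conjI allI impI)
  show "0 \<le> 2 * (1 + u_L1nrm) * (L2_nrm u)\<^sup>2"
    by (intro mult_nonneg_nonneg add_nonneg_nonneg) auto
  show "0 < max 1 smallness_threshold" by simp
  fix l assume "max 1 smallness_threshold \<le> l"
  then show "cmod (scattering_coeff l) \<le> cmod (fourier v l) + 2 * (1 + u_L1nrm) * (L2_nrm u)\<^sup>2 / l"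
    unfolding scattering_coeff_def by (intro beta_estimate sol) auto
qed

lemma scattering_coeff_tendsto: "(scattering_coeff \<longlongrightarrow> 0) at_top"
proof -
  obtain K R where KR: "0 < R" "\<And>l. R \<le> l \<Longrightarrow> cmod (scattering_coeff l) \<le> cmod (fourier v l) + K / l"
    using scattering_coeff_bound_large by blast
  show ?thesis
  proof (rule Lim_null_comparison)
    show "\<forall>\<^sub>F l in at_top. norm (scattering_coeff l) \<le> cmod (fourier v l) + K / l"
      using eventually_ge_at_top[of R] by eventually_elim (rule KR(2))
    have "((\<lambda>l. K / l) \<longlongrightarrow> 0) at_top" by real_asymp
    from tendsto_add[OF tendsto_norm[OF fourier_v_tendsto] this]
    show "((\<lambda>l. cmod (fourier v l) + K / l) \<longlongrightarrow> 0) at_top" by simp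
  qed
qed

text \<open>On [a, R] continuity gives boundedness; beyond R the coefficient is at most |fourier v
  l| + K / l, and both terms are square integrable there. Continuity also supplies
  measurability.\<close>

lemma scattering_coeff_L2:
  assumes a: "0 < a"
  shows "in_L2 (lebesgue_on {a<..}) scattering_coeff"
proof -
  obtain K R where KR: "0 \<le> K" "0 < R" "\<And>l. R \<le> l \<Longrightarrow> cmod (scattering_coeff l) \<le> cmod (fourier v l) + K / l"
    using scattering_coeff_bound_large by blast
  have cont: "continuous_on {a..b} scattering_coeff" for b
    using a by (intro continuous_at_imp_continuous_on ballI scattering_coeff_isCont) auto
  have cont': "continuous_on {a<..} scattering_coeff"
    using a by (intro continuous_at_imp_continuous_on ballI scattering_coeff_isCont) auto
  have meas: "scattering_coeff \<in> borel_measurable (lebesgue_on {a<..})"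
    using cont' by (intro continuous_imp_measurable_on_sets_lebesgue) auto
  have "bounded (scattering_coeff ` {a..R})"
    by (intro compact_imp_bounded compact_continuous_image cont) auto
  then obtain B where B: "\<And>l. l \<in> {a..R} \<Longrightarrow> cmod (scattering_coeff l) \<le> B"
    unfolding bounded_iff by (meson imageI)
  \<comment> \<open>For l > R one has 1 / l^2 <= (1 + 1 / R^2) / (1 + l^2), which reduces the tail
    to the integrability of 1 / (1 + l^2) over the whole line.\<close>
  define G where "G l = indicator {a..R} l * B\<^sup>2 + (2 * (cmod (fourier v l))\<^sup>2 + 2 * K\<^sup>2 * (1 + 1 / R\<^sup>2) * inverse (1 + l\<^sup>2))" for l
  have fv2: "integrable lborel (\<lambda>l. (cmod (fourier v l))\<^sup>2)"
    using Plancherel_bound(1)[OF v_integrable] integrable_vm(3)[of "\<lambda>_. 1" 1] by (simp add: in_L2_def)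
  have i1: "integrable lborel (\<lambda>l. indicator {a..R} l * B\<^sup>2)"
    by (intro integrable_mult_left) (simp add: integrable_indicator_iff emeasure_lborel_Icc_eq)
  have i2: "integrable lborel (\<lambda>l::real. inverse (1 + l\<^sup>2))"
    using integrable_inverse_1_plus_square by (simp add: set_integrable_def)
  have Gi: "integrable lborel G"
    unfolding G_def[abs_def] using fv2 i1 i2 by (intro Bochner_Integration.integrable_add integrable_mult_right)
  have le: "(cmod (scattering_coeff l))\<^sup>2 \<le> G l" if l: "a < l" for l
  proof (cases "l \<le> R")
    case True
    then have "(cmod (scattering_coeff l))\<^sup>2 \<le> B\<^sup>2"
      using l by (intro power_mono B) auto
    moreover have "0 \<le> 2 * (cmod (fourier v l))\<^sup>2 + 2 * K\<^sup>2 * (1 + 1 / R\<^sup>2) * inverse (1 + l\<^sup>2)"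
      by (intro add_nonneg_nonneg mult_nonneg_nonneg) auto
    moreover have "G l = B\<^sup>2 + (2 * (cmod (fourier v l))\<^sup>2 + 2 * K\<^sup>2 * (1 + 1 / R\<^sup>2) * inverse (1 + l\<^sup>2))"
      using True l by (simp add: G_def)
    ultimately show ?thesis
      by linarith
  next
    case False
    have "(cmod (scattering_coeff l))\<^sup>2 \<le> (cmod (fourier v l) + K / l)\<^sup>2"
      using False by (intro power_mono KR(3)) auto
    also have "\<dots> \<le> 2 * (cmod (fourier v l))\<^sup>2 + 2 * (K / l)\<^sup>2"
      using sum_squares_bound[of "cmod (fourier v l)" "K / l"] by (simp add: power2_sum)
    also have "(K / l)\<^sup>2 \<le> K\<^sup>2 * ((1 + 1 / R\<^sup>2) * inverse (1 + l\<^sup>2))"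
    proof -
      have "R\<^sup>2 \<le> l\<^sup>2" using False KR(2) by (intro power_mono) auto
      then have "l\<^sup>2 / R\<^sup>2 \<ge> 1" using KR(2) by simp
      then have "1 + l\<^sup>2 \<le> l\<^sup>2 * (1 + 1 / R\<^sup>2)" by (simp add: distrib_left)
      moreover have pos: "0 < 1 + l\<^sup>2" "0 < l\<^sup>2" using False KR(2) by (auto simp: add_pos_nonneg)
      ultimately have "(1 + l\<^sup>2) / l\<^sup>2 \<le> 1 + 1 / R\<^sup>2"
        by (simp only: pos_divide_le_eq mult.commute)
      from divide_right_mono[OF this less_imp_le[OF pos(1)]]
      have "1 / l\<^sup>2 \<le> (1 + 1 / R\<^sup>2) / (1 + l\<^sup>2)"
        using pos by simp
      then show ?thesis
        unfolding power_divide by (metis divide_inverse mult_left_mono zero_le_power2 times_divide_eq_right mult.right_neutral)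
    qed
    finally show ?thesis
      using False by (simp add: G_def mult.assoc)
  qed
  have "integrable lebesgue (\<lambda>l. indicator {a<..} l *\<^sub>R G l)"
    using Gi by (intro integrable_mult_indicator) (auto simp: integrable_completion borel_measurable_integrable)
  then have GL: "integrable (lebesgue_on {a<..}) G"
    by (simp add: integrable_restrict_space)
  have "integrable (lebesgue_on {a<..}) (\<lambda>l. (cmod (scattering_coeff l))\<^sup>2)"
  proof (rule Bochner_Integration.integrable_bound[OF GL])
    show "(\<lambda>l. (cmod (scattering_coeff l))\<^sup>2) \<in> borel_measurable (lebesgue_on {a<..})"
      using meas by measurable
    show "AE l in lebesgue_on {a<..}. norm ((cmod (scattering_coeff l))\<^sup>2) \<le> norm (G l)"
    proof (rule AE_I2)
      fix l assume "l \<in> space (lebesgue_on {a<..})"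
      then have "a < l" by simp
      from le[OF this] show "norm ((cmod (scattering_coeff l))\<^sup>2) \<le> norm (G l)" by simp
    qed
  qed
  with meas show ?thesis by (simp add: in_L2_def)
qed

end

section \<open>The kernels on the cut plane\<close>

text \<open>Off a null set every kernel is, up to reflection and conjugation, of one of two shapes: a wave on a half
  line plus a small square integrable error, or a small error alone (away from the cut).\<close>

definition half_kernel :: "real \<Rightarrow> (real \<Rightarrow> complex) \<Rightarrow> bool"
  where "half_kernel \<kappa> K \<longleftrightarrow> (\<exists>k E. 0 \<le> Im k \<and> cmod k = \<kappa> \<and> in_L2 lborel E \<and> L2_nrm E \<le> 6 / sqrt \<kappa> \<and>
    (K = (\<lambda>x. \<i> * exp (\<i> * k * of_real x) * indicator {0<..} x + E x) \<or> K = E))"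

text \<open>Origin of the constant 6 in \<open>half_kernel\<close>: the decay rate is at least a
  third of |k| for every kernel in question, and pi sqrt 3 < 6.\<close>

lemma pi_div_sqrt_le:
  assumes "0 < \<mu>" "0 < \<kappa>" "\<kappa> \<le> 3 * \<mu>"
  shows "pi / sqrt \<mu> \<le> 6 / sqrt \<kappa>"
proof -
  have "pi * sqrt \<kappa> \<le> 3.2 * (sqrt 3 * sqrt \<mu>)"
    using assms pi_less_4 pi_approx(2) by (intro mult_mono) (auto simp flip: real_sqrt_mult)
  also have "\<dots> \<le> 6 * sqrt \<mu>"
  proof -
    have "sqrt 3 \<le> 1.8" by (rule real_le_lsqrt) (auto simp: power2_eq_square)
    then have "3.2 * sqrt 3 \<le> 6" by simp
    from mult_right_mono[OF this, of "sqrt \<mu>"] show ?thesis using assms by simp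
  qed
  finally show ?thesis
    using assms by (simp add: pos_divide_le_eq pos_le_divide_eq mult.commute)
qed

lemma edge_kernel_cnj: "edge_kernel (of_real l) x = cnj (edge_kernel (of_real l) (- x))"
proof (cases "x = 0")
  case False
  have "cnj (LINT t:{0<..}|lborel. of_real (exp (- (t * l))) / (of_real t + \<i> * of_real (- x)))
    = (LINT t:{0<..}|lborel. of_real (exp (- (t * l))) / (of_real t + \<i> * of_real x))"
    unfolding set_lebesgue_integral_def by (simp flip: Bochner_Integration.integral_cnj)
  then show ?thesis
    using False by (simp add: edge_kernel_alt)
qed (simp add: edge_kernel_def)

lemma half_kernel_edge:
  assumes "0 < Re k" "0 \<le> Im k" "cmod k \<le> 3 * Re k"
  shows "half_kernel (cmod k) (\<lambda>x. \<i> * exp (\<i> * k * of_real x) * indicator {0<..} x + edge_kernel k x)"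
proof -
  have L: "in_L2 lborel (edge_kernel k)" "L2_nrm (edge_kernel k) \<le> pi / sqrt (Re k)"
    using laplace_dominated_L2[OF assms(1) edge_kernel_measurable edge_kernel_bound[OF assms(1)]] by auto
  moreover have "0 < cmod k"
    using assms(1) by auto
  then have "L2_nrm (edge_kernel k) \<le> 6 / sqrt (cmod k)"
    using L(2) pi_div_sqrt_le[OF assms(1) _ assms(3)] by simp
  ultimately show ?thesis
    unfolding half_kernel_def using assms(2) by blast
qed

lemma half_kernel_far:
  assumes k: "Re k < Im k" "0 \<le> Im k" "cmod k \<le> 3 * (Im k - Re k)"
  shows "half_kernel (cmod k) (far_kernel k)"
proof -
  have \<mu>: "0 < Im k - Re k" using k(1) by simp
  have L: "in_L2 lborel (far_kernel k)" "L2_nrm (far_kernel k) \<le> pi / sqrt (Im k - Re k)"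
    using laplace_dominated_L2[OF \<mu> far_kernel_measurable far_kernel_bound[OF k(1)]] by auto
  moreover have "0 < cmod k"
    using k(1) by auto
  then have "L2_nrm (far_kernel k) \<le> 6 / sqrt (cmod k)"
    using L(2) pi_div_sqrt_le[OF \<mu> _ k(3)] by simp
  ultimately show ?thesis
    unfolding half_kernel_def using k(2) by blast
qed

text \<open>The upper half plane is divided along Im k = 2 Re k. To the right of this line the wave
  is split off and the rate is Re k; elsewhere the ray 1 + \<i> is admissible with rate Im k - Re k.
  As |k| <= |Re k| + |Im k|, both rates are at least |k| / 3, so the bound is uniform over all
  directions.\<close>

lemma G_off_upper:
  assumes k: "0 \<le> Im k" "k \<notin> complex_of_real ` {0..}"
  shows "\<exists>K. half_kernel (cmod k) K \<and> (\<forall>x. x \<noteq> 0 \<longrightarrow> (half_line_integral k x \<longlongrightarrow> 2 * of_real pi * K x) at_top)"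
proof (cases "Im k / 2 < Re k")
  case True
  then have "0 < Re k" using k(1) by simp
  moreover have "Im k \<noteq> 0"
  proof
    assume "Im k = 0"
    then have "k = complex_of_real (Re k)" by (simp add: complex_eq_iff)
    with k(2) \<open>0 < Re k\<close> show False by (metis atLeast_iff image_eqI less_imp_le)
  qed
  moreover have "cmod k \<le> 3 * Re k"
    using cmod_le[of k] True k(1) \<open>0 < Re k\<close> by simp
  ultimately show ?thesis
    using k(1)
    by (intro exI[of _ "\<lambda>x. \<i> * exp (\<i> * k * of_real x) * indicator {0<..} x + edge_kernel k x"]
        conjI half_kernel_edge allI impI G_off_edge_tendsto) auto
next
  case False
  have "Im k = 0 \<Longrightarrow> Re k < 0"
  proof (rule ccontr)
    assume "Im k = 0" "\<not> Re k < 0"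
    then have "k = complex_of_real (Re k)" by (simp add: complex_eq_iff)
    with k(2) \<open>\<not> Re k < 0\<close> show False by (metis atLeast_iff image_eqI not_less)
  qed
  then have "Re k < Im k" using False k(1) by (cases "Im k = 0") auto
  moreover have "cmod k \<le> 3 * (Im k - Re k)"
    using cmod_le[of k] False k(1) \<open>Re k < Im k\<close> by (cases "Re k < 0") auto
  ultimately show ?thesis
    using k(1) by (intro exI[of _ "far_kernel k"] conjI half_kernel_far allI impI G_off_far_tendsto) auto
qed

text \<open>Conjugating the half line integral replaces k by its conjugate and x by - x. The lower
  half plane and the lower edge thus have the conjugated and reflected shapes of the upper
  ones.\<close>

lemma G_kernel_half_kernel:
  assumes p: "p \<in> cut_plane"
  shows "\<exists>K. half_kernel (cut_abs p) K \<and>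
    ((\<forall>x. x \<noteq> 0 \<longrightarrow> G_kernel p x = K x) \<or> (\<forall>x. x \<noteq> 0 \<longrightarrow> G_kernel p x = cnj (K (- x))))"
proof (cases p)
  case (Interior k)
  then have k: "k \<notin> complex_of_real ` {0..}"
    using p by (auto simp: cut_plane_def)
  show ?thesis
  proof (cases "0 \<le> Im k")
    case True
    from G_off_upper[OF True k] obtain K where K: "half_kernel (cmod k) K"
      "\<And>x. x \<noteq> 0 \<Longrightarrow> (half_line_integral k x \<longlongrightarrow> 2 * of_real pi * K x) at_top" by blast
    have "G_kernel p x = K x" if "x \<noteq> 0" for x
      using G_off_eqI[OF K(2)[OF that]] by (simp add: Interior)
    then show ?thesis using K(1) Interior by auto
  next
    case False
    have "cnj k \<notin> complex_of_real ` {0..}"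
      using k by (metis (no_types, lifting) complex_cnj_cnj complex_cnj_complex_of_real imageE image_eqI)
    from G_off_upper[OF _ this] False obtain K where K: "half_kernel (cmod k) K"
      "\<And>x. x \<noteq> 0 \<Longrightarrow> (half_line_integral (cnj k) x \<longlongrightarrow> 2 * of_real pi * K x) at_top" by auto
    have "G_kernel p x = cnj (K (- x))" if x: "x \<noteq> 0" for x
    proof -
      have "half_line_integral k x = (\<lambda>R. cnj (half_line_integral (cnj k) (- x) R))"
        using half_line_integral_cnj[of "cnj k" x] by auto
      moreover have "((\<lambda>R. cnj (half_line_integral (cnj k) (- x) R)) \<longlongrightarrow> cnj (2 * of_real pi * K (- x))) at_top"
        using x by (intro tendsto_cnj K(2)) simp
      ultimately have "(half_line_integral k x \<longlongrightarrow> 2 * of_real pi * cnj (K (- x))) at_top"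
        by simp
      from G_off_eqI[OF this] show ?thesis by (simp add: Interior)
    qed
    then show ?thesis using K(1) Interior by auto
  qed
next
  case (Upper l)
  then have l: "0 < l" using p by (auto simp: cut_plane_def)
  have "half_kernel (cmod (of_real l)) (\<lambda>x. \<i> * exp (\<i> * of_real l * of_real x) * indicator {0<..} x + edge_kernel (of_real l) x)"
    using l by (intro half_kernel_edge) auto
  moreover have "G_kernel p x = \<i> * exp (\<i> * of_real l * of_real x) * indicator {0<..} x + edge_kernel (of_real l) x" if "x \<noteq> 0" for x
    using G_tilde_eq[OF l that] by (simp add: Upper mult.assoc)
  ultimately show ?thesis
    unfolding Upper by auto
next
  case (Lower l)
  then have l: "0 < l" using p by (auto simp: cut_plane_def)
  let ?K = "\<lambda>x. \<i> * exp (\<i> * of_real l * of_real x) * indicator {0<..} x + edge_kernel (of_real l) x"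
  have "half_kernel (cmod (of_real l)) ?K"
    using l by (intro half_kernel_edge) auto
  moreover have "G_kernel p x = cnj (?K (- x))" if "x \<noteq> 0" for x
  proof -
    have "indicator {..<0} x = (indicator {0<..} (- x) :: complex)"
      by (auto simp: indicator_def)
    then show ?thesis
      using G_tilde_eq[OF l that] edge_kernel_cnj[of l x]
      by (simp add: Lower exp_cnj mult.assoc indicator_def)
  qed
  ultimately show ?thesis
    unfolding Lower by auto
qed

lemma half_kernel_measurable: "half_kernel \<kappa> K \<Longrightarrow> K \<in> borel_measurable borel"
proof -
  assume "half_kernel \<kappa> K"
  then obtain k E where E: "in_L2 lborel E" and K: "K = (\<lambda>x. \<i> * exp (\<i> * k * of_real x) * indicator {0<..} x + E x) \<or> K = E"
    unfolding half_kernel_def by blast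
  have [measurable]: "E \<in> borel_measurable borel" using E by (simp add: in_L2_def)
  have "(\<lambda>x. \<i> * exp (\<i> * k * of_real x) * indicator {0<..} x + E x) \<in> borel_measurable borel"
    by measurable
  with K show ?thesis by auto
qed

lemma half_kernel_split:
  assumes "half_kernel \<kappa> K"
  obtains E where "in_L2 lborel E" "\<And>x. cmod (K x) \<le> 1 + cmod (E x)"
proof -
  from assms obtain k E where k: "0 \<le> Im k" and E: "in_L2 lborel E"
    and K: "K = (\<lambda>x. \<i> * exp (\<i> * k * of_real x) * indicator {0<..} x + E x) \<or> K = E"
    unfolding half_kernel_def by blast
  have "cmod (\<i> * exp (\<i> * k * of_real x) * indicator {0<..} x + E x) \<le> 1 + cmod (E x)" for x
  proof (rule order_trans[OF norm_triangle_ineq add_right_mono])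
    show "cmod (\<i> * exp (\<i> * k * of_real x) * indicator {0<..} x) \<le> 1"
      using norm_exp_phase_le[OF k, of 0 x] by (simp add: norm_mult indicator_def)
  qed
  with K have "cmod (K x) \<le> 1 + cmod (E x)" for x by auto
  with E that show thesis by blast
qed

context potential
begin

section \<open>Jost equations with a general kernel\<close>

definition conv :: "(real \<Rightarrow> complex) \<Rightarrow> (real \<Rightarrow> complex) \<Rightarrow> real \<Rightarrow> complex"
  where "conv K m x = (LINT y|lborel. K (x - y) * (of_real (u y) * m y))"

definition borel_sol :: "(real \<Rightarrow> complex) \<Rightarrow> (real \<Rightarrow> complex) \<Rightarrow> (real \<Rightarrow> complex) \<Rightarrow> bool"
  where "borel_sol K h m \<longleftrightarrow> m \<in> borel_measurable borel \<and> bounded (range m) \<and> (\<forall>x. m x = h x + conv K m x)"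

text \<open>The kernel contains the indicator of x - y > 0, the phase integral that of y <= x; they
  differ at the single point y = x.\<close>

lemma conv_wave:
  assumes k: "0 \<le> Im k" and E: "in_L2 lborel E" and m: "m \<in> borel_measurable borel" "\<And>x. cmod (m x) \<le> C"
  shows "conv (\<lambda>x. \<i> * exp (\<i> * k * of_real x) * indicator {0<..} x + E x) m x = jost_op k E m x"
proof -
  note um = integrable_um[OF m]
  note [measurable] = m(1)
  have [measurable]: "E \<in> borel_measurable borel" using E by (simp add: in_L2_def)
  define w where "w y = indicator {..x} y *\<^sub>R (exp (\<i> * k * of_real (x - y)) * (of_real (u y) * m y))" for y
  have wi: "integrable lborel w"
    using phase_int_integrable[OF um(1) k, of x] by (simp add: set_integrable_def w_def[abs_def])
  have ei: "integrable lborel (\<lambda>y. E (x - y) * (of_real (u y) * m y))"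
    by (rule integral_convolution_bound(1)[OF E um(3)])
  have "conv (\<lambda>x. \<i> * exp (\<i> * k * of_real x) * indicator {0<..} x + E x) m x
    = (LINT y|lborel. \<i> * w y + E (x - y) * (of_real (u y) * m y))"
    unfolding conv_def
  proof (rule integral_cong_AE)
    show "AE y in lborel. (\<i> * exp (\<i> * k * of_real (x - y)) * indicator {0<..} (x - y) + E (x - y)) * (of_real (u y) * m y)
       = \<i> * w y + E (x - y) * (of_real (u y) * m y)"
      using AE_lborel_singleton[of x] by eventually_elim (auto simp: w_def indicator_def algebra_simps)
  qed (unfold w_def, measurable)
  also have "\<dots> = (LINT y|lborel. \<i> * w y) + (LINT y|lborel. E (x - y) * (of_real (u y) * m y))"
    by (intro Bochner_Integration.integral_add integrable_mult_right wi ei)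
  finally show ?thesis
    by (simp only: integral_mult_right_zero jost_op_def rest_def phase_int_def set_lebesgue_integral_def w_def add.commute)
qed

lemma borel_sol_wave:
  assumes k: "0 \<le> Im k" and E: "in_L2 lborel E"
  shows "borel_sol (\<lambda>x. \<i> * exp (\<i> * k * of_real x) * indicator {0<..} x + E x) h m \<longleftrightarrow> jost_eq k E h m"
proof -
  have "conv (\<lambda>x. \<i> * exp (\<i> * k * of_real x) * indicator {0<..} x + E x) m x = jost_op k E m x"
    if m: "m \<in> borel_measurable borel" "bounded (range m)" for x
  proof -
    obtain C where "\<And>x. cmod (m x) \<le> C" using m(2) unfolding bounded_iff by blast
    then show ?thesis by (rule conv_wave[OF k E m(1)])
  qed
  then show ?thesis
    unfolding borel_sol_def jost_eq_iff by auto
qed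

text \<open>Without a wave there is no Volterra part: the operator itself has norm at most 1/2 in
  the supremum norm, and absorption works directly.\<close>

lemma borel_sol_small:
  assumes E: "in_L2 lborel E" and m: "borel_sol E (\<lambda>_. 1) m" and small: "L2_nrm E * L2_nrm u \<le> 1 / 2"
  shows "cmod (m x - 1) \<le> 2 * (L2_nrm E * L2_nrm u)"
proof -
  have mm: "m \<in> borel_measurable borel" and bd: "bounded (range m)" and eq: "m x = 1 + rest E m x" for x
    using m unfolding borel_sol_def conv_def rest_def by blast+
  define S where "S = (SUP x. cmod (m x))"
  have bdd: "bdd_above (range (\<lambda>x. cmod (m x)))"
  proof -
    obtain C where "\<And>x. norm (m x) \<le> C"
      using bd unfolding bounded_iff by blast
    then show ?thesis by (intro bdd_aboveI2)
  qed
  have S: "cmod (m x) \<le> S" for x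
    unfolding S_def by (rule cSUP_upper[OF _ bdd]) simp
  have rb: "cmod (rest E m x) \<le> (L2_nrm E * L2_nrm u) * S" for x
    using rest_bound[OF E mm S] by (simp add: mult.assoc)
  have S0: "0 \<le> S" using S[of 0] norm_ge_zero order_trans by blast
  have "cmod (m x) \<le> 1 + 1 / 2 * S" for x
  proof -
    have "cmod (m x) \<le> 1 + cmod (rest E m x)"
      by (subst eq) (rule order_trans[OF norm_triangle_ineq], simp)
    also have "cmod (rest E m x) \<le> 1 / 2 * S"
      by (rule order_trans[OF rb mult_right_mono[OF small S0]])
    finally show ?thesis by simp
  qed
  then have "S \<le> 1 + 1 / 2 * S"
    unfolding S_def[of] by (intro cSUP_least) (auto simp: S_def)
  then have "S \<le> 2" by simp
  have "cmod (m x - 1) = cmod (rest E m x)"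
    by (subst eq) simp
  also have "\<dots> \<le> (L2_nrm E * L2_nrm u) * 2"
    by (rule order_trans[OF rb mult_left_mono[OF \<open>S \<le> 2\<close>]]) simp
  finally show ?thesis by simp
qed

lemma half_kernel_uniform_limit:
  assumes e: "0 < e"
  shows "\<exists>B. \<forall>\<kappa> K m. B \<le> \<kappa> \<longrightarrow> half_kernel \<kappa> K \<longrightarrow> borel_sol K (\<lambda>_. 1) m \<longrightarrow> (\<forall>x. cmod (m x - 1) \<le> e)"
proof -
  obtain d B where d: "0 < d" and dB: "\<And>k E m x. 0 \<le> Im k \<Longrightarrow> B \<le> cmod k \<Longrightarrow> in_L2 lborel E \<Longrightarrow> L2_nrm E \<le> d \<Longrightarrow>
    jost_eq k E (\<lambda>_. 1) m \<Longrightarrow> cmod (m x - 1) \<le> e"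
    using jost_1_uniform_limit[OF e] by blast
  \<comment> \<open>The entry \<open>d\<close> serves kernels with a wave. The other two serve
    kernels without one: operator norm at most 1/2, and final error at most e.\<close>
  define d' where "d' = min d (min (1 / (2 * (L2_nrm u + 1))) (e / (2 * (L2_nrm u + 1))))"
  have u0: "0 < L2_nrm u + 1" by (simp add: add_nonneg_pos)
  have d'0: "0 < d'" using d e u0 by (simp add: d'_def)
  have d'u: "d' * L2_nrm u \<le> 1 / 2" "2 * (d' * L2_nrm u) \<le> e"
  proof -
    have "d' * L2_nrm u \<le> 1 / (2 * (L2_nrm u + 1)) * (L2_nrm u + 1)"
      using u0 d'0 by (intro mult_mono) (auto simp: d'_def)
    also have "\<dots> = 1 / 2" using u0 by (simp add: field_simps)
    finally show "d' * L2_nrm u \<le> 1 / 2" .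
    have "d' * L2_nrm u \<le> e / (2 * (L2_nrm u + 1)) * (L2_nrm u + 1)"
      using u0 d'0 by (intro mult_mono) (auto simp: d'_def)
    also have "\<dots> = e / 2" using u0 by (simp add: field_simps)
    finally show "2 * (d' * L2_nrm u) \<le> e" by simp
  qed
  show ?thesis
  proof (intro exI allI impI)
    fix \<kappa> K m x
    assume \<kappa>: "max 1 (max B ((6 / d')\<^sup>2)) \<le> \<kappa>" and K: "half_kernel \<kappa> K" and m: "borel_sol K (\<lambda>_. 1) m"
    have "6 / d' \<le> sqrt \<kappa>"
      using \<kappa> by (intro real_le_rsqrt) auto
    then have sq: "6 / sqrt \<kappa> \<le> d'"
      using \<kappa> d'0 by (simp add: pos_divide_le_eq mult.commute)
    from K obtain k E where k: "0 \<le> Im k" "cmod k = \<kappa>" and E: "in_L2 lborel E" "L2_nrm E \<le> 6 / sqrt \<kappa>"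
      and KE: "K = (\<lambda>x. \<i> * exp (\<i> * k * of_real x) * indicator {0<..} x + E x) \<or> K = E"
      unfolding half_kernel_def by blast
    have Ed: "L2_nrm E \<le> d'" using E(2) sq by simp
    from KE show "cmod (m x - 1) \<le> e"
    proof
      assume "K = (\<lambda>x. \<i> * exp (\<i> * k * of_real x) * indicator {0<..} x + E x)"
      then have "jost_eq k E (\<lambda>_. 1) m"
        using m borel_sol_wave[OF k(1) E(1)] by simp
      moreover have "L2_nrm E \<le> d" using Ed by (simp add: d'_def)
      ultimately show ?thesis
        using dB[OF k(1) _ E(1)] k(2) \<kappa> by simp
    next
      assume KE: "K = E"
      have le: "L2_nrm E * L2_nrm u \<le> d' * L2_nrm u"
        using Ed by (rule mult_right_mono) simp
      have "cmod (m x - 1) \<le> 2 * (L2_nrm E * L2_nrm u)"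
        using m le d'u(1) unfolding KE by (intro borel_sol_small[OF E(1)]) auto
      then show ?thesis using le d'u(2) by linarith
    qed
  qed
qed

end

lemma potential_reflect:
  assumes "potential u" shows "potential (\<lambda>x. u (- x))"
proof
  show "integrable lborel (\<lambda>x. u (- x))"
    using lborel_integrable_real_affine[OF potential.u_int[OF assms], of "-1" 0] by simp
  show "in_L2 lborel (\<lambda>x. u (- x))"
    using in_L2_reflect[OF potential.u_L2[OF assms], of 0] by simp
qed

text \<open>As u is real, conjugating the equation at - x and substituting y -> - y in the integral
  leads to the kernel K and the potential u (- x). The transformation preserves the distance of the
  solution from 1.\<close>

lemma borel_sol_reflect:
  assumes u: "potential u" and m: "potential.borel_sol u (\<lambda>x. cnj (K (- x))) (\<lambda>_. 1) m"
  shows "potential.borel_sol (\<lambda>x. u (- x)) K (\<lambda>_. 1) (\<lambda>x. cnj (m (- x)))"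
proof -
  interpret potential u by (rule u)
  interpret r: potential "\<lambda>x. u (- x)" by (rule potential_reflect[OF u])
  have mm: "m \<in> borel_measurable borel" and bd: "bounded (range m)" and eq: "m x = 1 + conv (\<lambda>x. cnj (K (- x))) m x" for x
    using m unfolding borel_sol_def by blast+
  have meas: "(\<lambda>x. cnj (m (- x))) \<in> borel_measurable borel"
    by (rule measurable_compose[where f="\<lambda>x. m (- x)" and g=cnj and N=borel])
      (use mm in measurable, intro borel_measurable_continuous_onI continuous_intros)
  obtain C where C: "\<And>x. cmod (m x) \<le> C" using bd unfolding bounded_iff by blast
  have sol: "cnj (m (- x)) = 1 + r.conv K (\<lambda>x. cnj (m (- x))) x" for x
  proof -
    have "cnj (m (- x)) = 1 + (LINT y|lborel. K (x + y) * (of_real (u y) * cnj (m y)))"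
      by (subst eq) (simp add: conv_def add.commute flip: Bochner_Integration.integral_cnj)
    also have "(LINT y|lborel. K (x + y) * (of_real (u y) * cnj (m y))) = r.conv K (\<lambda>x. cnj (m (- x))) x"
      unfolding r.conv_def
      using lborel_integral_real_affine[of "-1" "\<lambda>y. K (x + y) * (of_real (u y) * cnj (m y))" 0] by simp
    finally show ?thesis .
  qed
  have bnd: "bounded (range (\<lambda>x. cnj (m (- x))))"
    unfolding bounded_iff using C by (intro exI[of _ C]) auto
  show ?thesis
    unfolding r.borel_sol_def by (intro conjI allI meas bnd sol)
qed

section \<open>From Lebesgue classes to Borel functions\<close>

text \<open>The square is (1 + |x|)^(-2 s) with 2 s > 1; it is dominated by two shifted copies of
  the power on [1, \<infinity>), one of them reflected.\<close>

lemma weight_L2: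
  assumes "1 / 2 < (s :: real)"
  shows "in_L2 lborel (\<lambda>x. (1 + \<bar>x\<bar>) powr (- s))"
proof -
  define e where "e = - (2 * s)"
  have e: "e < -1" using assms by (simp add: e_def)
  have "(\<lambda>x. x powr e) integrable_on {1..}"
    using has_integral_powr_to_inf[OF e, of 1] by (auto simp: integrable_on_def)
  then have "(\<lambda>x. x powr e) absolutely_integrable_on {1..}"
    by (rule nonnegative_absolutely_integrable_1) auto
  then have "integrable lebesgue (\<lambda>x. indicator {1..} x *\<^sub>R x powr e)"
    by (simp add: set_integrable_def)
  then have i: "integrable lborel (\<lambda>x. indicator {1..} x *\<^sub>R x powr e)"
    by (subst (asm) integrable_completion) auto
  have i2: "integrable lborel (\<lambda>x. indicator {1..} (1 + 1 * x) *\<^sub>R (1 + 1 * x) powr e + indicator {1..} (1 + (-1) * x) *\<^sub>R (1 + (-1) * x) powr e)"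
    by (intro Bochner_Integration.integrable_add lborel_integrable_real_affine[OF i]) auto
  have sq: "(norm ((1 + \<bar>x\<bar>) powr (- s)))\<^sup>2 = (1 + \<bar>x\<bar>) powr e" for x :: real
    by (simp add: e_def power2_eq_square flip: powr_add)
  have le: "norm ((norm ((1 + \<bar>x\<bar>) powr (- s)))\<^sup>2) \<le> norm (indicator {1..} (1 + 1 * x) *\<^sub>R (1 + 1 * x) powr e + indicator {1..} (1 + (-1) * x) *\<^sub>R (1 + (-1) * x) powr e)" for x :: real
    unfolding sq by (cases "0 \<le> x") (auto simp: indicator_def)
  have "integrable lborel (\<lambda>x. (norm ((1 + \<bar>x\<bar>) powr (- s)))\<^sup>2)"
    by (rule Bochner_Integration.integrable_bound[OF i2 _ AE_I2[OF le]]) measurable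
  then show ?thesis
    unfolding in_L2_def by (intro conjI) measurable
qed

lemma one_plus_abs_nonzero [simp]: "1 + \<bar>x :: real\<bar> \<noteq> 0"
  using abs_add_one_gt_zero[of x] by linarith

lemma weight_cancel: "(1 + \<bar>x\<bar>) powr (- r) *\<^sub>R weighted r f x = f x"
  using abs_add_one_gt_zero[of x] by (auto simp: weighted_def simp flip: powr_add)

lemma Linf_norm_nonneg: "0 \<le> Linf_norm (lebesgue :: real measure) f"
proof -
  have "esssup (lebesgue :: real measure) (\<lambda>_. 0 :: ereal) \<le> esssup lebesgue (\<lambda>x. ereal (norm (f x)))"
    by (rule esssup_mono) auto
  moreover have "esssup (lebesgue :: real measure) (\<lambda>_. 0 :: ereal) = 0"
    by (rule esssup_const) (simp add: emeasure_completion)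
  ultimately show ?thesis
    by (simp add: Linf_norm_def)
qed

lemma Linf_norm_le:
  assumes "f \<in> borel_measurable lebesgue" "AE x in lborel. norm (f x) \<le> c"
  shows "Linf_norm lebesgue f \<le> ereal c"
  unfolding Linf_norm_def
proof (rule esssup_I)
  show "(\<lambda>x. ereal (norm (f x))) \<in> borel_measurable lebesgue"
    using assms(1) by measurable
  show "AE x in lebesgue. ereal (norm (f x)) \<le> ereal c"
    using AE_completion[OF assms(2)] by simp
qed

lemma in_Linf_bound:
  assumes "in_Linf (lebesgue :: real measure) f"
  obtains C where "AE x in lborel. norm (f x) \<le> C"
proof -
  have fin: "Linf_norm lebesgue f < \<infinity>" using assms by (simp add: in_Linf_def)
  have "AE x in lebesgue. ereal (norm (f x)) \<le> Linf_norm lebesgue f"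
    unfolding Linf_norm_def by (rule esssup_AE)
  moreover have "Linf_norm lebesgue f = ereal (real_of_ereal (Linf_norm lebesgue f))"
    using fin Linf_norm_nonneg[of f] by (intro ereal_real'[symmetric]) auto
  ultimately have "AE x in lebesgue. norm (f x) \<le> real_of_ereal (Linf_norm lebesgue f)"
    by (metis (mono_tags, lifting) eventually_mono ereal_less_eq(3))
  then show thesis
    using that by (simp add: AE_completion_iff)
qed

lemma lebesgue_ex_borel_complex:
  fixes f :: "real \<Rightarrow> complex"
  assumes "f \<in> borel_measurable lebesgue"
  obtains g where "g \<in> borel_measurable borel" "AE x in lborel. f x = g x"
proof -
  have "(\<lambda>x. Re (f x)) \<in> borel_measurable lebesgue" "(\<lambda>x. Im (f x)) \<in> borel_measurable lebesgue"
    using assms by measurable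
  from this[THEN completion_ex_borel_measurable_real] obtain a b
    where ab: "a \<in> borel_measurable lborel" "AE x in lborel. Re (f x) = a x"
      "b \<in> borel_measurable lborel" "AE x in lborel. Im (f x) = b x"
    by blast
  note [measurable] = ab(1,3)
  show thesis
  proof (rule that[of "\<lambda>x. Complex (a x) (b x)"])
    show "(\<lambda>x. Complex (a x) (b x)) \<in> borel_measurable borel"
      unfolding Complex_eq by measurable
    show "AE x in lborel. f x = Complex (a x) (b x)"
      using ab(2,4) by eventually_elim (simp add: complex_eq_iff)
  qed
qed

text \<open>\<open>u\<close> is the representative that occurs in the Jost equations, measurable for
  the completed measure; \<open>u0\<close> is a Borel version of it, to which product measures and
  the analysis of \<open>potential\<close> apply.\<close>

locale jost_setting =
  fixes s s1 :: real and u u0 :: "real \<Rightarrow> real"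
  assumes s1: "1 / 2 < s1" "s1 < s"
    and u_lebesgue: "u \<in> borel_measurable lebesgue"
    and u0_borel: "u0 \<in> borel_measurable borel"
    and u_ae: "AE x in lborel. u x = u0 x"
    and u0_weighted: "in_L2 lborel (weighted s u0)"
begin

text \<open>Write w = 1 + |x|. Then |u0| w^t is w^s |u0| times w^(t - s), and the latter is in L2
  because s - t > 1/2. For t = s - s1, the growth allowed to Jost solutions, this is the condition
  s1 > 1/2; t = 0 puts \<open>u0\<close> itself into L1 and L2.\<close>

lemma weighted_product:
  assumes t: "0 \<le> t" "t < s - 1 / 2" and f: "f \<in> borel_measurable borel"
    and le: "AE y in lborel. cmod (f y) \<le> C * (\<bar>u0 y\<bar> * (1 + \<bar>y\<bar>) powr t)"
  shows "integrable lborel f" "in_L2 lborel f"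
proof -
  have w: "in_L2 lborel (\<lambda>x. (1 + \<bar>x\<bar>) powr (- (s - t)))"
    by (rule weight_L2) (use t in simp)
  have int: "integrable lborel (\<lambda>x. C * (norm (weighted s u0 x) * norm ((1 + \<bar>x\<bar>) powr (- (s - t)))))"
    by (intro integrable_mult_right in_L2_mult_integrable u0_weighted w)
  have e1: "norm (weighted s u0 x) * norm ((1 + \<bar>x\<bar>) powr (- (s - t))) = \<bar>u0 x\<bar> * (1 + \<bar>x\<bar>) powr t" for x
    by (simp add: weighted_def abs_mult flip: powr_add)
  show "integrable lborel f"
  proof (rule Bochner_Integration.integrable_bound[OF int])
    show "AE x in lborel. norm (f x) \<le> norm (C * (norm (weighted s u0 x) * norm ((1 + \<bar>x\<bar>) powr (- (s - t)))))"
      unfolding e1 using le by eventually_elim (simp only: real_norm_def abs_ge_self order_trans[OF _ abs_ge_self])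
  qed (use f in simp)
  have int2: "integrable lborel (\<lambda>x. C\<^sup>2 * (norm (weighted s u0 x))\<^sup>2)"
    using u0_weighted by (simp add: in_L2_def)
  have "integrable lborel (\<lambda>x. (norm (f x))\<^sup>2)"
  proof (rule Bochner_Integration.integrable_bound[OF int2])
    show "AE x in lborel. norm ((norm (f x))\<^sup>2) \<le> norm (C\<^sup>2 * (norm (weighted s u0 x))\<^sup>2)"
      using le
    proof eventually_elim
      case (elim x)
      have "\<bar>u0 x\<bar> * (1 + \<bar>x\<bar>) powr t \<le> norm (weighted s u0 x)"
      proof -
        have "(1 + \<bar>x\<bar>) powr t \<le> (1 + \<bar>x\<bar>) powr s"
          using t by (intro powr_mono) auto
        from mult_left_mono[OF this, of "\<bar>u0 x\<bar>"] show ?thesis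
          by (simp add: weighted_def abs_mult mult.commute)
      qed
      moreover have "norm (f x) \<le> \<bar>C\<bar> * (\<bar>u0 x\<bar> * (1 + \<bar>x\<bar>) powr t)"
        using elim by (rule order_trans) (intro mult_right_mono abs_ge_self mult_nonneg_nonneg, auto)
      ultimately have "norm (f x) \<le> \<bar>C\<bar> * norm (weighted s u0 x)"
        by (meson abs_ge_zero mult_left_mono order_trans)
      from power_mono[OF this norm_ge_zero, of 2] show ?case
        by (simp add: power_mult_distrib)
    qed
  qed (use f in measurable)
  then show "in_L2 lborel f"
    using f by (simp add: in_L2_def)
qed

sublocale potential u0
proof
  have *: "(\<lambda>x. complex_of_real (u0 x)) \<in> borel_measurable borel"
    by (rule measurable_compose[OF u0_borel borel_measurable_continuous_onI]) (intro continuous_intros)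
  have "AE y in lborel. cmod (complex_of_real (u0 y)) \<le> 1 * (\<bar>u0 y\<bar> * (1 + \<bar>y\<bar>) powr 0)"
    by (rule AE_I2) simp
  note w = weighted_product[of 0, OF _ _ * this]
  have "integrable lborel (\<lambda>x. Re (complex_of_real (u0 x)))"
    by (intro integrable_Re w(1)) (use s1 in auto)
  then show "integrable lborel u0" by simp
  have "in_L2 lborel (\<lambda>x. complex_of_real (u0 x))"
    by (rule w(2)) (use s1 in auto)
  then show "in_L2 lborel u0"
    using u0_borel by (simp add: in_L2_def)
qed

lemma solves_jost_lebesgue:
  assumes "solves_jost r u p h m"
  shows "m \<in> borel_measurable lebesgue"
proof -
  have [measurable]: "weighted (- r) m \<in> borel_measurable lebesgue"
    using assms by (simp add: solves_jost_def in_Linf_def)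
  have [measurable]: "(\<lambda>x::real. (1 + \<bar>x\<bar>) powr r) \<in> borel_measurable lebesgue"
    by (rule measurable_completion) measurable
  have "(\<lambda>x. (1 + \<bar>x\<bar>) powr r *\<^sub>R weighted (- r) m x) \<in> borel_measurable lebesgue"
    by measurable
  also have "(\<lambda>x. (1 + \<bar>x\<bar>) powr r *\<^sub>R weighted (- r) m x) = m"
    using weight_cancel[of _ "- r" m] by (simp add: fun_eq_iff)
  finally show ?thesis .
qed

lemma convolution_eq_conv:
  assumes m: "m \<in> borel_measurable lebesgue" and m0: "m0 \<in> borel_measurable borel" and ae: "AE x in lborel. m x = m0 x"
    and K: "K \<in> borel_measurable borel" and G: "\<And>x. x \<noteq> 0 \<Longrightarrow> G_kernel p x = K x"
  shows "Defs.convolution (G_kernel p) (\<lambda>y. of_real (u y) * m y) x = conv K m0 x"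
proof -
  have uc: "(\<lambda>y. complex_of_real (u y)) \<in> borel_measurable lebesgue"
    by (rule measurable_compose[OF u_lebesgue borel_measurable_continuous_onI]) (intro continuous_intros)
  note [measurable] = m0 K
  have KB: "(\<lambda>y. K (x - y) * (of_real (u0 y) * m0 y)) \<in> borel_measurable borel"
    by measurable
  have "G_kernel p = (\<lambda>z. if z = 0 then G_kernel p 0 else K z)"
    using G by auto
  moreover have "(\<lambda>z. if z = 0 then G_kernel p 0 else K z) \<in> borel_measurable borel"
    by measurable
  ultimately have [measurable]: "G_kernel p \<in> borel_measurable borel" by simp
  have "(\<lambda>y. G_kernel p (x - y)) \<in> borel_measurable lebesgue"
    by (rule measurable_completion) measurable
  then have GB: "(\<lambda>y. G_kernel p (x - y) * (of_real (u y) * m y)) \<in> borel_measurable lebesgue"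
    using uc m by (intro borel_measurable_times)
  have "Defs.convolution (G_kernel p) (\<lambda>y. of_real (u y) * m y) x = (LINT y|lebesgue. K (x - y) * (of_real (u0 y) * m0 y))"
    unfolding Defs.convolution_def
  proof (rule integral_cong_AE)
    have "AE y in lborel. G_kernel p (x - y) * (of_real (u y) * m y) = K (x - y) * (of_real (u0 y) * m0 y)"
      using ae u_ae AE_lborel_singleton[of x] by eventually_elim (simp add: G)
    then show "AE y in lebesgue. G_kernel p (x - y) * (of_real (u y) * m y) = K (x - y) * (of_real (u0 y) * m0 y)"
      by (rule AE_completion)
    show "(\<lambda>y. K (x - y) * (of_real (u0 y) * m0 y)) \<in> borel_measurable lebesgue"
      by (rule measurable_completion) (use KB in simp)
  qed (rule GB)
  also have "\<dots> = conv K m0 x"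
    unfolding conv_def by (rule integral_completion) (use KB in simp)
  finally show ?thesis .
qed

lemma conv_integrable:
  assumes K: "half_kernel \<kappa> K" and w: "integrable lborel w" "in_L2 lborel w"
  shows "integrable lborel (\<lambda>y. K (x - y) * w y)"
    and "\<exists>B. \<forall>x. cmod (LINT y|lborel. K (x - y) * w y) \<le> B"
proof -
  obtain E where E: "in_L2 lborel E" and le: "\<And>x. cmod (K x) \<le> 1 + cmod (E x)"
    using half_kernel_split[OF K] by blast
  note [measurable] = half_kernel_measurable[OF K]
  have [measurable]: "w \<in> borel_measurable borel" using w by auto
  have En: "in_L2 lborel (\<lambda>x. cmod (E x))" and wn: "in_L2 lborel (\<lambda>x. cmod (w x))"
    using E w by (auto simp: in_L2_def)
  note conv = integral_convolution_bound[OF En wn]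
  have dom: "integrable lborel (\<lambda>y. cmod (w y) + cmod (E (x - y)) * cmod (w y))" for x
    using w(1) conv(1) by (intro Bochner_Integration.integrable_add integrable_norm)
  have le': "norm (K (x - y) * w y) \<le> cmod (w y) + cmod (E (x - y)) * cmod (w y)" for x y
    using mult_right_mono[OF le[of "x - y"], of "cmod (w y)"] by (simp add: norm_mult algebra_simps)
  have le'': "norm (K (x - y) * w y) \<le> norm (cmod (w y) + cmod (E (x - y)) * cmod (w y))" for x y
    using le'[of x y] by (rule order_trans) (simp only: real_norm_def abs_ge_self)
  show int: "integrable lborel (\<lambda>y. K (x - y) * w y)" for x
    by (rule Bochner_Integration.integrable_bound[OF dom _ AE_I2[OF le'']]) measurable
  have "cmod (LINT y|lborel. K (x - y) * w y) \<le> (LINT y|lborel. cmod (w y)) + L2_nrm (\<lambda>x. cmod (E x)) * L2_nrm (\<lambda>x. cmod (w x))" for x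
  proof -
    have "cmod (LINT y|lborel. K (x - y) * w y) \<le> (LINT y|lborel. cmod (w y) + cmod (E (x - y)) * cmod (w y))"
      by (rule order_trans[OF integral_norm_bound integral_mono[OF integrable_norm[OF int] dom le']])
    also have "\<dots> = (LINT y|lborel. cmod (w y)) + (LINT y|lborel. cmod (E (x - y)) * cmod (w y))"
      using w(1) conv(1) by (intro Bochner_Integration.integral_add integrable_norm)
    also have "(LINT y|lborel. cmod (E (x - y)) * cmod (w y)) \<le> L2_nrm (\<lambda>x. cmod (E x)) * L2_nrm (\<lambda>x. cmod (w x))"
      using conv(2)[of x] by (simp only: real_norm_def abs_le_iff)
    finally show ?thesis by simp
  qed
  then show "\<exists>B. \<forall>x. cmod (LINT y|lborel. K (x - y) * w y) \<le> B" by blast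
qed

text \<open>Isolates what the transfer between Lebesgue classes and Borel functions asks of a
  kernel, so that it covers a half kernel and its reflected conjugate alike.\<close>

definition good_kernel :: "(real \<Rightarrow> complex) \<Rightarrow> bool"
  where "good_kernel K \<longleftrightarrow> K \<in> borel_measurable borel \<and> (\<forall>w. integrable lborel w \<longrightarrow> in_L2 lborel w \<longrightarrow>
    (\<forall>x. integrable lborel (\<lambda>y. K (x - y) * w y)) \<and> (\<exists>B. \<forall>x. cmod (LINT y|lborel. K (x - y) * w y) \<le> B))"

lemma good_kernel_half: "half_kernel \<kappa> K \<Longrightarrow> good_kernel K"
  unfolding good_kernel_def using conv_integrable half_kernel_measurable by blast

lemma good_kernel_reflect:
  assumes K: "half_kernel \<kappa> K" shows "good_kernel (\<lambda>x. cnj (K (- x)))"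
proof -
  have Km: "K \<in> borel_measurable borel" by (rule half_kernel_measurable[OF K])
  have cm: "(\<lambda>x. cnj (K (- x))) \<in> borel_measurable borel"
    by (rule measurable_compose[where f="\<lambda>x. K (- x)" and g=cnj and N=borel])
      (use Km in measurable, intro borel_measurable_continuous_onI continuous_intros)
  have key: "integrable lborel (\<lambda>y. cnj (K (- (x - y))) * w y)
     \<and> (LINT y|lborel. cnj (K (- (x - y))) * w y) = cnj (LINT y|lborel. K (- x - y) * cnj (w (- y)))"
    if w: "integrable lborel w" "in_L2 lborel w" for w x
  proof -
    have wr: "integrable lborel (\<lambda>y. cnj (w (- y)))"
      using lborel_integrable_real_affine[OF w(1), of "-1" 0] by simp
    have "in_L2 lborel (\<lambda>y. cnj (w (- y)))"
      using in_L2_reflect[OF w(2), of 0] borel_measurable_integrable[OF wr] by (simp add: in_L2_def)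
    from conv_integrable(1)[OF K wr this, of "- x"]
    have i: "integrable lborel (\<lambda>y. cnj (K (- x - y) * cnj (w (- y))))"
      by (simp only: complex_integrable_cnj)
    from lborel_integrable_real_affine[OF i, of "-1" 0]
    have "integrable lborel (\<lambda>y. cnj (K (- (x - y))) * w y)" by (simp add: add.commute)
    moreover have "cnj (LINT y|lborel. K (- x - y) * cnj (w (- y))) = (LINT y|lborel. cnj (K (- x - y) * cnj (w (- y))))"
      by (rule Bochner_Integration.integral_cnj[symmetric])
    moreover have "(LINT y|lborel. cnj (K (- x - y) * cnj (w (- y)))) = (LINT y|lborel. cnj (K (- (x - y))) * w y)"
      using lborel_integral_real_affine[of "-1" "\<lambda>y. cnj (K (- x - y) * cnj (w (- y)))" 0] by (simp add: add.commute)
    ultimately show ?thesis by simp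
  qed
  have bound: "\<exists>B. \<forall>x. cmod (LINT y|lborel. K (- x - y) * cnj (w (- y))) \<le> B"
    if w: "integrable lborel w" "in_L2 lborel w" for w
  proof -
    have wr: "integrable lborel (\<lambda>y. cnj (w (- y)))"
      using lborel_integrable_real_affine[OF w(1), of "-1" 0] by simp
    have "in_L2 lborel (\<lambda>y. cnj (w (- y)))"
      using in_L2_reflect[OF w(2), of 0] borel_measurable_integrable[OF wr] by (simp add: in_L2_def)
    from conv_integrable(2)[OF K wr this] show ?thesis by blast
  qed
  show ?thesis
    unfolding good_kernel_def
  proof (intro conjI cm allI impI)
    fix w :: "real \<Rightarrow> complex" and x :: real
    assume w: "integrable lborel w" "in_L2 lborel w"
    show "integrable lborel (\<lambda>y. cnj (K (- (x - y))) * w y)"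
      using key[OF w] by blast
    obtain B where B: "\<And>x. cmod (LINT y|lborel. K (- x - y) * cnj (w (- y))) \<le> B"
      using bound[OF w] by blast
    have "cmod (LINT y|lborel. cnj (K (- (x - y))) * w y) \<le> B" for x
      using B[of x] by (simp only: key[OF w, THEN conjunct2] complex_mod_cnj)
    then show "\<exists>B. \<forall>x. cmod (LINT y|lborel. cnj (K (- (x - y))) * w y) \<le> B"
      by blast
  qed
qed

text \<open>Regularity from the equation: m grows at most like (1 + |x|)^(s - s1), so u m is in L1
  and L2 and its convolution is bounded. The right side is therefore a bounded Borel representative
  of m, and as convolution ignores null sets, it solves the equation at every point.\<close>

lemma borel_representative:
  assumes m: "solves_jost (s - s1) u p h m" and K: "good_kernel K" and G: "\<And>x. x \<noteq> 0 \<Longrightarrow> G_kernel p x = K x"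
    and h: "h \<in> borel_measurable borel" "\<And>x. cmod (h x) \<le> 1"
  obtains m' where "borel_sol K h m'" "AE x in lborel. m x = m' x"
proof -
  have mL: "m \<in> borel_measurable lebesgue"
    by (rule solves_jost_lebesgue[OF m])
  obtain m0 where m0: "m0 \<in> borel_measurable borel" and m0_ae: "AE x in lborel. m x = m0 x"
    by (rule lebesgue_ex_borel_complex[OF mL])
  note [measurable] = m0 h(1)
  have [measurable]: "K \<in> borel_measurable borel" using K by (simp add: good_kernel_def)
  obtain C where C: "AE x in lborel. norm (weighted (- (s - s1)) m x) \<le> C"
    using m in_Linf_bound unfolding solves_jost_def by blast
  have bnd: "AE y in lborel. cmod (of_real (u0 y) * m0 y) \<le> C * (\<bar>u0 y\<bar> * (1 + \<bar>y\<bar>) powr (s - s1))"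
    using C m0_ae
  proof eventually_elim
    case (elim y)
    have "m y = (1 + \<bar>y\<bar>) powr (s - s1) *\<^sub>R weighted (- (s - s1)) m y"
      using weight_cancel[of y "- (s - s1)" m] by simp
    then have "cmod (m y) = (1 + \<bar>y\<bar>) powr (s - s1) * norm (weighted (- (s - s1)) m y)"
      by (metis norm_scaleR abs_of_nonneg powr_ge_zero)
    also have "\<dots> \<le> (1 + \<bar>y\<bar>) powr (s - s1) * C"
      using elim(1) by (rule mult_left_mono) simp
    finally have "\<bar>u0 y\<bar> * cmod (m y) \<le> \<bar>u0 y\<bar> * ((1 + \<bar>y\<bar>) powr (s - s1) * C)"
      by (rule mult_left_mono) simp
    then show ?case
      using elim(2) by (simp add: norm_mult mult_ac)
  qed
  have um_meas: "(\<lambda>y. of_real (u0 y) * m0 y) \<in> borel_measurable borel"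
    by measurable
  have w: "integrable lborel (\<lambda>y. of_real (u0 y) * m0 y)" "in_L2 lborel (\<lambda>y. of_real (u0 y) * m0 y)"
    by (rule weighted_product[OF _ _ um_meas bnd]; use s1 in simp)+
  then obtain B where B: "\<And>x. cmod (conv K m0 x) \<le> B"
    using K unfolding good_kernel_def conv_def by blast
  define m' where "m' x = h x + conv K m0 x" for x
  have [measurable]: "m' \<in> borel_measurable borel"
    unfolding m'_def[abs_def] conv_def by measurable
  have "AE x in lebesgue. m x = h x + Defs.convolution (G_kernel p) (\<lambda>y. of_real (u y) * m y) x"
    using m by (simp add: solves_jost_def)
  then have "AE x in lborel. m x = h x + Defs.convolution (G_kernel p) (\<lambda>y. of_real (u y) * m y) x"
    by (simp only: AE_completion_iff)
  moreover have "Defs.convolution (G_kernel p) (\<lambda>y. of_real (u y) * m y) x = conv K m0 x" for x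
    by (rule convolution_eq_conv[OF mL m0 m0_ae \<open>K \<in> borel_measurable borel\<close> G])
  ultimately have ae: "AE x in lborel. m x = m' x"
    by (simp only: m'_def)
  have "conv K m0 x = conv K m' x" for x
    unfolding conv_def
  proof (rule integral_cong_AE)
    show "AE y in lborel. K (x - y) * (of_real (u0 y) * m0 y) = K (x - y) * (of_real (u0 y) * m' y)"
      using ae m0_ae by eventually_elim simp
  qed measurable
  then have "m' x = h x + conv K m' x" for x
    unfolding m'_def[of x] by simp
  moreover have "bounded (range m')"
    unfolding bounded_iff
  proof (intro exI ballI)
    fix z assume "z \<in> range m'"
    then show "norm z \<le> 1 + B"
      using norm_triangle_mono[OF h(2) B] by (auto simp: m'_def)
  qed
  ultimately have "borel_sol K h m'"
    unfolding borel_sol_def by simp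
  with ae that show thesis by blast
qed

text \<open>Bounded functions lie in the weighted space because s1 < s. This converse makes the
  uniqueness in \<open>is_jost\<close> applicable to Borel solutions.\<close>

lemma solves_jost_borel_sol:
  assumes m: "borel_sol K h m" and K: "good_kernel K" and G: "\<And>x. x \<noteq> 0 \<Longrightarrow> G_kernel p x = K x"
  shows "solves_jost (s - s1) u p h m"
proof -
  have mm [measurable]: "m \<in> borel_measurable borel" and bd: "bounded (range m)" and eq: "\<And>x. m x = h x + conv K m x"
    using m unfolding borel_sol_def by blast+
  have Km: "K \<in> borel_measurable borel" using K by (simp add: good_kernel_def)
  have mL: "m \<in> borel_measurable lebesgue" by (rule measurable_completion) measurable
  obtain C where C: "\<And>x. cmod (m x) \<le> C" using bd unfolding bounded_iff by blast
  have wL: "weighted (- (s - s1)) m \<in> borel_measurable lebesgue"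
    unfolding weighted_def[abs_def] by (rule measurable_completion) measurable
  have "norm (weighted (- (s - s1)) m x) \<le> C" for x
  proof -
    have "(1 + \<bar>x\<bar>) powr (- (s - s1)) \<le> (1 + \<bar>x\<bar>) powr 0"
      using s1 by (intro powr_mono) auto
    then have "(1 + \<bar>x\<bar>) powr (- (s - s1)) * cmod (m x) \<le> 1 * C"
      using C[of x] by (intro mult_mono) auto
    then show ?thesis by (simp add: weighted_def)
  qed
  then have "Linf_norm lebesgue (weighted (- (s - s1)) m) \<le> ereal C"
    by (intro Linf_norm_le wL AE_I2)
  then have "in_Linf lebesgue (weighted (- (s - s1)) m)"
    using wL by (auto simp: in_Linf_def intro: le_less_trans)
  moreover have "Defs.convolution (G_kernel p) (\<lambda>y. of_real (u y) * m y) x = conv K m x" for x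
    by (rule convolution_eq_conv[OF mL mm _ Km G]) simp
  ultimately show ?thesis
    unfolding solves_jost_def using eq by simp
qed

text \<open>By linearity, n added to the Jost solution solves the same inhomogeneous problem in the
  same space. Uniqueness there makes the homogeneous equation trivial.\<close>

lemma borel_sol_unique:
  assumes jost: "is_jost (s - s1) u p h m" and K: "good_kernel K" and G: "\<And>x. x \<noteq> 0 \<Longrightarrow> G_kernel p x = K x"
    and h: "h \<in> borel_measurable borel" "\<And>x. cmod (h x) \<le> 1" and n: "borel_sol K (\<lambda>_. 0) n"
  shows "AE x in lborel. n x = 0"
proof -
  have "solves_jost (s - s1) u p h m" using jost by (simp add: is_jost_def)
  from borel_representative[OF this K G h] obtain m' where m': "borel_sol K h m'" and ae: "AE x in lborel. m x = m' x"
    by blast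
  have m'm [measurable]: "m' \<in> borel_measurable borel" and m'b: "bounded (range m')" and m'eq: "\<And>x. m' x = h x + conv K m' x"
    using m' unfolding borel_sol_def by blast+
  have nm [measurable]: "n \<in> borel_measurable borel" and nb: "bounded (range n)" and neq: "\<And>x. n x = 0 + conv K n x"
    using n unfolding borel_sol_def by blast+
  obtain C where C: "\<And>x. cmod (m' x) \<le> C" using m'b unfolding bounded_iff by blast
  obtain D where D: "\<And>x. cmod (n x) \<le> D" using nb unfolding bounded_iff by blast
  have i: "integrable lborel (\<lambda>y. K (x - y) * (of_real (u0 y) * m' y))" "integrable lborel (\<lambda>y. K (x - y) * (of_real (u0 y) * n y))" for x
    using K integrable_um(1,3)[OF m'm C] integrable_um(1,3)[OF nm D] unfolding good_kernel_def by blast+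
  have "conv K (\<lambda>x. m' x + n x) x = conv K m' x + conv K n x" for x
    using Bochner_Integration.integral_add[OF i[of x]] by (simp add: conv_def distrib_left)
  then have eq: "m' x + n x = h x + conv K (\<lambda>x. m' x + n x) x" for x
    using m'eq[of x] neq[of x] by simp
  have bnd: "bounded (range (\<lambda>x. m' x + n x))"
    unfolding bounded_iff using norm_triangle_mono[OF C D] by blast
  then have "borel_sol K h (\<lambda>x. m' x + n x)"
    unfolding borel_sol_def by (intro conjI allI borel_measurable_add[OF m'm nm] bnd eq)
  from solves_jost_borel_sol[OF this K G]
  have "AE x in lebesgue. m' x + n x = m x"
    using jost by (simp add: is_jost_def)
  then have "AE x in lborel. m' x + n x = m x"
    by (simp add: AE_completion_iff)
  with ae show ?thesis
    by eventually_elim simp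
qed

text \<open>The uniform limit is invoked for \<open>u0\<close> and for its reflection; the larger
  threshold then covers all kernels of the cut plane. The norm is an extended real, so its
  convergence is read off from order bounds.\<close>

lemma jost_1_limit:
  assumes m: "\<And>p. p \<in> cut_plane \<Longrightarrow> R < cut_abs p \<Longrightarrow> is_jost_1 (s - s1) u p (m1 p)"
  shows "((\<lambda>k. Linf_norm lebesgue (\<lambda>x. m1 k x - 1)) \<longlongrightarrow> 0) cut_infinity"
proof -
  interpret r: potential "\<lambda>x. u0 (- x)"
    by (rule potential_reflect) (rule potential_axioms)
  have main: "\<exists>B. \<forall>p\<in>cut_plane. B \<le> cut_abs p \<longrightarrow> Linf_norm lebesgue (\<lambda>x. m1 p x - 1) \<le> ereal e" if e: "0 < e" for e
  proof -
    obtain B1 where B1: "\<And>\<kappa> K m x. B1 \<le> \<kappa> \<Longrightarrow> half_kernel \<kappa> K \<Longrightarrow> borel_sol K (\<lambda>_. 1) m \<Longrightarrow> cmod (m x - 1) \<le> e"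
      using half_kernel_uniform_limit[OF e] by blast
    obtain B2 where B2: "\<And>\<kappa> K m x. B2 \<le> \<kappa> \<Longrightarrow> half_kernel \<kappa> K \<Longrightarrow> r.borel_sol K (\<lambda>_. 1) m \<Longrightarrow> cmod (m x - 1) \<le> e"
      using r.half_kernel_uniform_limit[OF e] by blast
    show ?thesis
    proof (intro exI ballI impI)
      \<comment> \<open>The entry R + 1 secures the strict inequality beyond which the Jost
        solutions are given.\<close>
      fix p assume p: "p \<in> cut_plane" and large: "max (R + 1) (max B1 B2) \<le> cut_abs p"
      have "is_jost_1 (s - s1) u p (m1 p)"
        by (rule m[OF p]) (use large in simp)
      then have sol: "solves_jost (s - s1) u p (\<lambda>_. 1) (m1 p)"
        by (simp add: is_jost_1_def is_jost_def)
      have mL: "m1 p \<in> borel_measurable lebesgue"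
        by (rule solves_jost_lebesgue[OF sol])
      have one: "(\<lambda>_::real. 1 :: complex) \<in> borel_measurable borel" "cmod 1 \<le> 1"
        by auto
      obtain K where K: "half_kernel (cut_abs p) K"
        and G: "(\<forall>x. x \<noteq> 0 \<longrightarrow> G_kernel p x = K x) \<or> (\<forall>x. x \<noteq> 0 \<longrightarrow> G_kernel p x = cnj (K (- x)))"
        using G_kernel_half_kernel[OF p] by blast
      obtain m' where m': "\<And>x. cmod (m' x - 1) \<le> e" and ae: "AE x in lborel. m1 p x = m' x"
        using G
      proof
        assume "\<forall>x. x \<noteq> 0 \<longrightarrow> G_kernel p x = K x"
        then have G': "\<And>x. x \<noteq> 0 \<Longrightarrow> G_kernel p x = K x" by blast
        obtain m' where m': "borel_sol K (\<lambda>_. 1) m'" "AE x in lborel. m1 p x = m' x"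
          by (rule borel_representative[OF sol good_kernel_half[OF K] G' one])
        show thesis
        proof (rule that)
          show "cmod (m' x - 1) \<le> e" for x
            by (rule B1[OF _ K m'(1)]) (use large in simp)
        qed (rule m'(2))
      next
        assume "\<forall>x. x \<noteq> 0 \<longrightarrow> G_kernel p x = cnj (K (- x))"
        then have G': "\<And>x. x \<noteq> 0 \<Longrightarrow> G_kernel p x = cnj (K (- x))" by blast
        obtain m' where m': "borel_sol (\<lambda>x. cnj (K (- x))) (\<lambda>_. 1) m'" "AE x in lborel. m1 p x = m' x"
          by (rule borel_representative[OF sol good_kernel_reflect[OF K] G' one])
        have refl: "r.borel_sol K (\<lambda>_. 1) (\<lambda>x. cnj (m' (- x)))"
          by (rule borel_sol_reflect[OF potential_axioms m'(1)])
        show thesis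
        proof (rule that)
          fix x
          have "cmod (cnj (m' (- (- x))) - 1) \<le> e"
            by (rule B2[OF _ K refl]) (use large in simp)
          then have "cmod (cnj (m' x - 1)) \<le> e" by simp
          then show "cmod (m' x - 1) \<le> e" by (simp only: complex_mod_cnj)
        qed (rule m'(2))
      qed
      show "Linf_norm lebesgue (\<lambda>x. m1 p x - 1) \<le> ereal e"
      proof (rule Linf_norm_le)
        show "(\<lambda>x. m1 p x - 1) \<in> borel_measurable lebesgue"
          using mL by (intro borel_measurable_diff) auto
        show "AE x in lborel. norm (m1 p x - 1) \<le> e"
          using ae by eventually_elim (simp add: m')
      qed
    qed
  qed
  show ?thesis
  proof (rule order_tendstoI)
    fix c :: ereal assume "c < 0"
    then show "\<forall>\<^sub>F k in cut_infinity. c < Linf_norm lebesgue (\<lambda>x. m1 k x - 1)"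
      using Linf_norm_nonneg by (intro always_eventually allI) (rule less_le_trans)
  next
    fix c :: ereal assume "0 < c"
    then obtain e where e: "0 < ereal e" "ereal e < c"
      using ereal_dense2 by blast
    then obtain B where B: "\<And>p. p \<in> cut_plane \<Longrightarrow> B \<le> cut_abs p \<Longrightarrow> Linf_norm lebesgue (\<lambda>x. m1 p x - 1) \<le> ereal e"
      using main[of e] by auto
    show "\<forall>\<^sub>F k in cut_infinity. Linf_norm lebesgue (\<lambda>x. m1 k x - 1) < c"
      unfolding cut_infinity_def eventually_inf_principal eventually_filtercomap_at_top_linorder
      using B e(2) by (intro exI[of _ B] allI impI) (rule le_less_trans)
  qed
qed

lemma edge_representative:
  assumes l: "0 < l" and h: "h \<in> borel_measurable borel" "\<And>x. cmod (h x) \<le> 1"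
    and m: "is_jost (s - s1) u (Upper l) h m"
  shows "\<exists>m'. jost_eq (of_real l) (edge_kernel (of_real l)) h m' \<and> (AE x in lborel. m x = m' x)"
    and "jost_eq (of_real l) (edge_kernel (of_real l)) (\<lambda>_. 0) n \<Longrightarrow> AE x in lborel. n x = 0"
proof -
  let ?K = "\<lambda>x. \<i> * exp (\<i> * of_real l * of_real x) * indicator {0<..} x + edge_kernel (of_real l) x"
  have "half_kernel (cmod (of_real l)) ?K"
    using l by (intro half_kernel_edge) auto
  then have K: "good_kernel ?K"
    by (rule good_kernel_half)
  have G: "G_kernel (Upper l) x = ?K x" if "x \<noteq> 0" for x
    using G_tilde_eq[OF l that] by (simp add: mult.assoc)
  have wave: "borel_sol ?K g f \<longleftrightarrow> jost_eq (of_real l) (edge_kernel (of_real l)) g f" for g f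
    by (rule borel_sol_wave[OF _ edge_kernel_L2(1)[OF l]]) simp
  have "solves_jost (s - s1) u (Upper l) h m"
    using m by (simp add: is_jost_def)
  from borel_representative[OF this K G h] obtain m' where "borel_sol ?K h m'" "AE x in lborel. m x = m' x"
    by blast
  then show "\<exists>m'. jost_eq (of_real l) (edge_kernel (of_real l)) h m' \<and> (AE x in lborel. m x = m' x)"
    unfolding wave by blast
  assume "jost_eq (of_real l) (edge_kernel (of_real l)) (\<lambda>_. 0) n"
  then have "borel_sol ?K (\<lambda>_. 0) n"
    unfolding wave .
  from borel_sol_unique[OF m K G h this] show "AE x in lborel. n x = 0" .
qed

lemma fourier_um_eq:
  assumes m: "m \<in> borel_measurable lebesgue" and m': "m' \<in> borel_measurable borel" and ae: "AE x in lborel. m x = m' x"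
  shows "(LINT x|lebesgue. of_real (u x) * m x * exp (- (\<i> * of_real (l * x)))) = fourier (\<lambda>x. of_real (u0 x) * m' x) l"
proof -
  have uc: "(\<lambda>y. complex_of_real (u y)) \<in> borel_measurable lebesgue"
    by (rule measurable_compose[OF u_lebesgue borel_measurable_continuous_onI]) (intro continuous_intros)
  have eL: "(\<lambda>x. exp (- (\<i> * of_real (l * x)))) \<in> borel_measurable lebesgue"
    by (rule measurable_completion) measurable
  note [measurable] = m'
  have B: "(\<lambda>x. of_real (u0 x) * m' x * exp (- (\<i> * of_real (l * x)))) \<in> borel_measurable lborel"
    by measurable
  have "(LINT x|lebesgue. of_real (u x) * m x * exp (- (\<i> * of_real (l * x)))) = (LINT x|lebesgue. of_real (u0 x) * m' x * exp (- (\<i> * of_real (l * x))))"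
  proof (rule integral_cong_AE)
    show "(\<lambda>x. of_real (u x) * m x * exp (- (\<i> * of_real (l * x)))) \<in> borel_measurable lebesgue"
      by (intro borel_measurable_times uc m eL)
    have "AE x in lborel. of_real (u x) * m x * exp (- (\<i> * of_real (l * x))) = of_real (u0 x) * m' x * exp (- (\<i> * of_real (l * x)))"
      using ae u_ae by eventually_elim simp
    then show "AE x in lebesgue. of_real (u x) * m x * exp (- (\<i> * of_real (l * x))) = of_real (u0 x) * m' x * exp (- (\<i> * of_real (l * x)))"
      by (rule AE_completion)
  qed (rule measurable_completion[OF B])
  also have "\<dots> = (LINT x|lborel. of_real (u0 x) * m' x * exp (- (\<i> * of_real (l * x))))"
    by (rule integral_completion[OF B])
  finally show ?thesis
    by (simp add: fourier_def)
qed

lemma integral_u_eq: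
  assumes A: "A \<in> sets borel"
  shows "(LINT t:A|lebesgue. u t) = (LINT t:A|lborel. u0 t)"
  unfolding set_lebesgue_integral_def
proof -
  have AL: "A \<in> sets lebesgue" using A by auto
  have B: "(\<lambda>t. indicator A t *\<^sub>R u0 t) \<in> borel_measurable lborel"
    using A by measurable
  have "(LINT t|lebesgue. indicator A t *\<^sub>R u t) = (LINT t|lebesgue. indicator A t *\<^sub>R u0 t)"
  proof (rule integral_cong_AE)
    show "(\<lambda>t. indicator A t *\<^sub>R u t) \<in> borel_measurable lebesgue"
      using AL u_lebesgue by (intro borel_measurable_scaleR borel_measurable_indicator)
    have "AE t in lborel. indicator A t *\<^sub>R u t = indicator A t *\<^sub>R u0 t"
      using u_ae by eventually_elim simp
    then show "AE t in lebesgue. indicator A t *\<^sub>R u t = indicator A t *\<^sub>R u0 t"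
      by (rule AE_completion)
  qed (rule measurable_completion[OF B])
  then show "(LINT t|lebesgue. indicator A t *\<^sub>R u t) = (LINT t|lborel. indicator A t *\<^sub>R u0 t)"
    using integral_completion[OF B] by simp
qed

lemma U_eq: "(LINT t:{..x}|lebesgue. u t) = U x"
  unfolding U_def by (rule integral_u_eq) simp

lemma U_inf_eq: "(LINT t|lebesgue. u t) = U_inf"
  using integral_u_eq[of UNIV] by (simp add: U_inf_def set_lebesgue_integral_def)

lemma jost_e_limit:
  assumes me: "\<And>l. 0 < l \<Longrightarrow> is_jost_e (s - s1) u l (me l)"
  shows "((\<lambda>l. Linf_norm lebesgue (\<lambda>x. me l x - iexp (l * x) * iexp (LINT t:{..x}|lebesgue. u t))) \<longlongrightarrow> 0) at_top"
    and "(\<lambda>l. Gamma_coeff u me l - iexp (LINT t|lebesgue. u t)) \<in> O[at_top](\<lambda>l. of_real (1 / l))"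
proof -
  have rep: "\<exists>m'. jost_eq (of_real l) (edge_kernel (of_real l)) (plane_wave l) m' \<and> (AE x in lborel. me l x = m' x)"
    and meL: "me l \<in> borel_measurable lebesgue" if l: "0 < l" for l
  proof -
    have j: "is_jost (s - s1) u (Upper l) (plane_wave l) (me l)"
      using me[OF l] by (simp add: is_jost_e_def plane_wave_def[abs_def])
    show "\<exists>m'. jost_eq (of_real l) (edge_kernel (of_real l)) (plane_wave l) m' \<and> (AE x in lborel. me l x = m' x)"
      by (rule edge_representative(1)[OF l plane_wave_measurable _ j]) simp
    show "me l \<in> borel_measurable lebesgue"
      using j solves_jost_lebesgue unfolding is_jost_def by blast
  qed
  define C where "C = 2 * (1 + u_L1nrm)\<^sup>2 * L2_nrm u0 * pi"
  have large: "\<forall>\<^sub>F l in at_top. 0 < l \<and> smallness_threshold \<le> l"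
    by (intro eventually_conj eventually_gt_at_top eventually_ge_at_top)
  have bound: "Linf_norm lebesgue (\<lambda>x. me l x - iexp (l * x) * iexp (LINT t:{..x}|lebesgue. u t)) \<le> ereal (C / sqrt l)"
    if l: "0 < l" "smallness_threshold \<le> l" for l
  proof (rule Linf_norm_le)
    obtain m' where m': "jost_eq (of_real l) (edge_kernel (of_real l)) (plane_wave l) m'" and ae: "AE x in lborel. me l x = m' x"
      using rep[OF l(1)] by blast
    have "(\<lambda>x. plane_wave l x * iexp (U x)) \<in> borel_measurable lebesgue"
      by (rule measurable_completion) measurable
    then show "(\<lambda>x. me l x - iexp (l * x) * iexp (LINT t:{..x}|lebesgue. u t)) \<in> borel_measurable lebesgue"
      unfolding U_eq plane_wave_def using meL[OF l(1)] by (intro borel_measurable_diff)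
    have "cmod (m' x - plane_wave l x * iexp (U x)) \<le> C / sqrt l" for x
    proof -
      have "cmod (m' x - plane_wave l x * iexp (U x)) \<le> 2 * (1 + u_L1nrm)\<^sup>2 * (L2_nrm u0 * L2_nrm (edge_kernel (of_real l)))"
        by (rule jost_e_approx[OF edge_kernel_L2(1)[OF l(1)] m' edge_small[OF l]])
      also have "\<dots> \<le> 2 * (1 + u_L1nrm)\<^sup>2 * (L2_nrm u0 * (pi / sqrt l))"
        using edge_kernel_L2(2)[OF l(1)] by (intro mult_left_mono) auto
      finally show ?thesis by (simp add: C_def)
    qed
    then show "AE x in lborel. cmod (me l x - iexp (l * x) * iexp (LINT t:{..x}|lebesgue. u t)) \<le> C / sqrt l"
      using ae unfolding U_eq plane_wave_def by (auto elim!: eventually_mono)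
  qed
  show "((\<lambda>l. Linf_norm lebesgue (\<lambda>x. me l x - iexp (l * x) * iexp (LINT t:{..x}|lebesgue. u t))) \<longlongrightarrow> 0) at_top"
  proof (rule tendsto_sandwich)
    show "\<forall>\<^sub>F l in at_top. 0 \<le> Linf_norm lebesgue (\<lambda>x. me l x - iexp (l * x) * iexp (LINT t:{..x}|lebesgue. u t))"
      by (intro always_eventually allI Linf_norm_nonneg)
    show "\<forall>\<^sub>F l in at_top. Linf_norm lebesgue (\<lambda>x. me l x - iexp (l * x) * iexp (LINT t:{..x}|lebesgue. u t)) \<le> ereal (C / sqrt l)"
      using large by (rule eventually_mono) (blast intro: bound)
    have "((\<lambda>l. C / sqrt l) \<longlongrightarrow> 0) at_top" by real_asymp
    then show "((\<lambda>l. ereal (C / sqrt l)) \<longlongrightarrow> 0) at_top"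
      by (simp add: zero_ereal_def)
  qed simp
  show "(\<lambda>l. Gamma_coeff u me l - iexp (LINT t|lebesgue. u t)) \<in> O[at_top](\<lambda>l. of_real (1 / l))"
  proof (rule bigoI)
    show "\<forall>\<^sub>F l in at_top. norm (Gamma_coeff u me l - iexp (LINT t|lebesgue. u t)) \<le> 2 * (1 + u_L1nrm) * (L2_nrm u0)\<^sup>2 * norm (complex_of_real (1 / l))"
      using large
    proof (rule eventually_mono)
      fix l assume l: "0 < l \<and> smallness_threshold \<le> l"
      obtain m' where m': "jost_eq (of_real l) (edge_kernel (of_real l)) (plane_wave l) m'" and ae: "AE x in lborel. me l x = m' x"
        using rep[of l] l by blast
      have m'm: "m' \<in> borel_measurable borel" using m' unfolding jost_eq_def by blast
      have "Gamma_coeff u me l = 1 + \<i> * fourier (\<lambda>x. of_real (u0 x) * m' x) l"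
        unfolding Gamma_coeff_def using fourier_um_eq[OF meL m'm ae] l by simp
      then show "norm (Gamma_coeff u me l - iexp (LINT t|lebesgue. u t)) \<le> 2 * (1 + u_L1nrm) * (L2_nrm u0)\<^sup>2 * norm (complex_of_real (1 / l))"
        using gamma_estimate[of l m'] l m' by (simp add: U_inf_eq norm_divide)
    qed
  qed
qed

text \<open>Representatives are chosen for each l separately, without any regularity in l. The
  coefficient depends on the class alone and equals \<i> times the continuous
  \<open>scattering_coeff\<close>, so the choice does no harm.\<close>

lemma beta_properties:
  assumes m1: "\<And>l. 0 < l \<Longrightarrow> is_jost_1 (s - s1) u (Upper l) (m1 (Upper l))"
  shows "0 < a \<Longrightarrow> in_L2 (lebesgue_on {a<..}) (beta_coeff u m1)" and "(beta_coeff u m1 \<longlongrightarrow> 0) at_top"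
proof -
  have one: "(\<lambda>_::real. 1 :: complex) \<in> borel_measurable borel" "cmod 1 \<le> 1"
    by auto
  have j: "is_jost (s - s1) u (Upper l) (\<lambda>_. 1) (m1 (Upper l))" if "0 < l" for l
    using m1[OF that] by (simp add: is_jost_1_def)
  have "\<forall>l. \<exists>m'. 0 < l \<longrightarrow> jost_eq (of_real l) (edge_kernel (of_real l)) (\<lambda>_. 1) m' \<and> (AE x in lborel. m1 (Upper l) x = m' x)"
    using edge_representative(1)[OF _ one j] by blast
  then obtain m' where m': "\<And>l. 0 < l \<Longrightarrow> jost_eq (of_real l) (edge_kernel (of_real l)) (\<lambda>_. 1) (m' l)"
    and ae: "\<And>l. 0 < l \<Longrightarrow> AE x in lborel. m1 (Upper l) x = m' l x"
    by metis
  interpret edge_family u0 m'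
  proof
    show "jost_eq (of_real l) (edge_kernel (of_real l)) (\<lambda>_. 1) (m' l)" if "0 < l" for l
      by (rule m'[OF that])
    show "AE x in lborel. n x = 0" if l: "0 < l" and n: "jost_eq (of_real l) (edge_kernel (of_real l)) (\<lambda>_. 0) n" for l n
      by (rule edge_representative(2)[OF l one j[OF l] n])
  qed
  have eq: "beta_coeff u m1 l = \<i> * scattering_coeff l" if l: "0 < l" for l
  proof -
    have "m1 (Upper l) \<in> borel_measurable lebesgue"
      using j[OF l] solves_jost_lebesgue unfolding is_jost_def by blast
    from fourier_um_eq[OF this sol_measurable[OF l] ae[OF l], of l] show ?thesis
      by (simp add: beta_coeff_def scattering_coeff_def)
  qed
  show "in_L2 (lebesgue_on {a<..}) (beta_coeff u m1)" if a: "0 < a"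
  proof -
    have "in_L2 (lebesgue_on {a<..}) scattering_coeff"
      by (rule scattering_coeff_L2[OF a])
    moreover have "beta_coeff u m1 x = \<i> * scattering_coeff x" if "x \<in> space (lebesgue_on {a<..})" for x
      using eq[of x] that a by simp
    moreover have "beta_coeff u m1 \<in> borel_measurable (lebesgue_on {a<..}) \<longleftrightarrow> (\<lambda>x. \<i> * scattering_coeff x) \<in> borel_measurable (lebesgue_on {a<..})"
      by (rule measurable_cong) (rule calculation(2))
    moreover have "integrable (lebesgue_on {a<..}) (\<lambda>x. (norm (beta_coeff u m1 x))\<^sup>2) \<longleftrightarrow> integrable (lebesgue_on {a<..}) (\<lambda>x. (norm (scattering_coeff x))\<^sup>2)"
      by (rule Bochner_Integration.integrable_cong[OF refl]) (simp add: calculation(2) norm_mult)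
    ultimately show ?thesis
      unfolding in_L2_def by (auto intro: borel_measurable_times)
  qed
  have "((\<lambda>l. \<i> * scattering_coeff l) \<longlongrightarrow> \<i> * 0) at_top"
    by (intro tendsto_mult tendsto_const scattering_coeff_tendsto)
  then have "((\<lambda>l. \<i> * scattering_coeff l) \<longlongrightarrow> 0) at_top"
    by simp
  then show "(beta_coeff u m1 \<longlongrightarrow> 0) at_top"
    by (rule Lim_transform_eventually)
      (use eq in \<open>auto intro: eventually_mono[OF eventually_gt_at_top[of 0]]\<close>)
qed

end

theorem theorem6p3:
  fixes s s1 :: real
    and u :: "real \<Rightarrow> real"
    and m1 :: "cut_point \<Rightarrow> real \<Rightarrow> complex"
    and me :: "real \<Rightarrow> real \<Rightarrow> complex"
  assumes s: "s > 1 / 2"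
    and s1: "1 / 2 < s1" "s1 < s"
    and u: "in_L2 lebesgue (weighted s u)"
    and m1_edges: "\<And>l. l > 0 \<Longrightarrow> is_jost_1 (s - s1) u (Upper l) (m1 (Upper l))"
      "\<And>l. l > 0 \<Longrightarrow> is_jost_1 (s - s1) u (Lower l) (m1 (Lower l))"
    and m1_off: "\<exists>R. \<forall>k. k \<notin> complex_of_real ` {0..} \<and> cmod k > R \<longrightarrow>
      is_jost_1 (s - s1) u (Interior k) (m1 (Interior k))"
    and me: "\<And>l. l > 0 \<Longrightarrow> is_jost_e (s - s1) u l (me l)"
  shows "((\<lambda>k. Linf_norm lebesgue (\<lambda>x. m1 k x - 1)) \<longlongrightarrow> 0) cut_infinity
    \<and> ((\<lambda>l. Linf_norm lebesgue (\<lambda>x. me l x -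
          exp (\<i> * of_real (l * x)) * exp (\<i> * of_real (LINT t:{..x}|lebesgue. u t))))
        \<longlongrightarrow> 0) at_top
    \<and> (\<lambda>l. Gamma_coeff u me l - exp (\<i> * of_real (LINT t|lebesgue. u t)))
        \<in> O[at_top](\<lambda>l. of_real (1 / l))
    \<and> (\<forall>a>0. in_L2 (lebesgue_on {a<..}) (beta_coeff u m1))
    \<and> (beta_coeff u m1 \<longlongrightarrow> 0) at_top"
proof -
  have [measurable]: "weighted s u \<in> borel_measurable lebesgue"
    using u by (simp add: in_L2_def)
  have [measurable]: "(\<lambda>x::real. (1 + \<bar>x\<bar>) powr (- s)) \<in> borel_measurable lebesgue"
    by (rule measurable_completion) measurable
  have "(\<lambda>x. (1 + \<bar>x\<bar>) powr (- s) *\<^sub>R weighted s u x) \<in> borel_measurable lebesgue"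
    by measurable
  then have uL: "u \<in> borel_measurable lebesgue"
    by (simp only: weight_cancel)
  \<comment> \<open>Passing to a Borel version changes neither the weighted norm nor any integral in
    the statement, and places the potential in the setting of Borel functions.\<close>
  obtain u0 where u0: "u0 \<in> borel_measurable lborel" and ae: "AE x in lborel. u x = u0 x"
    using completion_ex_borel_measurable_real[OF uL] by blast
  have u0B [measurable]: "u0 \<in> borel_measurable borel" using u0 by simp
  have wB: "weighted s u0 \<in> borel_measurable borel"
    unfolding weighted_def[abs_def] by measurable
  have wsB: "(\<lambda>x. (norm (weighted s u0 x))\<^sup>2) \<in> borel_measurable lborel"
    using wB by measurable
  have "integrable lebesgue (\<lambda>x. (norm (weighted s u x))\<^sup>2) \<longleftrightarrow> integrable lebesgue (\<lambda>x. (norm (weighted s u0 x))\<^sup>2)"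
  proof (rule integrable_cong_AE)
    show "(\<lambda>x. (norm (weighted s u x))\<^sup>2) \<in> borel_measurable lebesgue"
      by measurable
    show "(\<lambda>x. (norm (weighted s u0 x))\<^sup>2) \<in> borel_measurable lebesgue"
      by (rule measurable_completion[OF wsB])
    have "AE x in lborel. (norm (weighted s u x))\<^sup>2 = (norm (weighted s u0 x))\<^sup>2"
      using ae by eventually_elim (simp add: weighted_def)
    then show "AE x in lebesgue. (norm (weighted s u x))\<^sup>2 = (norm (weighted s u0 x))\<^sup>2"
      by (rule AE_completion)
  qed
  then have "integrable lborel (\<lambda>x. (norm (weighted s u0 x))\<^sup>2)"
    using u integrable_completion[OF wsB] by (simp add: in_L2_def)
  then have w: "in_L2 lborel (weighted s u0)"
    using wB by (simp add: in_L2_def)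
  interpret jost_setting s s1 u u0
    by (rule jost_setting.intro[OF s1 uL u0B ae w])
  obtain R where R: "\<And>k. k \<notin> complex_of_real ` {0..} \<Longrightarrow> cmod k > R \<Longrightarrow> is_jost_1 (s - s1) u (Interior k) (m1 (Interior k))"
    using m1_off by blast
  have "is_jost_1 (s - s1) u p (m1 p)" if "p \<in> cut_plane" "R < cut_abs p" for p
    using that R m1_edges by (cases p) (auto simp: cut_plane_def)
  from jost_1_limit[of R m1, OF this] show ?thesis
    using jost_e_limit[of me, OF me] beta_properties[of m1, OF m1_edges(1)] by blast
qed

end
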